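(* Let $C$ be a non-singular projective curve over an algebraically closed field $\kappa$ of characteristic zero, $D$ a divisor on $C$ of rank $r\ge 0$, $\mathcal L=\mathcal L(D)$, $L=\Gamma(C,\mathcal L)$, and $\mathcal F=\{f_0,\dots,f_r\}$ a basis of $L$. Let $\eta:C\to\mathbb P(L)$ be the map sending $P$ to the line $\ell_P\subseteq L$ spanned by a rational function $f_P\in L$ such that $D+\mathrm{div}(f_P)$ is the $P$-reduced divisor linearly equivalent to $D$. Then $\eta$ coincides (on all of $C$) with the morphism $C\to\mathbb P^r\cong\mathbb P(L)$ (the identification via the basis $\mathcal F$) defined by the sections $(-1)^0\mathrm{Wr}_{\mathcal F_0},\dots,(-1)^r\mathrm{Wr}_{\mathcal F_r}$ of $\mathcal L^{\otimes r}\otimes\Omega^{\otimes r(r-1)/2}$, extended to the whole of $C$.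
   Context: $L$ is identified with the vector space of rational functions $f$ with $D+\mathrm{div}(f)\ge0$ (together with $0$), of dimension $r+1$. A divisor $D'\sim D$ is $P$-reduced if all its coefficients outside $P$ are non-negative and its coefficient at $P$ is maximal among divisors linearly equivalent to $D$ with this property; it exists and is unique, so the line $\ell_P$ is well defined. $\Omega$ is the invertible sheaf of differentials on $C$. Wronskians: for a family $\mathcal G=\{g_1,\dots,g_s\}$ of linearly independent elements of $L$ and a point $P$ with local parameter $\tau$ and local generator $g_P$ of $\mathcal L_P$, write $g_{j|P}=g_{j,P}\,g_P$ with $g_{j,P}\in\mathcal O_P$, define $g^{(0)}_{j,P}=g_{j,P}$ and $g^{(k+1)}_{j,P}$ by $dg^{(k)}_{j,P}=g^{(k+1)}_{j,P}d\tau$; then $\mathrm{Wr}_{\mathcal G,P}=\det\big(g^{(k)}_{j,P}\big)_{j=1..s,\,k=0..s-1}\,g_P^{s}\,(d\tau)^{s(s-1)/2}$, and these local sections glue to a nonzero global section $\mathrm{Wr}_{\mathcal G}$ of $\mathcal L^{\otimes s}\otimes\Omega^{\otimes s(s-1)/2}$ independent of the choices. For $0\le i\le r$, $\mathcal F_i=\mathcal F\setminus\{f_i\}$ (in its induced order), so $\mathrm{Wr}_{\mathcal F_i}\in\Gamma(C,\mathcal L^{\otimes r}\otimes\Omega^{\otimes r(r-1)/2})$. The morphism defined by these sections sends a generic point $P$ to $[(-1)^0\mathrm{Wr}_{\mathcal F_0}(P):\dots:(-1)^r\mathrm{Wr}_{\mathcal F_r}(P)]$ and is extended to all of $C$ (as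 a morphism from a smooth curve). *)

theory Defs
  imports
    "HOL-Library.Poly_Mapping"
    "HOL-Computational_Algebra.Computational_Algebra"
    "Jordan_Normal_Form.Determinant"
begin

section \<open>Polynomials and forms\<close>

type_synonym 'a mpoly = "(nat \<Rightarrow>\<^sub>0 nat) \<Rightarrow>\<^sub>0 'a"

text \<open>Evaluation at \<open>x\<close>, the coefficients being transported along \<open>h\<close>.\<close>

definition eval_via :: "('a::zero \<Rightarrow> 'b::comm_semiring_1) \<Rightarrow> 'a mpoly \<Rightarrow> (nat \<Rightarrow> 'b) \<Rightarrow> 'b" where
  "eval_via h p x = (\<Sum>m\<in>Poly_Mapping.keys p.
     h (Poly_Mapping.lookup p m) * (\<Prod>i\<in>Poly_Mapping.keys m. x i ^ Poly_Mapping.lookup m i))"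

abbreviation eval :: "'a::comm_semiring_1 mpoly \<Rightarrow> (nat \<Rightarrow> 'a) \<Rightarrow> 'a" where
  "eval \<equiv> eval_via (\<lambda>c. c)"

definition vars_below :: "nat \<Rightarrow> 'a::zero mpoly \<Rightarrow> bool" where
  "vars_below N p \<longleftrightarrow> (\<forall>m\<in>Poly_Mapping.keys p. Poly_Mapping.keys m \<subseteq> {..<N})"

definition homogeneous :: "nat \<Rightarrow> 'a::zero mpoly \<Rightarrow> bool" where
  "homogeneous d p \<longleftrightarrow>
     (\<forall>m\<in>Poly_Mapping.keys p. (\<Sum>i\<in>Poly_Mapping.keys m. Poly_Mapping.lookup m i) = d)"

definition forms :: "nat \<Rightarrow> nat \<Rightarrow> 'a::zero mpoly set" where
  "forms n d = {p. vars_below (Suc n) p \<and> homogeneous d p}"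

section \<open>Projective space and its Zariski topology\<close>

text \<open>Points of projective \<open>n\<close>-space are lines through the origin in the space of vectors
  \<open>(x\<^sub>0, \<dots>, x\<^sub>n)\<close>, encoded as functions on \<^typ>\<open>nat\<close> that vanish beyond \<open>n\<close>.\<close>

type_synonym 'a point = "(nat \<Rightarrow> 'a) set"

definition proj_point :: "(nat \<Rightarrow> 'a::field) \<Rightarrow> 'a point" where
  "proj_point v = {(\<lambda>i. c * v i) | c. True}"

definition proj_space :: "nat \<Rightarrow> 'a::field point set" where
  "proj_space n = {proj_point v | v. (\<forall>i>n. v i = 0) \<and> (\<exists>i. v i \<noteq> 0)}"

definition vanishes_at :: "'a::field mpoly \<Rightarrow> 'a point \<Rightarrow> bool" where
  "vanishes_at p P \<longleftrightarrow> (\<forall>v\<in>P. eval p v = 0)"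

definition algebraic_set :: "nat \<Rightarrow> 'a::field point set \<Rightarrow> bool" where
  "algebraic_set n Z \<longleftrightarrow>
     (\<exists>S \<subseteq> (\<Union>d. forms n d). Z = {P \<in> proj_space n. \<forall>p\<in>S. vanishes_at p P})"

definition irreducible_set :: "nat \<Rightarrow> 'a::field point set \<Rightarrow> bool" where
  "irreducible_set n X \<longleftrightarrow> X \<noteq> {} \<and>
     (\<forall>Z1 Z2. algebraic_set n Z1 \<and> algebraic_set n Z2 \<and> X = Z1 \<union> Z2 \<longrightarrow> X = Z1 \<or> X = Z2)"

section \<open>Projective varieties with their function field\<close>

text \<open>The function field is carried by an arbitrary field type \<^typ>\<open>'k\<close>; \<open>frac C F G\<close> is the
  rational function \<open>F/G\<close>, for forms \<open>F\<close>, \<open>G\<close> of the same degree with \<open>G\<close> not vanishing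
  identically on the variety.  The predicate \<open>function_field\<close> below says that \<^typ>\<open>'k\<close> is, up to
  isomorphism, the field of all these fractions.\<close>

record (overloaded) ('a, 'k) variety =
  amb_dim :: nat
  points :: "'a point set"
  frac :: "'a mpoly \<Rightarrow> 'a mpoly \<Rightarrow> 'k"

definition is_fraction ::
    "('a::field, 'k) variety \<Rightarrow> 'a mpoly \<Rightarrow> 'a mpoly \<Rightarrow> bool" where
  "is_fraction C F G \<longleftrightarrow>
     (\<exists>d. F \<in> forms (amb_dim C) d \<and> G \<in> forms (amb_dim C) d) \<and>
     (\<exists>P\<in>points C. \<not> vanishes_at G P)"

definition function_field :: "('a::field, 'k::field) variety \<Rightarrow> bool" where
  "function_field C \<longleftrightarrow>
     (\<forall>f. \<exists>F G. is_fraction C F G \<and> f = frac C F G) \<and>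
     (\<forall>F G F' G'. is_fraction C F G \<and> is_fraction C F' G' \<longrightarrow>
        (frac C F G = frac C F' G' \<longleftrightarrow> (\<forall>P\<in>points C. vanishes_at (F * G' - F' * G) P)) \<and>
        frac C F G + frac C F' G' = frac C (F * G' + F' * G) (G * G') \<and>
        frac C F G * frac C F' G' = frac C (F * F') (G * G'))"

definition projective_variety :: "('a::field, 'k::field) variety \<Rightarrow> bool" where
  "projective_variety C \<longleftrightarrow>
     algebraic_set (amb_dim C) (points C) \<and> irreducible_set (amb_dim C) (points C) \<and>
     function_field C"

definition const_fun :: "('a::field, 'k::field) variety \<Rightarrow> 'a \<Rightarrow> 'k" where
  "const_fun C c = frac C (Poly_Mapping.single 0 c) 1"

definition scale_fun :: "('a::field, 'k::field) variety \<Rightarrow> 'a \<Rightarrow> 'k \<Rightarrow> 'k" where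
  "scale_fun C c f = const_fun C c * f"

definition alg_independent ::
    "('a::field, 'k::field) variety \<Rightarrow> nat \<Rightarrow> (nat \<Rightarrow> 'k) \<Rightarrow> bool" where
  "alg_independent C N x \<longleftrightarrow>
     (\<forall>p. vars_below N p \<and> eval_via (const_fun C) p x = 0 \<longrightarrow> p = 0)"

text \<open>The dimension of a variety is the transcendence degree of its function field.\<close>

definition has_dimension :: "('a::field, 'k::field) variety \<Rightarrow> nat \<Rightarrow> bool" where
  "has_dimension C N \<longleftrightarrow>
     (\<exists>x. alg_independent C N x) \<and> \<not> (\<exists>x. alg_independent C (Suc N) x)"

section \<open>Local rings, non-singular curves\<close>

definition local_ring :: "('a::field, 'k::field) variety \<Rightarrow> 'a point \<Rightarrow> 'k set" where
  "local_ring C P = {frac C F G | F G. is_fraction C F G \<and> \<not> vanishes_at G P}"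

text \<open>The value at \<open>P\<close> of a function regular at \<open>P\<close>.\<close>

definition value_at :: "('a::field, 'k::field) variety \<Rightarrow> 'a point \<Rightarrow> 'k \<Rightarrow> 'a" where
  "value_at C P f = (THE c. \<exists>F G. is_fraction C F G \<and> \<not> vanishes_at G P \<and> f = frac C F G \<and>
     (\<forall>v\<in>P. eval F v = c * eval G v))"

definition max_ideal :: "('a::field, 'k::field) variety \<Rightarrow> 'a point \<Rightarrow> 'k set" where
  "max_ideal C P = {f \<in> local_ring C P. value_at C P f = 0}"

definition max_ideal_sq :: "('a::field, 'k::field) variety \<Rightarrow> 'a point \<Rightarrow> 'k set" where
  "max_ideal_sq C P = {(\<Sum>i<(N::nat). a i * b i) | N a b.
     \<forall>i<N. a i \<in> max_ideal C P \<and> b i \<in> max_ideal C P}"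

text \<open>A curve is non-singular at \<open>P\<close> if \<open>\<mm>/\<mm>\<^sup>2\<close> has dimension 1 over the residue field, i.e. is
  generated by the class of one function \<open>t\<close> and is not zero.\<close>

definition nonsingular_projective_curve :: "('a::field, 'k::field) variety \<Rightarrow> bool" where
  "nonsingular_projective_curve C \<longleftrightarrow> projective_variety C \<and> has_dimension C 1 \<and>
     (\<forall>P\<in>points C. \<exists>t\<in>max_ideal C P. t \<notin> max_ideal_sq C P \<and>
        (\<forall>f\<in>max_ideal C P. \<exists>c. f - scale_fun C c t \<in> max_ideal_sq C P))"

definition local_parameter :: "('a::field, 'k::field) variety \<Rightarrow> 'a point \<Rightarrow> 'k \<Rightarrow> bool" where
  "local_parameter C P t \<longleftrightarrow> max_ideal C P = {t * h | h. h \<in> local_ring C P}"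

text \<open>Order of vanishing at \<open>P\<close>; meaningful for \<open>f \<noteq> 0\<close> only.\<close>

definition ord_at :: "('a::field, 'k::field) variety \<Rightarrow> 'a point \<Rightarrow> 'k \<Rightarrow> int" where
  "ord_at C P f = (THE e. \<exists>t u. local_parameter C P t \<and> u \<noteq> 0 \<and>
     u \<in> local_ring C P \<and> inverse u \<in> local_ring C P \<and> f = u * t powi e)"

section \<open>Divisors\<close>

definition divisor :: "('a::field, 'k::field) variety \<Rightarrow> ('a point \<Rightarrow> int) \<Rightarrow> bool" where
  "divisor C D \<longleftrightarrow> finite {P. D P \<noteq> 0} \<and> {P. D P \<noteq> 0} \<subseteq> points C"

definition add_div ::
    "('a::field, 'k::field) variety \<Rightarrow> ('a point \<Rightarrow> int) \<Rightarrow> 'k \<Rightarrow> ('a point \<Rightarrow> int)" where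
  "add_div C D f = (\<lambda>P. D P + (if P \<in> points C then ord_at C P f else 0))"

text \<open>Non-zero rational functions on a curve have finitely many zeros and poles, so
  \<open>add_div C D f\<close> is a divisor whenever \<open>D\<close> is one and \<open>f \<noteq> 0\<close>.\<close>

definition lin_equiv ::
    "('a::field, 'k::field) variety \<Rightarrow> ('a point \<Rightarrow> int) \<Rightarrow> ('a point \<Rightarrow> int) \<Rightarrow> bool" where
  "lin_equiv C D' D \<longleftrightarrow> (\<exists>f. f \<noteq> 0 \<and> D' = add_div C D f)"

definition effective_away ::
    "('a::field, 'k::field) variety \<Rightarrow> 'a point \<Rightarrow> ('a point \<Rightarrow> int) \<Rightarrow> bool" where
  "effective_away C P D \<longleftrightarrow> (\<forall>Q\<in>points C - {P}. D Q \<ge> 0)"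

text \<open>\<open>D'\<close> is the \<open>P\<close>-reduced divisor linearly equivalent to \<open>D\<close>.\<close>

definition reduced_divisor :: "('a::field, 'k::field) variety \<Rightarrow> ('a point \<Rightarrow> int) \<Rightarrow> 'a point \<Rightarrow>
    ('a point \<Rightarrow> int) \<Rightarrow> bool" where
  "reduced_divisor C D P D' \<longleftrightarrow> lin_equiv C D' D \<and> effective_away C P D' \<and>
     (\<forall>D''. lin_equiv C D'' D \<and> effective_away C P D'' \<longrightarrow> D'' P \<le> D' P)"

section \<open>The sheaf \<open>\<L>(D)\<close> and its global sections\<close>

definition sheaf_stalk ::
    "('a::field, 'k::field) variety \<Rightarrow> ('a point \<Rightarrow> int) \<Rightarrow> 'a point \<Rightarrow> 'k set" where
  "sheaf_stalk C D P = {f. f = 0 \<or> D P + ord_at C P f \<ge> 0}"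

definition local_generator ::
    "('a::field, 'k::field) variety \<Rightarrow> ('a point \<Rightarrow> int) \<Rightarrow> 'a point \<Rightarrow> 'k \<Rightarrow> bool" where
  "local_generator C D P g \<longleftrightarrow> sheaf_stalk C D P = {g * h | h. h \<in> local_ring C P}"

definition sections :: "('a::field, 'k::field) variety \<Rightarrow> ('a point \<Rightarrow> int) \<Rightarrow> 'k set" where
  "sections C D = {f. f = 0 \<or> (\<forall>P\<in>points C. add_div C D f P \<ge> 0)}"

definition divisor_rank :: "('a::field, 'k::field) variety \<Rightarrow> ('a point \<Rightarrow> int) \<Rightarrow> int" where
  "divisor_rank C D = int (vector_space.dim (scale_fun C) (sections C D)) - 1"

text \<open>\<open>f 0, \<dots>, f r\<close> is a basis of \<open>\<Gamma>(C, \<L>(D))\<close> over the ground field.\<close>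

definition sections_basis ::
    "('a::field, 'k::field) variety \<Rightarrow> ('a point \<Rightarrow> int) \<Rightarrow> nat \<Rightarrow> (nat \<Rightarrow> 'k) \<Rightarrow> bool" where
  "sections_basis C D r f \<longleftrightarrow> inj_on f {..r} \<and>
     \<not> Modules.module.dependent (scale_fun C) (f ` {..r}) \<and>
     Modules.module.span (scale_fun C) (f ` {..r}) = sections C D"

section \<open>Differentials\<close>

text \<open>Rational differentials: the quotient of the free vector space on symbols \<open>dg\<close> (here
  \<open>single g 1\<close>, with \<open>g\<close> in the function field) by the relations \<open>d(a+b) = da + db\<close>,
  \<open>d(ab) = a db + b da\<close>, \<open>dc = 0\<close>.  The sheaf \<open>\<Omega>\<close>, being invertible, embeds into the constant
  sheaf of rational differentials, and identities between its sections are read there.\<close>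

definition kaehler_scale :: "'k::field \<Rightarrow> ('k \<Rightarrow>\<^sub>0 'k) \<Rightarrow> ('k \<Rightarrow>\<^sub>0 'k)" where
  "kaehler_scale b x = Poly_Mapping.map ((*) b) x"

definition kaehler_relations :: "('a::field, 'k::field) variety \<Rightarrow> ('k \<Rightarrow>\<^sub>0 'k) set" where
  "kaehler_relations C = Modules.module.span kaehler_scale (
     {Poly_Mapping.single (a + b) 1 - Poly_Mapping.single a 1 - Poly_Mapping.single b 1 | a b. True} \<union>
     {Poly_Mapping.single (a * b) 1 - Poly_Mapping.single b a - Poly_Mapping.single a b | a b. True} \<union>
     {Poly_Mapping.single (const_fun C c) 1 | c. True})"

text \<open>\<open>deriv_wrt C \<tau> g\<close> is the coefficient \<open>h\<close> in \<open>dg = h d\<tau>\<close>.\<close>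

definition deriv_wrt :: "('a::field, 'k::field) variety \<Rightarrow> 'k \<Rightarrow> 'k \<Rightarrow> 'k" where
  "deriv_wrt C \<tau> g =
     (THE h. Poly_Mapping.single g 1 - Poly_Mapping.single \<tau> h \<in> kaehler_relations C)"

section \<open>Sections of \<open>\<L>(D)\<^sup>\<otimes>\<^sup>s \<otimes> \<Omega>\<^sup>\<otimes>\<^sup>m\<close>\<close>

text \<open>A section is given by its local coordinates: \<open>\<sigma> P \<tau> g\<close> stands for the germ
  \<open>\<sigma> P \<tau> g \<cdot> g\<^sup>s (d\<tau>)\<^sup>m\<close> at \<open>P\<close>, for every local parameter \<open>\<tau>\<close> and local generator \<open>g\<close> of \<open>\<L>(D)\<close>
  at \<open>P\<close>.  The coordinates of a global section are regular, and all of them represent the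
  same rational section.\<close>

type_synonym ('a, 'k) local_coords = "'a point \<Rightarrow> 'k \<Rightarrow> 'k \<Rightarrow> 'k"

definition local_frame ::
    "('a::field, 'k::field) variety \<Rightarrow> ('a point \<Rightarrow> int) \<Rightarrow> 'a point \<Rightarrow> 'k \<Rightarrow> 'k \<Rightarrow> bool" where
  "local_frame C D P \<tau> g \<longleftrightarrow> P \<in> points C \<and> local_parameter C P \<tau> \<and> local_generator C D P g"

definition global_section :: "('a::field, 'k::field) variety \<Rightarrow> ('a point \<Rightarrow> int) \<Rightarrow> nat \<Rightarrow> nat \<Rightarrow>
    ('a, 'k) local_coords \<Rightarrow> bool" where
  "global_section C D s m \<sigma> \<longleftrightarrow>
     (\<forall>P \<tau> g. local_frame C D P \<tau> g \<longrightarrow> \<sigma> P \<tau> g \<in> local_ring C P) \<and>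
     (\<forall>P \<tau> g P' \<tau>' g'. local_frame C D P \<tau> g \<and> local_frame C D P' \<tau>' g' \<longrightarrow>
        \<sigma> P \<tau> g * g ^ s = \<sigma> P' \<tau>' g' * g' ^ s * deriv_wrt C \<tau> \<tau>' ^ m)"

text \<open>The Wronskian of \<open>G 0, \<dots>, G (s - 1)\<close>, a section of
  \<open>\<L>(D)\<^sup>\<otimes>\<^sup>s \<otimes> \<Omega>\<^sup>\<otimes>\<^sup>m\<close> with \<open>m = s(s-1)/2\<close>.\<close>

definition wronskian ::
    "('a::field, 'k::field) variety \<Rightarrow> nat \<Rightarrow> (nat \<Rightarrow> 'k) \<Rightarrow> ('a, 'k) local_coords" where
  "wronskian C s G = (\<lambda>P \<tau> g. det (mat s s (\<lambda>(j, k). (deriv_wrt C \<tau> ^^ k) (G j / g))))"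

definition omit :: "nat \<Rightarrow> (nat \<Rightarrow> 'k) \<Rightarrow> nat \<Rightarrow> 'k" where
  "omit i f = (\<lambda>j. if j < i then f j else f (Suc j))"

definition signed_wronskians :: "('a::field, 'k::field) variety \<Rightarrow> nat \<Rightarrow> (nat \<Rightarrow> 'k) \<Rightarrow>
    nat \<Rightarrow> ('a, 'k) local_coords" where
  "signed_wronskians C r f i = (\<lambda>P \<tau> g. (-1) ^ i * wronskian C r (omit i f) P \<tau> g)"

section \<open>Morphisms to projective space\<close>

definition morphism_to_proj ::
    "('a::field, 'k::field) variety \<Rightarrow> nat \<Rightarrow> ('a point \<Rightarrow> 'a point) \<Rightarrow> bool" where
  "morphism_to_proj C r \<phi> \<longleftrightarrow>
     (\<forall>P\<in>points C. \<exists>Z d G. algebraic_set (amb_dim C) Z \<and> P \<notin> Z \<and>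
        (\<forall>i\<le>r. G i \<in> forms (amb_dim C) d) \<and>
        (\<forall>Q\<in>points C - Z. (\<exists>i\<le>r. \<not> vanishes_at (G i) Q) \<and>
           (\<forall>v\<in>Q. v \<noteq> (\<lambda>_. 0) \<longrightarrow>
              \<phi> Q = proj_point (\<lambda>i. if i \<le> r then eval (G i) v else 0))))"

definition section_values :: "('a::field, 'k::field) variety \<Rightarrow> nat \<Rightarrow>
    (nat \<Rightarrow> ('a, 'k) local_coords) \<Rightarrow> 'a point \<Rightarrow> 'k \<Rightarrow> 'k \<Rightarrow> (nat \<Rightarrow> 'a)" where
  "section_values C r \<sigma> P \<tau> g = (\<lambda>i. if i \<le> r then value_at C P (\<sigma> i P \<tau> g) else 0)"

text \<open>\<open>\<phi>\<close> is the morphism defined by the global sections \<open>\<sigma> 0, \<dots>, \<sigma> r\<close> of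
  \<open>\<L>(D)\<^sup>\<otimes>\<^sup>s \<otimes> \<Omega>\<^sup>\<otimes>\<^sup>m\<close>, extended across their common zeros.  The locus where the sections do not all
  vanish is open, so requiring it to be non-empty makes it dense and determines \<open>\<phi>\<close> on the
  curve.\<close>

definition morphism_of_sections :: "('a::field, 'k::field) variety \<Rightarrow> ('a point \<Rightarrow> int) \<Rightarrow> nat \<Rightarrow>
    nat \<Rightarrow> nat \<Rightarrow> (nat \<Rightarrow> ('a, 'k) local_coords) \<Rightarrow> ('a point \<Rightarrow> 'a point) \<Rightarrow> bool" where
  "morphism_of_sections C D s m r \<sigma> \<phi> \<longleftrightarrow>
     (\<forall>i\<le>r. global_section C D s m (\<sigma> i)) \<and>
     morphism_to_proj C r \<phi> \<and>
     (\<exists>P \<tau> g. local_frame C D P \<tau> g \<and> section_values C r \<sigma> P \<tau> g \<noteq> (\<lambda>_. 0)) \<and>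
     (\<forall>P \<tau> g. local_frame C D P \<tau> g \<and> section_values C r \<sigma> P \<tau> g \<noteq> (\<lambda>_. 0) \<longrightarrow>
        \<phi> P = proj_point (section_values C r \<sigma> P \<tau> g))"

section \<open>The map given by reduced divisors\<close>

definition fun_line :: "('a::field, 'k::field) variety \<Rightarrow> 'k \<Rightarrow> 'k set" where
  "fun_line C f = {scale_fun C c f | c. True}"

definition reduced_map ::
    "('a::field, 'k::field) variety \<Rightarrow> ('a point \<Rightarrow> int) \<Rightarrow> 'a point \<Rightarrow> 'k set" where
  "reduced_map C D P = (THE l. \<exists>f\<in>sections C D. f \<noteq> 0 \<and>
     reduced_divisor C D P (add_div C D f) \<and> l = fun_line C f)"

text \<open>The identification of projective \<open>r\<close>-space with the lines in \<open>\<Gamma>(C, \<L>(D))\<close> through a basis.\<close>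

definition line_of_coords ::
    "('a::field, 'k::field) variety \<Rightarrow> nat \<Rightarrow> (nat \<Rightarrow> 'k) \<Rightarrow> 'a point \<Rightarrow> 'k set" where
  "line_of_coords C r f p = {(\<Sum>i\<le>r. scale_fun C (c i) (f i)) | c. c \<in> p}"

end

theory Submission
  imports Defs "Jordan_Normal_Form.Char_Poly"
begin

text \<open>Near a point \<open>P\<close> write \<open>f\<^sub>i = \<phi>\<^sub>i g\<close> and let \<open>\<sigma>\<^sub>i\<close> be the signed Wronskian with \<open>f\<^sub>i\<close> omitted.
  Cofactor expansion of a determinant with two equal columns gives \<open>\<Sum> \<sigma>\<^sub>i \<phi>\<^sub>i\<^sup>(\<^sup>k\<^sup>) = 0\<close> for \<open>k < r\<close>.
  Divide \<open>\<sigma>\<close> by its largest common power of the local parameter \<open>t\<close> and call the result \<open>\<rho>\<close>.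
  Pass to a basis of sections with distinct orders \<open>a\<^sub>0, \<dots>, a\<^sub>r\<close> at \<open>P\<close> and apply the operators
  \<open>\<Prod>\<^sub>l (t d/dt - a\<^sub>l)\<close>, \<open>l\<close> ranging over all but two indices.  The lowest terms then show
  that all products \<open>\<rho>\<^sub>j h\<^sub>j\<close> have the same order, so at \<open>P\<close> only the coefficient of the section \<open>h\<^sub>m\<close> of
  largest order survives.  Hence \<open>\<Sum> \<rho>\<^sub>i(P) f\<^sub>i\<close> is the section vanishing to maximal order at \<open>P\<close>, which
  is the one defining the \<open>P\<close>-reduced divisor.  Two extensions of the morphism agree because their
  \<open>2 \<times> 2\<close> minors vanish on a dense open set, where some Wronskian does not vanish.  Taking Laurent
  expansions at a single point shows that \<open>dt \<noteq> 0\<close>.\<close>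

section \<open>Evaluation of polynomials and forms\<close>

text \<open>The Wronskians may vanish simultaneously at P, so they cannot just be evaluated there.
  What helps is that the relations are linear in the \<open>\<sigma>\<close> and differentiate only
  the sections, so a common factor may be divided out. There are r relations for r + 1 unknowns. The
  operator t d/dt - b keeps the power t^a of a term, multiplies its leading coefficient by a - b,
  which in characteristic zero vanishes only for b = a, and uses up one relation; r - 1 such factors
  leave one relation between two leading terms, so these vanish together or not at all. Maximal
  order is what reducedness asks for: D + div(f) has coefficient D(P) + ord f at P, and a
  competitor, effective away from P, that beats an effective divisor at P is effective, so it comes
  from a section. Since the function field is an abstract field type and orders and derivatives are
  definite descriptions, both have to be shown well defined. Dimension one gives every function an
  algebraic relation over the polynomials in t; taken of minimal degree, it yields finite orders
  and, by differentiation, derivatives.\<close>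

abbreviation "keys \<equiv> Poly_Mapping.keys"
abbreviation "lookup \<equiv> Poly_Mapping.lookup"
abbreviation "single \<equiv> Poly_Mapping.single"

definition mon_value :: "(nat \<Rightarrow>\<^sub>0 nat) \<Rightarrow> (nat \<Rightarrow> 'b::comm_semiring_1) \<Rightarrow> 'b" where
  "mon_value m x = (\<Prod>i\<in>keys m. x i ^ lookup m i)"

abbreviation var :: "nat \<Rightarrow> 'a::{zero_neq_one} mpoly" where
  "var i \<equiv> single (single i 1) 1"

lemma poly_mapping_expand:
  "p = (\<Sum>m\<in>keys p. single m (lookup p m))"
proof (rule poly_mapping_eqI)
  fix k
  show "lookup p k = lookup (\<Sum>m\<in>keys p. single m (lookup p m)) k"
    by (cases "k \<in> keys p")
      (auto simp: lookup_sum lookup_single when_def in_keys_iff sum.delta')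
qed

lemma mon_value_superset:
  assumes "finite A" "keys m \<subseteq> A"
  shows "mon_value m x = (\<Prod>i\<in>A. x i ^ lookup m i)"
  unfolding mon_value_def
  by (rule prod.mono_neutral_left) (use assms in \<open>auto simp: in_keys_iff\<close>)

lemma mon_value_add: "mon_value (m + m') x = mon_value m x * mon_value m' x"
proof -
  let ?A = "keys m \<union> keys m'"
  have "mon_value (m + m') x = (\<Prod>i\<in>?A. x i ^ lookup (m + m') i)"
    by (rule mon_value_superset) (simp_all add: keys_add)
  also have "\<dots> = mon_value m x * mon_value m' x"
    by (simp add: mon_value_superset[of ?A] lookup_add power_add prod.distrib)
  finally show ?thesis .
qed

lemma mon_value_0 [simp]: "mon_value 0 x = 1"
  by (simp add: mon_value_def)

lemma mon_value_single [simp]: "mon_value (single i n) x = x i ^ n"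
  by (simp add: mon_value_def)

context comm_semiring_hom
begin

lemma eval_via_superset:
  assumes "finite A" "keys p \<subseteq> A"
  shows "eval_via hom p x = (\<Sum>m\<in>A. hom (lookup p m) * mon_value m x)"
  unfolding eval_via_def mon_value_def
  by (rule sum.mono_neutral_left) (use assms in \<open>auto simp: in_keys_iff\<close>)

lemma eval_via_add: "eval_via hom (p + q) x = eval_via hom p x + eval_via hom q x"
proof -
  let ?A = "keys p \<union> keys q"
  have "eval_via hom (p + q) x = (\<Sum>m\<in>?A. hom (lookup (p + q) m) * mon_value m x)"
    by (rule eval_via_superset) (simp_all add: keys_add)
  also have "\<dots> = eval_via hom p x + eval_via hom q x"
    by (simp add: eval_via_superset[of ?A] lookup_add hom_add distrib_right sum.distrib)
  finally show ?thesis .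
qed

lemma eval_via_0 [simp]: "eval_via hom 0 x = 0"
  by (simp add: eval_via_def)

lemma eval_via_single [simp]: "eval_via hom (single m a) x = hom a * mon_value m x"
  by (simp add: eval_via_def mon_value_def)

lemma eval_via_1 [simp]: "eval_via hom 1 x = 1"
  using eval_via_single[of 0 1 x] by simp

lemma eval_via_sum: "eval_via hom (\<Sum>i\<in>A. p i) x = (\<Sum>i\<in>A. eval_via hom (p i) x)"
  by (induction A rule: infinite_finite_induct) (auto simp: eval_via_add)

lemma eval_via_mult: "eval_via hom (p * q) x = eval_via hom p x * eval_via hom q x"
proof -
  let ?P = "keys p" and ?Q = "keys q"
  have "p * q = (\<Sum>m\<in>?P. single m (lookup p m)) *
     (\<Sum>m\<in>?Q. single m (lookup q m))"
    by (simp flip: poly_mapping_expand)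
  also have "\<dots> = (\<Sum>m\<in>?P. \<Sum>n\<in>?Q. single (m + n) (lookup p m * lookup q n))"
    by (simp add: sum_product mult_single)
  finally have "eval_via hom (p * q) x =
     (\<Sum>m\<in>?P. \<Sum>n\<in>?Q. hom (lookup p m * lookup q n) * mon_value (m + n) x)"
    by (simp add: eval_via_sum)
  also have "\<dots> = (\<Sum>m\<in>?P. \<Sum>n\<in>?Q. (hom (lookup p m) * mon_value m x) *
       (hom (lookup q n) * mon_value n x))"
    by (simp add: hom_mult mon_value_add mult_ac)
  also have "\<dots> = eval_via hom p x * eval_via hom q x"
    by (simp add: eval_via_def mon_value_def sum_product)
  finally show ?thesis .
qed

lemma eval_via_power: "eval_via hom (p ^ n) x = eval_via hom p x ^ n"
  by (induction n) (auto simp: eval_via_mult)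

lemma eval_via_prod: "eval_via hom (\<Prod>i\<in>A. p i) x = (\<Prod>i\<in>A. eval_via hom (p i) x)"
  by (induction A rule: infinite_finite_induct) (auto simp: eval_via_mult)

end

lemma ident_comm_semiring_hom: "comm_semiring_hom (\<lambda>c::'a::comm_semiring_1. c)"
  by unfold_locales auto

lemmas eval_add = comm_semiring_hom.eval_via_add[OF ident_comm_semiring_hom]
lemmas eval_mult = comm_semiring_hom.eval_via_mult[OF ident_comm_semiring_hom]
lemmas eval_power = comm_semiring_hom.eval_via_power[OF ident_comm_semiring_hom]
lemmas eval_prod = comm_semiring_hom.eval_via_prod[OF ident_comm_semiring_hom]
lemmas eval_zero [simp] = comm_semiring_hom.eval_via_0[OF ident_comm_semiring_hom]
lemmas eval_one [simp] = comm_semiring_hom.eval_via_1[OF ident_comm_semiring_hom]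
lemmas eval_single [simp] = comm_semiring_hom.eval_via_single[OF ident_comm_semiring_hom]

lemma eval_diff: "eval (p - q) x = eval p x - eval (q :: 'a::comm_ring_1 mpoly) x"
  using eval_add[of "p - q" q x] by (simp add: algebra_simps)

lemma homogeneous_eval_scale:
  assumes "homogeneous d p"
  shows "eval p (\<lambda>i. c * x i) = c ^ d * eval p x"
proof -
  have "mon_value m (\<lambda>i. c * x i) = c ^ d * mon_value m x" if "m \<in> keys p" for m
  proof -
    have "d = (\<Sum>i\<in>keys m. lookup m i)"
      using assms that by (simp add: homogeneous_def)
    then show ?thesis
      by (simp add: mon_value_def power_mult_distrib prod.distrib power_sum)
  qed
  then show ?thesis
    unfolding eval_via_def mon_value_def[symmetric] sum_distrib_left
    by (intro sum.cong) (auto simp: mult_ac)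
qed

definition mdeg :: "(nat \<Rightarrow>\<^sub>0 nat) \<Rightarrow> nat" where
  "mdeg m = (\<Sum>i\<in>keys m. lookup m i)"

lemma mdeg_superset:
  "finite A \<Longrightarrow> keys m \<subseteq> A \<Longrightarrow> mdeg m = (\<Sum>i\<in>A. lookup m i)"
  unfolding mdeg_def by (rule sum.mono_neutral_left) (auto simp: in_keys_iff)

lemma mdeg_add: "mdeg (m + m') = mdeg m + mdeg m'"
proof -
  let ?A = "keys m \<union> keys m'"
  have "mdeg (m + m') = (\<Sum>i\<in>?A. lookup (m + m') i)"
    by (rule mdeg_superset) (simp_all add: keys_add)
  then show ?thesis
    by (simp add: mdeg_superset[of ?A] lookup_add sum.distrib)
qed

lemma forms_iff:
  "p \<in> forms n d \<longleftrightarrow> (\<forall>m\<in>keys p. keys m \<subseteq> {..n} \<and> mdeg m = d)"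
  by (auto simp: forms_def vars_below_def homogeneous_def mdeg_def lessThan_Suc_atMost)

lemma forms_zero [simp]: "0 \<in> forms n d"
  by (simp add: forms_iff)

lemma forms_one [simp]: "1 \<in> forms n 0"
  by (simp add: forms_iff mdeg_def)

lemma forms_const [simp]: "single 0 c \<in> forms n 0"
  by (simp add: forms_iff mdeg_def)

lemma forms_var: "i \<le> n \<Longrightarrow> var i \<in> forms n 1"
  by (simp add: forms_iff mdeg_def)

lemma forms_add: "p \<in> forms n d \<Longrightarrow> q \<in> forms n d \<Longrightarrow> p + q \<in> forms n d"
  using keys_add[of p q] unfolding forms_iff by blast

lemma forms_sum: "(\<And>i. i \<in> A \<Longrightarrow> p i \<in> forms n d) \<Longrightarrow> (\<Sum>i\<in>A. p i) \<in> forms n d"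
  by (induction A rule: infinite_finite_induct) (auto intro: forms_add)

lemma forms_uminus: "p \<in> forms n d \<Longrightarrow> - (p :: 'a::ab_group_add mpoly) \<in> forms n d"
  by (auto simp: forms_iff in_keys_iff)

lemma forms_diff: "p \<in> forms n d \<Longrightarrow> q \<in> forms n d \<Longrightarrow> p - (q :: 'a::ab_group_add mpoly) \<in> forms n d"
  using forms_add[of p n d "- q"] forms_uminus[of q] by simp

lemma forms_mult:
  assumes "p \<in> forms n d" "q \<in> forms n e"
  shows "p * q \<in> forms n (d + e)"
proof -
  have "keys m \<subseteq> {..n} \<and> mdeg m = d + e" if "m \<in> keys (p * q)" for m
  proof -
    have "m \<in> {a + b |a b. a \<in> keys p \<and> b \<in> keys q}"
      using that keys_mult[of p q] by (rule subsetD[rotated])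
    then obtain a b where "m = a + b" "a \<in> keys p" "b \<in> keys q"
      by blast
    then have "keys a \<subseteq> {..n}" "keys b \<subseteq> {..n}" "mdeg a = d" "mdeg b = e"
      using assms by (simp_all add: forms_iff)
    then show ?thesis
      using keys_add[of a b] \<open>m = a + b\<close> by (simp add: mdeg_add) blast
  qed
  then show ?thesis by (simp add: forms_iff)
qed

lemma forms_power: "p \<in> forms n d \<Longrightarrow> p ^ k \<in> forms n (k * d)"
  by (induction k) (auto intro: forms_mult)

lemma forms_prod: "finite A \<Longrightarrow> (\<And>i. i \<in> A \<Longrightarrow> p i \<in> forms n (d i)) \<Longrightarrow>
    (\<Prod>i\<in>A. p i) \<in> forms n (\<Sum>i\<in>A. d i)"
  by (induction A rule: finite_induct) (auto intro: forms_mult)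

lemma var_power: "var i ^ n = single (single i n) (1 :: 'a::comm_semiring_1)"
  by (induction n) (simp_all add: mult_single flip: single_add)

lemma single_prod:
  "(\<Prod>i\<in>A. single (m i :: 'b::comm_monoid_add) (1 :: 'a::comm_semiring_1)) =
     single (\<Sum>i\<in>A. m i) 1"
  by (induction A rule: infinite_finite_induct) (auto simp: mult_single)

text \<open>Prepares dehomogenization: over a power of one variable, a monomial then splits into
  fractions of single variables.\<close>

lemma monomial_as_prod:
  "single m (a :: 'a::comm_semiring_1) =
     single 0 a * (\<Prod>i\<in>keys m. var i ^ lookup m i)"
proof -
  have "(\<Prod>i\<in>keys m. var i ^ lookup m i) = single m (1::'a)"
    by (simp only: var_power single_prod poly_mapping_expand[symmetric])
  then show ?thesis by (simp add: mult_single)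
qed

section \<open>Points of projective space\<close>

text \<open>A nonzero vector chosen on the line. What is read off at it, chiefly whether forms
  vanish and quotients of forms of equal degree, does not depend on the choice.\<close>

definition rep :: "'a::field point \<Rightarrow> nat \<Rightarrow> 'a" where
  "rep P = (SOME v. v \<in> P \<and> v \<noteq> (\<lambda>_. 0))"

lemma proj_point_self: "v \<in> proj_point v"
  unfolding proj_point_def by (auto intro: exI[of _ 1])

lemma proj_point_scale:
  assumes "c \<noteq> 0"
  shows "proj_point (\<lambda>i. c * v i) = proj_point v"
proof (intro equalityI subsetI)
  fix w assume "w \<in> proj_point v"
  then obtain d where "w = (\<lambda>i. d * v i)"
    by (auto simp: proj_point_def)
  with assms have "w = (\<lambda>i. (d / c) * (c * v i))" by auto
  then show "w \<in> proj_point (\<lambda>i. c * v i)"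
    unfolding proj_point_def by blast
next
  fix w assume "w \<in> proj_point (\<lambda>i. c * v i)"
  then obtain d where "w = (\<lambda>i. (d * c) * v i)"
    by (auto simp: proj_point_def mult.assoc)
  then show "w \<in> proj_point v"
    unfolding proj_point_def by blast
qed

lemma proj_pointE:
  assumes "P \<in> proj_space n"
  shows "rep P \<in> P" "rep P \<noteq> (\<lambda>_. 0)" "P = proj_point (rep P)" "\<And>i. i > n \<Longrightarrow> rep P i = 0"
    "\<exists>i\<le>n. rep P i \<noteq> 0"
proof -
  obtain v where v: "P = proj_point v" "\<forall>i>n. v i = 0" "\<exists>i. v i \<noteq> 0"
    using assms by (auto simp: proj_space_def)
  have "v \<in> P \<and> v \<noteq> (\<lambda>_. 0)"
    using v proj_point_self by auto
  then have *: "rep P \<in> P \<and> rep P \<noteq> (\<lambda>_. 0)"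
    unfolding rep_def by (rule someI[of "\<lambda>v. v \<in> P \<and> v \<noteq> (\<lambda>_. 0)"])
  then show "rep P \<in> P" "rep P \<noteq> (\<lambda>_. 0)" by auto
  obtain c where c: "rep P = (\<lambda>i. c * v i)"
    using * v(1) by (auto simp: proj_point_def)
  with * have "c \<noteq> 0" by auto
  then have "proj_point (rep P) = proj_point v"
    unfolding c by (rule proj_point_scale)
  then show "P = proj_point (rep P)"
    using v(1) by simp
  show "rep P i = 0" if "i > n" for i
    using that c v by auto
  then show "\<exists>i\<le>n. rep P i \<noteq> 0"
    using * by (metis ext not_le)
qed

lemma in_proj_pointE:
  assumes "P \<in> proj_space n" "v \<in> P"
  obtains c where "v = (\<lambda>i. c * rep P i)"
  using proj_pointE(3)[OF assms(1)] assms(2) by (auto simp: proj_point_def)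

lemma vanishes_at_iff:
  assumes "P \<in> proj_space n" "F \<in> forms n d"
  shows "vanishes_at F P \<longleftrightarrow> eval F (rep P) = 0"
proof
  show "vanishes_at F P \<Longrightarrow> eval F (rep P) = 0"
    using proj_pointE(1)[OF assms(1)] by (simp add: vanishes_at_def)
next
  assume F: "eval F (rep P) = 0"
  have hom: "homogeneous d F"
    using assms(2) by (simp add: forms_def)
  have "eval F v = 0" if v: "v \<in> P" for v
  proof -
    obtain c where "v = (\<lambda>i. c * rep P i)"
      using in_proj_pointE[OF assms(1) v] by blast
    then show ?thesis
      using homogeneous_eval_scale[OF hom, of c "rep P"] F by simp
  qed
  then show "vanishes_at F P"
    by (simp add: vanishes_at_def)
qed

text \<open>Turns equality of points into polynomial equations, which is the form in which it passes
  from a dense set to the whole curve.\<close>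

lemma proj_point_eq_iff_minors:
  assumes "\<exists>i. v i \<noteq> 0" "\<exists>i. w i \<noteq> 0" "\<And>i j. v i * w j = v j * w i"
  shows "proj_point v = proj_point w"
proof -
  obtain j where j: "w j \<noteq> 0" using assms by auto
  define c where "c = v j / w j"
  have v: "v i = c * w i" for i
    using assms(3)[of i j] j by (simp add: c_def eq_divide_eq)
  then have "c \<noteq> 0"
    using assms(1) by auto
  moreover have "v = (\<lambda>i. c * w i)"
    using v by auto
  ultimately show ?thesis
    using proj_point_scale by simp
qed

section \<open>Rational functions and local rings of a projective variety\<close>

locale proj_variety =
  fixes C :: "('a::field, 'k::field) variety"
  assumes projective: "projective_variety C"
begin

abbreviation dim where "dim \<equiv> amb_dim C"

definition nonvan :: "'a mpoly \<Rightarrow> bool" where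
  "nonvan G \<longleftrightarrow> (\<exists>d. G \<in> forms dim d) \<and> (\<exists>P\<in>points C. \<not> vanishes_at G P)"

lemma alg_points: "algebraic_set dim (points C)"
  and irred_points: "irreducible_set dim (points C)"
  and fun_field: "function_field C"
  using projective by (auto simp: projective_variety_def)

lemma points_proj: "P \<in> points C \<Longrightarrow> P \<in> proj_space dim"
  using alg_points by (auto simp: algebraic_set_def)

lemma points_nonempty: "\<exists>P. P \<in> points C"
  using irred_points by (auto simp: irreducible_set_def)

lemma vanishes_iff: "P \<in> points C \<Longrightarrow> F \<in> forms dim d \<Longrightarrow> vanishes_at F P \<longleftrightarrow> eval F (rep P) = 0"
  using vanishes_at_iff points_proj by blast

lemma vanishes_mult:
  assumes "P \<in> points C" "F \<in> forms dim d" "G \<in> forms dim e"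
  shows "vanishes_at (F * G) P \<longleftrightarrow> vanishes_at F P \<or> vanishes_at G P"
  using assms vanishes_iff[OF assms(1) forms_mult[OF assms(2,3)]]
  by (simp add: vanishes_iff eval_mult)

lemma not_vanishes_one: "P \<in> points C \<Longrightarrow> \<not> vanishes_at 1 P"
  by (simp add: vanishes_iff[of _ _ 0])

lemma algebraic_subset:
  assumes "F \<in> forms dim d"
  shows "algebraic_set dim {P \<in> points C. vanishes_at F P}"
proof -
  obtain S where S: "S \<subseteq> (\<Union>d. forms dim d)" "points C = {P \<in> proj_space dim. \<forall>p\<in>S. vanishes_at p P}"
    using alg_points by (auto simp: algebraic_set_def)
  have "insert F S \<subseteq> (\<Union>d. forms dim d)"
    using S(1) assms by auto
  moreover have "{P \<in> points C. vanishes_at F P} = {P \<in> proj_space dim. \<forall>p\<in>insert F S. vanishes_at p P}"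
    using S(2) by auto
  ultimately show ?thesis
    unfolding algebraic_set_def by blast
qed

text \<open>This is irreducibility: otherwise the variety would be the union of the zero sets of the
  two factors, hence equal to one of them.\<close>

lemma nonvan_mult:
  assumes "nonvan F" "nonvan G"
  shows "nonvan (F * G)"
proof (rule ccontr)
  assume contr: "\<not> nonvan (F * G)"
  obtain d e where de: "F \<in> forms dim d" "G \<in> forms dim e"
    using assms by (auto simp: nonvan_def)
  let ?Z = "\<lambda>F. {P \<in> points C. vanishes_at F P}"
  have "points C = ?Z F \<union> ?Z G"
    using contr forms_mult[OF de] vanishes_mult[OF _ de] by (auto simp: nonvan_def)
  then have "points C = ?Z F \<or> points C = ?Z G"
    using irred_points algebraic_subset de unfolding irreducible_set_def by meson
  then show False
    using assms by (auto simp: nonvan_def)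
qed

lemma nonvan_one: "nonvan 1"
  using points_nonempty not_vanishes_one forms_one unfolding nonvan_def by blast

text \<open>Truth on a nonempty principal open set. By \<open>nonvan_mult\<close> any two of these
  meet, so \<open>generic\<close> behaves like a filter and stands in for the Zariski topology.
  Density is \<open>vanishes_of_generic\<close>.\<close>

definition generic :: "('a point \<Rightarrow> bool) \<Rightarrow> bool" where
  "generic p \<longleftrightarrow> (\<exists>H. nonvan H \<and> (\<forall>P\<in>points C. \<not> vanishes_at H P \<longrightarrow> p P))"

lemma generic_conj:
  assumes "generic p" "generic q"
  shows "generic (\<lambda>P. p P \<and> q P)"
proof -
  obtain H H' where H: "nonvan H" "\<And>P. P \<in> points C \<Longrightarrow> \<not> vanishes_at H P \<Longrightarrow> p P"
      "nonvan H'" "\<And>P. P \<in> points C \<Longrightarrow> \<not> vanishes_at H' P \<Longrightarrow> q P"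
    using assms by (auto simp: generic_def)
  moreover obtain d e where "H \<in> forms dim d" "H' \<in> forms dim e"
    using H by (auto simp: nonvan_def)
  ultimately show ?thesis
    unfolding generic_def by (intro exI[of _ "H * H'"]) (auto simp: nonvan_mult vanishes_mult)
qed

lemma generic_mono: "generic p \<Longrightarrow> (\<And>P. P \<in> points C \<Longrightarrow> p P \<Longrightarrow> q P) \<Longrightarrow> generic q"
  unfolding generic_def by blast

lemma generic_all: "(\<And>P. P \<in> points C \<Longrightarrow> p P) \<Longrightarrow> generic p"
  unfolding generic_def using nonvan_one by blast

lemma generic_Ball:
  "finite A \<Longrightarrow> (\<And>i. i \<in> A \<Longrightarrow> generic (p i)) \<Longrightarrow> generic (\<lambda>P. \<forall>i\<in>A. p i P)"
proof (induction A rule: finite_induct)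
  case empty
  then show ?case by (simp add: generic_all)
next
  case (insert x F)
  then show ?case
    using generic_conj[of "p x" "\<lambda>P. \<forall>i\<in>F. p i P"] by simp
qed

lemma generic_ex: "generic p \<Longrightarrow> \<exists>P\<in>points C. p P"
  by (auto simp: generic_def nonvan_def)

lemma generic_nonvan: "nonvan H \<Longrightarrow> generic (\<lambda>P. \<not> vanishes_at H P)"
  by (auto simp: generic_def)

lemma vanishes_of_generic:
  assumes "F \<in> forms dim d" "generic (vanishes_at F)" "P \<in> points C"
  shows "vanishes_at F P"
proof (rule ccontr)
  assume "\<not> vanishes_at F P"
  then have "nonvan F"
    using assms by (auto simp: nonvan_def)
  from generic_ex[OF generic_conj[OF generic_nonvan[OF this] assms(2)]] show False by auto
qed

text \<open>Some form defining Z does not vanish at P, and its nonvanishing locus avoids Z.\<close>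

lemma generic_off_algebraic:
  assumes "algebraic_set dim Z" "P \<in> points C" "P \<notin> Z"
  shows "generic (\<lambda>Q. Q \<notin> Z)"
proof -
  obtain S where S: "S \<subseteq> (\<Union>d. forms dim d)" "Z = {P \<in> proj_space dim. \<forall>p\<in>S. vanishes_at p P}"
    using assms(1) by (auto simp: algebraic_set_def)
  then obtain F where "F \<in> S" "\<not> vanishes_at F P"
    using assms points_proj by auto
  moreover have "nonvan F"
    using S \<open>F \<in> S\<close> \<open>\<not> vanishes_at F P\<close> assms unfolding nonvan_def by blast
  ultimately show ?thesis
    using S(2) generic_mono[OF generic_nonvan[of F], of "\<lambda>Q. Q \<notin> Z"] by blast
qed

subsection \<open>The function field\<close>

lemma is_fractionI:
  "F \<in> forms dim d \<Longrightarrow> G \<in> forms dim d \<Longrightarrow> nonvan G \<Longrightarrow> is_fraction C F G"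
  by (auto simp: is_fraction_def nonvan_def)

lemma is_fractionE:
  assumes "is_fraction C F G"
  obtains d where "F \<in> forms dim d" "G \<in> forms dim d" "nonvan G"
  using assms by (auto simp: is_fraction_def nonvan_def)

lemma frac_eq_iff:
  "is_fraction C F G \<Longrightarrow> is_fraction C F' G' \<Longrightarrow>
    frac C F G = frac C F' G' \<longleftrightarrow> (\<forall>P\<in>points C. vanishes_at (F * G' - F' * G) P)"
  and frac_add: "is_fraction C F G \<Longrightarrow> is_fraction C F' G' \<Longrightarrow>
    frac C F G + frac C F' G' = frac C (F * G' + F' * G) (G * G')"
  and frac_mult: "is_fraction C F G \<Longrightarrow> is_fraction C F' G' \<Longrightarrow>
    frac C F G * frac C F' G' = frac C (F * F') (G * G')"
  using fun_field unfolding function_field_def by blast+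

lemma frac_surj:
  obtains F G where "is_fraction C F G" "f = frac C F G"
  using fun_field unfolding function_field_def by blast

lemma is_fraction_mult: "is_fraction C F G \<Longrightarrow> is_fraction C F' G' \<Longrightarrow> is_fraction C (F * F') (G * G')"
  by (elim is_fractionE) (rule is_fractionI[OF forms_mult forms_mult nonvan_mult])

lemma is_fraction_add: "is_fraction C F G \<Longrightarrow> is_fraction C F' G' \<Longrightarrow> is_fraction C (F * G' + F' * G) (G * G')"
  apply (elim is_fractionE)
  subgoal for d e
    using forms_mult[of F dim d G' e] forms_mult[of F' dim e G d] forms_mult[of G dim d G' e]
    by (intro is_fractionI[where d = "d + e"] nonvan_mult forms_add) (simp_all add: add.commute)
  done

text \<open>\<open>function_field\<close> says nothing about 0 and 1. They are recovered from the
  equations x + x = x and, in \<open>frac_self\<close>, x x = x with x nonzero.\<close>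

lemma frac_zero: assumes "is_fraction C 0 G" shows "frac C 0 G = 0"
proof -
  have "is_fraction C (0 * G + 0 * G) (G * G)"
    using is_fraction_add[OF assms assms] by simp
  then have "frac C 0 G + frac C 0 G = frac C 0 G + 0"
    using frac_add[OF assms assms] assms frac_eq_iff[of 0 "G * G" 0 G] by (simp add: vanishes_at_def)
  then show ?thesis by (rule add_left_imp_eq)
qed

lemma frac_eq_0_iff:
  assumes "is_fraction C F G"
  shows "frac C F G = 0 \<longleftrightarrow> (\<forall>P\<in>points C. vanishes_at F P)"
proof -
  obtain d where d: "F \<in> forms dim d" "G \<in> forms dim d" "nonvan G"
    using assms by (rule is_fractionE)
  have 0: "is_fraction C 0 1"
    by (rule is_fractionI[of _ 0]) (simp_all add: nonvan_one)
  show ?thesis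
    using frac_eq_iff[OF assms 0] frac_zero[OF 0] by simp
qed

lemma frac_self: assumes "nonvan G" shows "frac C G G = 1"
proof -
  obtain d where d: "G \<in> forms dim d" using assms by (auto simp: nonvan_def)
  have f: "is_fraction C G G"
    using d assms by (auto intro: is_fractionI)
  have "frac C G G * frac C G G = frac C G G"
    using frac_mult[OF f f] frac_eq_iff[OF is_fraction_mult[OF f f] f]
    by (simp add: vanishes_at_def algebra_simps)
  moreover have "frac C G G \<noteq> 0"
    using frac_eq_0_iff[OF f] assms by (auto simp: nonvan_def)
  ultimately show ?thesis by simp
qed

lemma frac_add_same:
  assumes "F \<in> forms dim d" "F' \<in> forms dim d" "G \<in> forms dim d" "nonvan G"
  shows "frac C (F + F') G = frac C F G + frac C F' G"
proof -
  have f: "is_fraction C F G" "is_fraction C F' G" "is_fraction C (F + F') G"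
    using assms by (auto intro: is_fractionI forms_add)
  show ?thesis
    unfolding frac_add[OF f(1,2)]
    using frac_eq_iff[OF f(3) is_fraction_add[OF f(1,2)]]
    by (simp add: vanishes_at_def algebra_simps)
qed

lemma inverse_frac:
  assumes "is_fraction C F G" "nonvan F"
  shows "inverse (frac C F G) = frac C G F" "is_fraction C G F"
proof -
  obtain d where d: "F \<in> forms dim d" "G \<in> forms dim d" "nonvan G"
    using assms(1) by (rule is_fractionE)
  show g: "is_fraction C G F"
    using d assms(2) by (auto intro: is_fractionI)
  have "frac C F G * frac C G F = frac C (F * G) (F * G)"
    using frac_mult[OF assms(1) g] by (simp add: mult.commute)
  then have "frac C F G * frac C G F = 1"
    using frac_self[OF nonvan_mult[OF assms(2) d(3)]] by simp
  then show "inverse (frac C F G) = frac C G F"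
    by (metis inverse_unique)
qed

lemma is_fraction_const: "is_fraction C (single 0 c) 1"
  by (rule is_fractionI[of _ 0]) (simp_all add: nonvan_one)

abbreviation "const \<equiv> const_fun C"

sublocale const: field_hom "const_fun C"
proof
  note f = is_fraction_const
  show "const_fun C 0 = 0"
    using frac_zero[of 1] f[of 0] by (simp add: const_fun_def)
  show "const_fun C 1 = 1"
    using frac_self[OF nonvan_one] by (simp add: const_fun_def)
  show "const_fun C (a + b) = const_fun C a + const_fun C b" for a b
    using frac_add[OF f f, of a b] by (simp add: const_fun_def single_add)
  show "const_fun C (a * b) = const_fun C a * const_fun C b" for a b
    using frac_mult[OF f f, of a b] by (simp add: const_fun_def mult_single)
qed

lemma scale_module: "vector_space (scale_fun C)"
  by unfold_locales (auto simp: scale_fun_def algebra_simps const.hom_add const.hom_mult)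

subsection \<open>Local rings\<close>

lemma in_local_ringE:
  assumes "P \<in> points C" "f \<in> local_ring C P"
  obtains F G d where "F \<in> forms dim d" "G \<in> forms dim d" "eval G (rep P) \<noteq> 0"
    "f = frac C F G" "is_fraction C F G"
proof -
  obtain F G where FG: "f = frac C F G" "is_fraction C F G" "\<not> vanishes_at G P"
    using assms(2) by (auto simp: local_ring_def)
  obtain d where "F \<in> forms dim d" "G \<in> forms dim d"
    using FG(2) by (rule is_fractionE)
  then show thesis
    using that FG vanishes_iff[OF assms(1)] by blast
qed

lemma nonvanI: "P \<in> points C \<Longrightarrow> G \<in> forms dim d \<Longrightarrow> eval G (rep P) \<noteq> 0 \<Longrightarrow> nonvan G"
  by (auto simp: nonvan_def vanishes_iff)

text \<open>A quotient of forms of equal degree is constant along a line through the origin, and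
  equal fractions agree after cross-multiplication. So the description in \<open>value_at\<close>
  has a unique solution, found at \<open>rep P\<close>.\<close>

lemma in_local_ringI:
  assumes "P \<in> points C" "F \<in> forms dim d" "G \<in> forms dim d" "eval G (rep P) \<noteq> 0"
  shows "frac C F G \<in> local_ring C P" "value_at C P (frac C F G) = eval F (rep P) / eval G (rep P)"
    "is_fraction C F G"
proof -
  show f: "is_fraction C F G"
    using assms nonvanI[OF assms(1,3,4)] by (auto intro: is_fractionI)
  have G: "\<not> vanishes_at G P"
    using assms by (simp add: vanishes_iff)
  show "frac C F G \<in> local_ring C P"
    using f G by (auto simp: local_ring_def)
  have scale: "eval F (\<lambda>i. c * rep P i) = c ^ d * eval F (rep P)"
    "eval G (\<lambda>i. c * rep P i) = c ^ d * eval G (rep P)" for c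
    using assms by (auto intro!: homogeneous_eval_scale simp: forms_def)
  have 1: "\<forall>v\<in>P. eval F v = (eval F (rep P) / eval G (rep P)) * eval G v"
  proof
    fix v assume v: "v \<in> P"
    obtain c where "v = (\<lambda>i. c * rep P i)"
      using in_proj_pointE[OF points_proj[OF assms(1)] v] by blast
    then show "eval F v = (eval F (rep P) / eval G (rep P)) * eval G v"
      using assms(4) by (simp add: scale)
  qed
  have 2: "e = eval F (rep P) / eval G (rep P)"
    if e: "is_fraction C F' G'" "\<not> vanishes_at G' P" "frac C F G = frac C F' G'"
      "\<forall>v\<in>P. eval F' v = e * eval G' v" for e F' G'
  proof -
    obtain d' where d': "F' \<in> forms dim d'" "G' \<in> forms dim d'"
      using e(1) by (rule is_fractionE)
    have P: "rep P \<in> P" using proj_pointE(1)[OF points_proj[OF assms(1)]] .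
    have "eval (F * G' - F' * G) (rep P) = 0"
      using frac_eq_iff[OF f e(1)] e(3) assms(1) P by (simp add: vanishes_at_def)
    then have "eval F (rep P) * eval G' (rep P) = eval F' (rep P) * eval G (rep P)"
      by (simp add: eval_diff eval_mult)
    moreover have "eval F' (rep P) = e * eval G' (rep P)" using e(4) P by blast
    moreover have "eval G' (rep P) \<noteq> 0" using e(2) vanishes_iff[OF assms(1) d'(2)] by simp
    ultimately show ?thesis using assms(4) by (simp add: field_simps)
  qed
  show "value_at C P (frac C F G) = eval F (rep P) / eval G (rep P)"
    unfolding value_at_def
    by (rule the_equality) (use 1 2 f G in blast)+
qed

context
  fixes P assumes P: "P \<in> points C"
begin

lemma const_in_local_ring: "const c \<in> local_ring C P"
  and value_const: "value_at C P (const c) = c"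
  using in_local_ringI[OF P forms_const forms_one, of c] by (auto simp: const_fun_def)

lemma local_ring_add_mult:
  assumes "f \<in> local_ring C P" "g \<in> local_ring C P"
  shows "f + g \<in> local_ring C P" "value_at C P (f + g) = value_at C P f + value_at C P g"
    "f * g \<in> local_ring C P" "value_at C P (f * g) = value_at C P f * value_at C P g"
proof -
  obtain F G d where F: "F \<in> forms dim d" "G \<in> forms dim d" "eval G (rep P) \<noteq> 0" "f = frac C F G" "is_fraction C F G"
    using in_local_ringE[OF P assms(1)] by blast
  obtain F' G' d' where F': "F' \<in> forms dim d'" "G' \<in> forms dim d'" "eval G' (rep P) \<noteq> 0" "g = frac C F' G'" "is_fraction C F' G'"
    using in_local_ringE[OF P assms(2)] by blast
  have 1: "F * G' + F' * G \<in> forms dim (d + d')"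
    using forms_mult[OF F(1) F'(2)] forms_mult[OF F'(1) F(2)] by (auto intro: forms_add simp: add.commute)
  have 2: "F * F' \<in> forms dim (d + d')" "G * G' \<in> forms dim (d + d')"
    using F F' by (auto intro: forms_mult)
  have 3: "eval (G * G') (rep P) \<noteq> 0" using F F' by (simp add: eval_mult)
  note v = in_local_ringI(2)[OF P F(1-3)] in_local_ringI(2)[OF P F'(1-3)]
  show "f + g \<in> local_ring C P" "value_at C P (f + g) = value_at C P f + value_at C P g"
    unfolding F(4) F'(4) v frac_add[OF F(5) F'(5)] using in_local_ringI[OF P 1 2(2) 3] F(3) F'(3)
    by (simp_all add: eval_add eval_mult field_simps)
  show "f * g \<in> local_ring C P" "value_at C P (f * g) = value_at C P f * value_at C P g"
    unfolding F(4) F'(4) v frac_mult[OF F(5) F'(5)] using in_local_ringI[OF P 2 3] F(3) F'(3)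
    by (simp_all add: eval_mult field_simps)
qed

lemma local_ring_inverse:
  assumes "f \<in> local_ring C P" "value_at C P f \<noteq> 0"
  shows "inverse f \<in> local_ring C P"
proof -
  obtain F G d where F: "F \<in> forms dim d" "G \<in> forms dim d" "eval G (rep P) \<noteq> 0" "f = frac C F G" "is_fraction C F G"
    using in_local_ringE[OF P assms(1)] by blast
  have "eval F (rep P) \<noteq> 0"
    using in_local_ringI(2)[OF P F(1-3)] assms F(4) by auto
  then show ?thesis
    using inverse_frac[OF F(5)] nonvanI[OF P F(1)] in_local_ringI[OF P F(2,1)] F(4) by simp
qed

end

end

section \<open>The local rings of a non-singular curve\<close>

locale curve =
  fixes C :: "('a::{alg_closed_field, field_char_0}, 'k::field) variety"
  assumes curve: "nonsingular_projective_curve C"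

sublocale curve \<subseteq> proj_variety C
  by unfold_locales (use curve in \<open>simp add: nonsingular_projective_curve_def\<close>)

context curve
begin

abbreviation const_poly :: "'a poly \<Rightarrow> 'k \<Rightarrow> 'k" where
  "const_poly A t \<equiv> poly (map_poly (const) A) t"

lemma const_poly_simps [simp]:
  "const_poly (A + B) t = const_poly A t + const_poly B t"
  "const_poly (A * B) t = const_poly A t * const_poly B t"
  "const_poly (monom a n) t = const a * t ^ n"
  "const_poly [:a, b:] t = const a + t * const b"
proof -
  interpret h: map_poly_comm_ring_hom "const" by unfold_locales
  show "const_poly (A + B) t = const_poly A t + const_poly B t"
    "const_poly (A * B) t = const_poly A t * const_poly B t"
    by (simp_all add: h.hom_add h.hom_mult)
  show "const_poly (monom a n) t = const a * t ^ n"
    by (simp add: map_poly_monom poly_monom)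
  show "const_poly [:a, b:] t = const a + t * const b"
    by (cases "b = 0"; cases "a = 0") (simp_all add: map_poly_pCons)
qed

lemma const_poly_sum: "const_poly (\<Sum>i\<in>S. A i) t = (\<Sum>i\<in>S. const_poly (A i) t)"
  by (induction S rule: infinite_finite_induct) simp_all

text \<open>As the ground field is algebraically closed, non-constant functions are transcendental.\<close>

lemma const_poly_eq_0:
  assumes "t \<notin> range (const)" "const_poly A t = 0"
  shows "A = 0"
  using assms(2)
proof (induction "degree A" arbitrary: A)
  case 0
  then obtain a where "A = [:a:]" by (metis degree_eq_zeroE)
  with 0 show ?case by (cases "a = 0") (simp_all add: map_poly_pCons)
next
  case (Suc n)
  then obtain x where "poly A x = 0"
    using alg_closed_imp_poly_has_root[of A] by auto
  then obtain B where B: "A = [:- x, 1:] * B"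
    by (metis dvd_def poly_eq_0_iff_dvd)
  have "t - const x \<noteq> 0"
    using assms(1) by auto
  moreover have "const_poly A t = (t - const x) * const_poly B t"
    unfolding B const_poly_simps by (simp add: const.hom_uminus)
  ultimately have "const_poly B t = 0"
    using Suc.prems by simp
  moreover have "n = degree B"
  proof -
    have "B \<noteq> 0" using Suc(2) B by auto
    then have "degree A = degree [:- x, 1:] + degree B"
      unfolding B by (intro degree_mult_eq) auto
    then show ?thesis using Suc(2) by simp
  qed
  ultimately have "B = 0"
    using Suc(1) by blast
  then show ?case by (simp add: B)
qed

section \<open>Algebraic dependence of functions on a curve\<close>

definition over :: "'k \<Rightarrow> 'k poly \<Rightarrow> bool" where
  "over t q \<longleftrightarrow> (\<forall>i. \<exists>A. coeff q i = const_poly A t)"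

text \<open>Dimension one makes t and f algebraically dependent. The relation, read as a polynomial
  in f, stays nonzero: otherwise its coefficients, being polynomials in t, would vanish by
  transcendence of t, and they carry all coefficients of the original relation.\<close>

lemma algebraic_relation:
  assumes t: "t \<notin> range (const)"
  shows "\<exists>q. q \<noteq> 0 \<and> over t q \<and> poly q f = 0"
proof -
  define x :: "nat \<Rightarrow> 'k" where "x = (\<lambda>i. if i = 0 then t else f)"
  have "\<not> alg_independent C 2 x"
    using curve by (auto simp: nonsingular_projective_curve_def has_dimension_def eval_nat_numeral)
  then obtain p where p: "vars_below 2 p" "eval_via (const) p x = 0" "p \<noteq> 0"
    by (auto simp: alg_independent_def)
  let ?K = "keys p" and ?l = "lookup"
  have K: "keys m \<subseteq> {0, 1}" if "m \<in> ?K" for m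
    using p(1) that by (simp add: vars_below_def numeral_2_eq_2 lessThan_Suc insert_commute)
  define A where "A i = (\<Sum>m\<in>{m\<in>?K. ?l m 1 = i}. monom (?l p m) (?l m 0))" for i
  define q where "q = (\<Sum>m\<in>?K. monom (const (?l p m) * t ^ ?l m 0) (?l m 1))"
  have q: "coeff q i = const_poly (A i) t" for i
  proof -
    have "coeff q i = (\<Sum>m\<in>?K. if ?l m 1 = i then const (?l p m) * t ^ ?l m 0 else 0)"
      by (simp add: q_def coeff_sum)
    also have "\<dots> = const_poly (A i) t"
      unfolding A_def const_poly_sum by (simp add: sum.inter_filter poly_monom)
    finally show ?thesis .
  qed
  have "poly q f = (\<Sum>m\<in>?K. const (?l p m) * (t ^ ?l m 0 * f ^ ?l m 1))"
    by (simp add: q_def poly_sum poly_monom mult_ac)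
  also have "\<dots> = (\<Sum>m\<in>?K. const (?l p m) * mon_value m x)"
    by (intro sum.cong refl) (use K in \<open>simp add: mon_value_superset[of "{0,1}"] x_def\<close>)
  also have "\<dots> = 0"
    using p(2) by (simp add: eval_via_def mon_value_def)
  finally have "poly q f = 0" .
  moreover have "q \<noteq> 0"
  proof
    assume "q = 0"
    obtain m where m: "m \<in> ?K" using p(3) by (metis keys_eq_empty ex_in_conv)
    have "A (?l m 1) = 0"
      using const_poly_eq_0[OF t] q \<open>q = 0\<close> by (metis coeff_0)
    then have "0 = coeff (A (?l m 1)) (?l m 0)" by simp
    also have "\<dots> = (\<Sum>n\<in>{n\<in>?K. ?l n 1 = ?l m 1}. if ?l n 0 = ?l m 0 then ?l p n else 0)"
      by (simp add: A_def coeff_sum)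
    also have "\<dots> = (\<Sum>n\<in>{n\<in>?K. ?l n 1 = ?l m 1}. if n = m then ?l p n else 0)"
    proof (intro sum.cong refl if_cong)
      fix n assume n: "n \<in> {n\<in>?K. ?l n 1 = ?l m 1}"
      show "(?l n 0 = ?l m 0) = (n = m)"
      proof
        assume eq: "?l n 0 = ?l m 0"
        show "n = m"
        proof (rule poly_mapping_eqI)
          fix k :: nat
          show "?l n k = ?l m k"
          proof (cases "k \<in> {0, 1}")
            case False
            then have "k \<notin> keys n" "k \<notin> keys m"
              using K[of n] K[of m] m n by auto
            then show ?thesis by (simp add: in_keys_iff)
          qed (use n eq in auto)
        qed
      qed auto
    qed
    also have "\<dots> = ?l p m" using m by simp
    finally show False using m by (simp add: in_keys_iff)
  qed
  ultimately show ?thesis using q unfolding over_def by blast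
qed

text \<open>Coefficients are kept polynomial in t so that they are regular where t is. Minimality is
  used twice: for nonzero f it makes the constant coefficient nonzero, and it keeps the derivative
  of the relation from vanishing at f.\<close>

lemma minimal_relation:
  assumes t: "t \<notin> range (const)"
  obtains q where "q \<noteq> 0" "over t q" "poly q f = 0"
    "\<And>p. p \<noteq> 0 \<Longrightarrow> over t p \<Longrightarrow> degree p < degree q \<Longrightarrow> poly p f \<noteq> 0"
proof -
  let ?R = "\<lambda>q. q \<noteq> 0 \<and> over t q \<and> poly q f = 0"
  obtain q where "?R q" "\<And>p. ?R p \<Longrightarrow> degree q \<le> degree p"
    using algebraic_relation[OF t, of f] ex_has_least_nat[of ?R _ degree] by blast
  then show ?thesis
    using that[of q] by (meson not_le)
qed

section \<open>Forms over powers of a variable as polynomials in affine coordinates\<close>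

lemma frac_prod:
  assumes "finite S" "\<And>i. i \<in> S \<Longrightarrow> is_fraction C (F i) (G i)"
  shows "is_fraction C (\<Prod>i\<in>S. F i) (\<Prod>i\<in>S. G i) \<and>
    frac C (\<Prod>i\<in>S. F i) (\<Prod>i\<in>S. G i) = (\<Prod>i\<in>S. frac C (F i) (G i))"
  using assms
proof (induction S rule: finite_induct)
  case empty
  then show ?case
    using frac_self[OF nonvan_one] is_fractionI[of 1 0 1] nonvan_one by simp
next
  case (insert x S)
  then have f: "is_fraction C (F x) (G x)" "is_fraction C (\<Prod>i\<in>S. F i) (\<Prod>i\<in>S. G i)" by auto
  then show ?case
    using insert frac_mult[OF f] is_fraction_mult[OF f] by simp
qed

lemma frac_power:
  assumes "is_fraction C F G"
  shows "is_fraction C (F ^ n) (G ^ n)" "frac C (F ^ n) (G ^ n) = frac C F G ^ n"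
  using frac_prod[of "{..<n}" "\<lambda>_. F" "\<lambda>_. G"] assms by simp_all

lemma frac_sum:
  assumes "finite S" "\<And>i. i \<in> S \<Longrightarrow> F i \<in> forms dim d" "G \<in> forms dim d" "nonvan G"
  shows "frac C (\<Sum>i\<in>S. F i) G = (\<Sum>i\<in>S. frac C (F i) G)"
  using assms(1,2)
proof (induction S rule: finite_induct)
  case empty
  then show ?case using frac_zero is_fractionI[OF forms_zero assms(3,4)] by simp
next
  case (insert x S)
  then show ?case
    using frac_add_same[of "F x" d "\<Sum>i\<in>S. F i" G] assms(3,4) by (simp add: forms_sum)
qed

lemma frac_dehomogenize:
  assumes j: "j \<le> dim" "nonvan (var j)" and F: "F \<in> forms dim d"
  shows "frac C F (var j ^ d) = eval_via (const) F (\<lambda>i. frac C (var i) (var j))"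
proof -
  let ?K = "keys F" and ?l = "lookup"
  have G: "var j ^ d \<in> forms dim d"
    using forms_power[OF forms_var[OF j(1)], of d] by simp
  have nv: "nonvan (var j ^ d)" for d
    by (induction d) (use j nonvan_one nonvan_mult in auto)
  have m: "single m a \<in> forms dim d \<and> frac C (single m a) (var j ^ d) =
      const a * mon_value m (\<lambda>i. frac C (var i) (var j))" if m: "m \<in> ?K" for m a
  proof -
    have mf: "keys m \<subseteq> {..dim}" "mdeg m = d"
      using F m by (auto simp: forms_iff)
    have i: "is_fraction C (var i ^ n) (var j ^ n)"
      "frac C (var i ^ n) (var j ^ n) = frac C (var i) (var j) ^ n" if "i \<in> keys m" for i n
      using frac_power[OF is_fractionI[OF forms_var forms_var[OF j(1)] j(2)]] that mf(1) by auto
    let ?P = "\<lambda>j. \<Prod>i\<in>keys m. var (j i) ^ ?l m i"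
    have p: "is_fraction C (?P (\<lambda>i. i)) (?P (\<lambda>i. j))"
      "frac C (?P (\<lambda>i. i)) (?P (\<lambda>i. j)) = mon_value m (\<lambda>i. frac C (var i) (var j))"
      using frac_prod[of "keys m" "\<lambda>i. var i ^ ?l m i" "\<lambda>i. var j ^ ?l m i"] i
      by (simp_all add: mon_value_def)
    have Pj: "?P (\<lambda>i. j) = var j ^ d"
      using mf(2) by (simp add: mdeg_def flip: power_sum)
    have "frac C (single m a) (var j ^ d) =
        frac C (single 0 a * ?P (\<lambda>i. i)) (1 * ?P (\<lambda>i. j))"
      by (simp only: Pj mult_1 flip: monomial_as_prod)
    also have "\<dots> = const a * mon_value m (\<lambda>i. frac C (var i) (var j))"
      using frac_mult[OF is_fraction_const p(1), of a] p(2) by (simp add: const_fun_def)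
    finally show ?thesis using mf by (simp add: forms_iff)
  qed
  have "frac C F (var j ^ d) = frac C (\<Sum>m\<in>?K. single m (?l F m)) (var j ^ d)"
    by (simp flip: poly_mapping_expand)
  also have "\<dots> = (\<Sum>m\<in>?K. frac C (single m (?l F m)) (var j ^ d))"
    by (rule frac_sum[where d = d]) (use m G nv in auto)
  also have "\<dots> = eval_via (const) F (\<lambda>i. frac C (var i) (var j))"
    using m by (simp add: eval_via_def mon_value_def)
  finally show ?thesis .
qed

end

section \<open>Values, units and the maximal ideal at a point\<close>

locale curve_point = curve +
  fixes P assumes point: "P \<in> points C"
begin

abbreviation "\<O> \<equiv> local_ring C P"
abbreviation "v \<equiv> value_at C P"
abbreviation "parameter \<equiv> local_parameter C P"

lemmas const_in [simp] = const_in_local_ring[OF point]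
lemmas v_const [simp] = value_const[OF point]
lemmas add_in [simp] = local_ring_add_mult(1)[OF point]
lemmas v_add [simp] = local_ring_add_mult(2)[OF point]
lemmas mult_in [simp] = local_ring_add_mult(3)[OF point]
lemmas v_mult [simp] = local_ring_add_mult(4)[OF point]
lemmas inverse_in = local_ring_inverse[OF point]

lemma zero_in [simp]: "0 \<in> \<O>" and v_zero [simp]: "v 0 = 0"
  using const_in[of 0] v_const[of 0] by simp_all

lemma one_in [simp]: "1 \<in> \<O>" and v_one [simp]: "v 1 = 1"
  using const_in[of 1] v_const[of 1] by simp_all

lemma uminus_in [simp]: "f \<in> \<O> \<Longrightarrow> - f \<in> \<O>" and v_uminus [simp]: "f \<in> \<O> \<Longrightarrow> v (- f) = - v f"
proof -
  assume f: "f \<in> \<O>"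
  have e: "- f = const (- 1) * f" by (simp add: const.hom_uminus)
  show "- f \<in> \<O>" "v (- f) = - v f"
    unfolding e using f by (simp_all del: const.hom_uminus)
qed

lemma diff_in [simp]: "f \<in> \<O> \<Longrightarrow> g \<in> \<O> \<Longrightarrow> f - g \<in> \<O>"
  and v_diff [simp]: "f \<in> \<O> \<Longrightarrow> g \<in> \<O> \<Longrightarrow> v (f - g) = v f - v g"
  using add_in[of f "- g"] v_add[of f "- g"] by simp_all

lemma sum_in [simp]: "(\<And>i. i \<in> S \<Longrightarrow> f i \<in> \<O>) \<Longrightarrow> (\<Sum>i\<in>S. f i) \<in> \<O>"
  by (induction S rule: infinite_finite_induct) auto

lemma v_sum [simp]: "(\<And>i. i \<in> S \<Longrightarrow> f i \<in> \<O>) \<Longrightarrow> v (\<Sum>i\<in>S. f i) = (\<Sum>i\<in>S. v (f i))"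
  by (induction S rule: infinite_finite_induct) auto

lemma prod_in [simp]: "(\<And>i. i \<in> S \<Longrightarrow> f i \<in> \<O>) \<Longrightarrow> (\<Prod>i\<in>S. f i) \<in> \<O>"
  by (induction S rule: infinite_finite_induct) auto

lemma power_in [simp]: "f \<in> \<O> \<Longrightarrow> f ^ n \<in> \<O>"
  by (induction n) auto

lemma v_power [simp]: "f \<in> \<O> \<Longrightarrow> v (f ^ n) = v f ^ n"
  by (induction n) auto

definition unit :: "'b \<Rightarrow> bool" where
  "unit u \<longleftrightarrow> u \<in> \<O> \<and> v u \<noteq> 0"

lemma unit_in: "unit u \<Longrightarrow> u \<in> \<O>" and unit_nonzero: "unit u \<Longrightarrow> u \<noteq> 0"
  by (auto simp: unit_def)

lemma unit_inverse: "unit u \<Longrightarrow> unit (inverse u)"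
  and v_inverse: "unit u \<Longrightarrow> v (inverse u) = inverse (v u)"
proof -
  assume u: "unit u"
  then have i: "inverse u \<in> \<O>" by (auto simp: unit_def inverse_in)
  have "v (u * inverse u) = v u * v (inverse u)"
    using u i by (simp add: unit_def del: right_inverse)
  moreover have "u * inverse u = 1" using unit_nonzero[OF u] by simp
  ultimately have *: "v u * v (inverse u) = 1" by simp
  then show "v (inverse u) = inverse (v u)" by (metis inverse_unique)
  show "unit (inverse u)" using i * by (auto simp: unit_def)
qed

lemma unit_mult: "unit u \<Longrightarrow> unit w \<Longrightarrow> unit (u * w)"
  by (simp add: unit_def)

lemma unit_one: "unit 1"
  by (simp add: unit_def)

lemma unit_power: "unit u \<Longrightarrow> unit (u ^ n)"
  by (induction n) (auto simp: unit_one unit_mult)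

lemma unit_powi: "unit u \<Longrightarrow> unit (u powi n)"
  by (simp add: power_int_def unit_power unit_inverse)

lemma unit_iff: "unit u \<longleftrightarrow> u \<noteq> 0 \<and> u \<in> \<O> \<and> inverse u \<in> \<O>"
proof
  assume *: "u \<noteq> 0 \<and> u \<in> \<O> \<and> inverse u \<in> \<O>"
  then have "v (u * inverse u) = v u * v (inverse u)" by (simp del: right_inverse)
  then have "v u * v (inverse u) = 1" using * by simp
  then show "unit u" using * by (auto simp: unit_def)
qed (use unit_inverse unit_nonzero in \<open>auto simp: unit_def\<close>)

abbreviation "\<mm> \<equiv> max_ideal C P"

lemma max_ideal_iff: "f \<in> \<mm> \<longleftrightarrow> f \<in> \<O> \<and> v f = 0"
  by (simp add: max_ideal_def)

lemma const_poly_in: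
  assumes "t \<in> \<O>" shows "const_poly A t \<in> \<O> \<and> v (const_poly A t) = poly A (v t)"
proof (induction A)
  case 0
  then show ?case by simp
next
  case (pCons a A)
  have "const_poly (pCons a A) t = const a + t * const_poly A t"
    using pCons by (simp add: map_poly_pCons)
  then show ?case using pCons assms by simp
qed

text \<open>M is an ideal, and polynomial expressions respect congruence modulo an ideal. It will be
  the ideal generated by the centered coordinates, with x' the values of the affine coordinates at
  P.\<close>

lemma eval_via_congruent:
  assumes x: "\<And>i. x i \<in> \<O>" "\<And>i. x' i \<in> \<O>"
    and zero: "0 \<in> M" and M: "M \<subseteq> \<O>" "\<And>f g. f \<in> M \<Longrightarrow> g \<in> M \<Longrightarrow> f + g \<in> M" "\<And>f g. f \<in> \<O> \<Longrightarrow> g \<in> M \<Longrightarrow> f * g \<in> M"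
    and xx: "\<And>i. i \<le> n \<Longrightarrow> x i - x' i \<in> M" and F: "F \<in> forms n d"
  shows "eval_via (const) F x - eval_via (const) F x' \<in> M"
proof -
  have mult: "a * b - a' * b' \<in> M" if "a - a' \<in> M" "b - b' \<in> M" "a' \<in> \<O>" "b \<in> \<O>" for a a' b b'
  proof -
    have "a * b - a' * b' = b * (a - a') + a' * (b - b')" by (simp add: algebra_simps)
    then show ?thesis using that M by simp
  qed
  have pow: "x i ^ k - x' i ^ k \<in> M" if "i \<le> n" for i k
    by (induction k) (use zero mult xx[OF that] x in auto)
  have prod: "(\<Prod>i\<in>S. x i ^ e i) - (\<Prod>i\<in>S. x' i ^ e i) \<in> M" if "finite S" "S \<subseteq> {..n}" for S e
    using that
  proof (induction S rule: finite_induct)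
    case (insert s S)
    then show ?case
      using mult[OF pow[of s "e s"], of "\<Prod>i\<in>S. x i ^ e i" "\<Prod>i\<in>S. x' i ^ e i"] x by simp
  qed (simp add: zero)
  have sum: "(\<Sum>i\<in>S. f i) \<in> M" if "\<And>i. i \<in> S \<Longrightarrow> f i \<in> M" for S :: "(nat \<Rightarrow>\<^sub>0 nat) set" and f
    using that by (induction S rule: infinite_finite_induct) (auto simp: zero M)
  show ?thesis
    unfolding eval_via_def sum_subtractf[symmetric] right_diff_distrib[symmetric]
    by (intro sum M prod) (use F in \<open>auto simp: forms_iff\<close>)
qed

section \<open>Affine coordinates generate the maximal ideal\<close>

definition affine :: "nat \<Rightarrow> nat \<Rightarrow> 'b" where
  "affine j i = frac C (var i) (var j)"

definition centered :: "nat \<Rightarrow> nat \<Rightarrow> 'b" where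
  "centered j i = affine j i - const (v (affine j i))"

context
  fixes j assumes j: "j \<le> dim" "rep P j \<noteq> 0"
begin

lemma var_nonvan: "nonvan (var j)"
  by (rule nonvanI[OF point forms_var[OF j(1)]]) (use j in simp)

lemma affine_in: "i \<le> dim \<Longrightarrow> affine j i \<in> \<O>" "i \<le> dim \<Longrightarrow> v (affine j i) = rep P i / rep P j"
  using in_local_ringI[OF point forms_var forms_var[OF j(1)]] j by (simp_all add: affine_def)

lemma centered_in: "i \<le> dim \<Longrightarrow> centered j i \<in> \<mm>"
  by (simp add: centered_def max_ideal_iff affine_in)

text \<open>A first-order Taylor argument. Divided by a power of the j-th variable, the numerator
  becomes a polynomial in the affine coordinates, congruent to its value at P, which is 0; the
  denominator becomes a unit.\<close>

lemma centered_generate: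
  assumes "f \<in> \<mm>"
  shows "\<exists>b. (\<forall>i. b i \<in> \<O>) \<and> f = (\<Sum>i\<le>dim. b i * centered j i)"
proof -
  obtain F G d where F: "F \<in> forms dim d" "G \<in> forms dim d" "eval G (rep P) \<noteq> 0" "f = frac C F G"
      "is_fraction C F G"
    using in_local_ringE[OF point, of f] assms unfolding max_ideal_iff by blast
  let ?X = "var j ^ d"
  have X: "?X \<in> forms dim d" using forms_power[OF forms_var[OF j(1)], of d] by simp
  have evX: "eval ?X (rep P) = rep P j ^ d" by (simp add: eval_power)
  have F0: "eval F (rep P) = 0"
    using in_local_ringI(2)[OF point F(1-3)] F(3,4) assms by (simp add: max_ideal_iff)
  define M where "M = {\<Sum>i\<le>dim. b i * centered j i | b. \<forall>i. b i \<in> \<O>}"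
  have zero: "0 \<in> M" unfolding M_def by (auto intro!: exI[of _ "\<lambda>_. 0"])
  have M1: "M \<subseteq> \<O>" unfolding M_def using centered_in by (auto simp: max_ideal_iff intro!: sum_in)
  have M2: "f + g \<in> M" if "f \<in> M" "g \<in> M" for f g
  proof -
    obtain b c where "f = (\<Sum>i\<le>dim. b i * centered j i)" "g = (\<Sum>i\<le>dim. c i * centered j i)"
      "\<forall>i. b i \<in> \<O>" "\<forall>i. c i \<in> \<O>" using \<open>f \<in> M\<close> \<open>g \<in> M\<close> by (auto simp: M_def)
    then show ?thesis unfolding M_def
      by (auto intro!: exI[of _ "\<lambda>i. b i + c i"] simp: distrib_right sum.distrib)
  qed
  have M3: "f * g \<in> M" if "f \<in> \<O>" "g \<in> M" for f g
  proof -
    obtain c where "g = (\<Sum>i\<le>dim. c i * centered j i)"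
      "\<forall>i. c i \<in> \<O>" using \<open>g \<in> M\<close> by (auto simp: M_def)
    then show ?thesis unfolding M_def using \<open>f \<in> \<O>\<close>
      by (auto intro!: exI[of _ "\<lambda>i. f * c i"] simp: sum_distrib_left mult.assoc)
  qed
  define x where "x i = (if i \<le> dim then affine j i else 0)" for i
  define x' where "x' i = const (if i \<le> dim then rep P i / rep P j else 0)" for i
  have "x i - x' i \<in> M" if "i \<le> dim" for i
  proof -
    have "x i - x' i = (\<Sum>k\<le>dim. if k = i then centered j k else 0)"
      using that by (simp add: x_def x'_def centered_def affine_in)
    also have "\<dots> = (\<Sum>k\<le>dim. (if k = i then 1 else 0) * centered j k)"
      by (intro sum.cong) auto
    finally have "x i - x' i = (\<Sum>k\<le>dim. (if k = i then 1 else 0) * centered j k)" .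
    then show ?thesis unfolding M_def by fastforce
  qed
  then have "eval_via (const) F x - eval_via (const) F x' \<in> M"
    using eval_via_congruent[of x x' M dim F d] zero M1 M2 M3 F(1)
    by (simp add: x_def x'_def affine_in)
  moreover have "eval_via (const) F x = frac C F ?X"
  proof -
    have "eval_via (const) F x = eval_via (const) F (affine j)"
      unfolding eval_via_def
      by (intro sum.cong prod.cong refl arg_cong2[of _ _ _ _ "(*)"]) (use F(1) in \<open>auto simp: forms_iff x_def\<close>)
    then show ?thesis
      using frac_dehomogenize[OF j(1) var_nonvan F(1)] by (simp add: affine_def[abs_def])
  qed
  moreover have "eval_via (const) F x' = 0"
  proof -
    have "eval_via (const) F x' = const (eval F (\<lambda>i. if i \<le> dim then rep P i / rep P j else 0))"
      by (simp add: eval_via_def x'_def const.hom_sum const.hom_mult const.hom_prod const.hom_power)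
    also have "(\<lambda>i. if i \<le> dim then rep P i / rep P j else 0) = (\<lambda>i. inverse (rep P j) * rep P i)"
      using proj_pointE(4)[OF points_proj[OF point]] by (auto simp: divide_inverse not_le)
    also have "eval F \<dots> = 0"
      using homogeneous_eval_scale[of d F "inverse (rep P j)" "rep P"] F(1) F0 by (simp add: forms_def)
    finally show ?thesis by simp
  qed
  ultimately have "frac C F ?X \<in> M" by simp
  moreover have "f = inverse (frac C G ?X) * frac C F ?X \<and> inverse (frac C G ?X) \<in> \<O>"
  proof -
    have g: "is_fraction C G ?X" "is_fraction C F ?X" "frac C G ?X \<in> \<O>" "v (frac C G ?X) \<noteq> 0"
      using in_local_ringI[OF point F(2) X] in_local_ringI[OF point F(1) X] F(3) j evX by simp_all
    have "frac C G ?X * f = frac C F ?X"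
      unfolding F(4) frac_mult[OF g(1) F(5)]
      using frac_eq_iff[OF is_fraction_mult[OF g(1) F(5)] g(2)]
      by (simp add: vanishes_at_def algebra_simps)
    moreover have "frac C G ?X \<noteq> 0" using g(4) by auto
    ultimately show ?thesis
      using inverse_in[OF g(3,4)] by (simp add: field_simps)
  qed
  ultimately have "f \<in> M" using M3 by auto
  then show ?thesis by (auto simp: M_def)
qed

end

end

section \<open>Existence and comparison of local parameters\<close>

context curve_point
begin

lemma coordinate_exists: "\<exists>j\<le>dim. rep P j \<noteq> 0"
  using proj_pointE(5)[OF points_proj[OF point]] .

text \<open>A Nakayama argument: the generators of \<open>\<mm>\<close> are eliminated one at a time.\<close>

lemma eliminate_generators:
  assumes "finite S" "t \<in> \<O>" "\<And>i. i \<in> S \<Longrightarrow> z i \<in> \<O>"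
    "\<And>i. i \<in> S \<Longrightarrow> \<exists>h b. h \<in> \<O> \<and> (\<forall>k. b k \<in> \<mm>) \<and> z i = t * h + (\<Sum>k\<in>S. b k * z k)"
  shows "\<forall>i\<in>S. \<exists>h\<in>\<O>. z i = t * h"
  using assms
proof (induction S rule: finite_induct)
  case (insert s S)
  obtain h b where s: "h \<in> \<O>" "\<And>k. b k \<in> \<mm>" "z s = t * h + (\<Sum>k\<in>insert s S. b k * z k)"
    using insert.prems(3)[of s] by blast
  \<comment> \<open>The element 1 - b s has value 1, so it is a unit and the relation can be solved
    for \<open>z s\<close>.\<close>
  define u where "u = inverse (1 - b s)"
  have bO: "b k \<in> \<O>" "v (b k) = 0" for k
    using s(2) by (auto simp: max_ideal_iff)
  then have u: "u \<in> \<O>" "unit (1 - b s)"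
    using unit_inverse[of "1 - b s"] by (auto simp: u_def unit_def)
  have "(1 - b s) * z s = t * h + (\<Sum>k\<in>S. b k * z k)"
    using s(3) insert.hyps by (simp add: algebra_simps)
  moreover have "u * (1 - b s) = 1"
    using unit_nonzero[OF u(2)] by (simp add: u_def)
  ultimately have "z s = u * (t * h + (\<Sum>k\<in>S. b k * z k))"
    by (metis mult.assoc mult_1)
  then have zs: "z s = t * (u * h) + (\<Sum>k\<in>S. u * b k * z k)"
    by (simp add: algebra_simps sum_distrib_left)
  have "\<forall>i\<in>S. \<exists>h\<in>\<O>. z i = t * h"
  proof (rule insert.IH)
    fix i assume i: "i \<in> S"
    obtain h' b' where i': "h' \<in> \<O>" "\<And>k. b' k \<in> \<mm>" "z i = t * h' + (\<Sum>k\<in>insert s S. b' k * z k)"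
      using insert.prems(3)[of i] i by blast
    have b'O: "b' k \<in> \<O>" "v (b' k) = 0" for k
      using i'(2) by (auto simp: max_ideal_iff)
    have "z i = t * h' + b' s * z s + (\<Sum>k\<in>S. b' k * z k)"
      using i'(3) insert.hyps by (simp add: add.assoc)
    also have "\<dots> = t * (h' + b' s * (u * h)) + (\<Sum>k\<in>S. (b' k + b' s * u * b k) * z k)"
      unfolding zs by (simp add: algebra_simps sum_distrib_left sum.distrib)
    finally have "z i = t * (h' + b' s * (u * h)) + (\<Sum>k\<in>S. (b' k + b' s * u * b k) * z k)" .
    moreover have "h' + b' s * (u * h) \<in> \<O>" "\<forall>k. b' k + b' s * u * b k \<in> \<mm>"
      using i' b'O bO u s by (simp_all add: max_ideal_iff)
    ultimately show "\<exists>h b. h \<in> \<O> \<and> (\<forall>k. b k \<in> \<mm>) \<and> z i = t * h + (\<Sum>k\<in>S. b k * z k)"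
      by (intro exI[of _ "h' + b' s * (u * h)"] exI[of _ "\<lambda>k. b' k + b' s * u * b k"]) simp
  qed (use insert.prems in auto)
  then obtain g where g: "\<And>i. i \<in> S \<Longrightarrow> g i \<in> \<O> \<and> z i = t * g i" by metis
  have "z s = t * (u * h + (\<Sum>k\<in>S. u * b k * g k))"
    unfolding zs by (simp add: distrib_left sum_distrib_left) (intro sum.cong; simp add: g mult_ac)
  moreover have "u * h + (\<Sum>k\<in>S. u * b k * g k) \<in> \<O>"
    using g u s bO by simp
  ultimately show ?case using g by blast
qed simp

text \<open>Elements of the square of the maximal ideal are combinations of the centered coordinates
  with coefficients in that ideal. So non-singularity writes each centered coordinate as a multiple
  of t plus such a combination, and elimination leaves t as the only generator. It is nonzero
  because the empty sum lies in the square.\<close>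

lemma parameter_exists: "\<exists>t. parameter t \<and> t \<noteq> 0"
proof -
  obtain t where t: "t \<in> \<mm>" "t \<notin> max_ideal_sq C P"
    "\<And>f. f \<in> \<mm> \<Longrightarrow> \<exists>c. f - scale_fun C c t \<in> max_ideal_sq C P"
    using curve point unfolding nonsingular_projective_curve_def by blast
  obtain j where j: "j \<le> dim" "rep P j \<noteq> 0" using coordinate_exists by blast
  let ?z = "centered j"
  have sq: "\<exists>b. (\<forall>k. b k \<in> \<mm>) \<and> f = (\<Sum>k\<le>dim. b k * ?z k)" if sq_mem: "f \<in> max_ideal_sq C P" for f
  proof -
    obtain N :: nat and a b where ab: "f = (\<Sum>i<N. a i * b i)" "\<And>i. i < N \<Longrightarrow> a i \<in> \<mm> \<and> b i \<in> \<mm>"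
      using sq_mem by (auto simp: max_ideal_sq_def)
    have "\<forall>i. \<exists>e. i < N \<longrightarrow> (\<forall>k. e k \<in> \<O>) \<and> b i = (\<Sum>k\<le>dim. e k * ?z k)"
      using centered_generate[OF j] ab(2) by blast
    then obtain e where e: "\<And>i. i < N \<Longrightarrow> (\<forall>k. e i k \<in> \<O>) \<and> b i = (\<Sum>k\<le>dim. e i k * ?z k)"
      by metis
    have "f = (\<Sum>i<N. \<Sum>k\<le>dim. a i * e i k * ?z k)"
      unfolding ab(1) by (intro sum.cong refl) (simp add: e sum_distrib_left mult.assoc)
    also have "\<dots> = (\<Sum>k\<le>dim. (\<Sum>i<N. a i * e i k) * ?z k)"
      by (subst sum.swap) (simp add: sum_distrib_right)
    finally have f_eq: "f = (\<Sum>k\<le>dim. (\<Sum>i<N. a i * e i k) * ?z k)" .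
    have ae: "a i * e i k \<in> \<O>" "v (a i * e i k) = 0" if "i < N" for i k
      using e[OF that] ab(2)[OF that] by (auto simp: max_ideal_iff)
    have "(\<Sum>i<N. a i * e i k) \<in> \<O>" for k
      by (rule sum_in) (use ae in auto)
    moreover have "v (\<Sum>i<N. a i * e i k) = 0" for k
      by (subst v_sum) (use ae in \<open>auto intro: sum.neutral simp del: v_mult\<close>)
    ultimately have "\<forall>k. (\<Sum>i<N. a i * e i k) \<in> \<mm>"
      by (simp add: max_ideal_iff)
    then show ?thesis using f_eq by (intro exI[of _ "\<lambda>k. \<Sum>i<N. a i * e i k"]) simp
  qed
  have tO: "t \<in> \<O>" "v t = 0" using t(1) by (auto simp: max_ideal_iff)
  have "\<forall>i\<in>{..dim}. \<exists>h\<in>\<O>. ?z i = t * h"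
  proof (rule eliminate_generators)
    fix i assume i: "i \<in> {..dim}"
    then obtain c where "?z i - scale_fun C c t \<in> max_ideal_sq C P"
      using t(3) centered_in[OF j] by auto
    then obtain b where b: "\<forall>k. b k \<in> \<mm>" "?z i - scale_fun C c t = (\<Sum>k\<le>dim. b k * ?z k)"
      using sq by blast
    have "?z i = t * const c + (\<Sum>k\<le>dim. b k * ?z k)"
      using b(2) by (simp add: scale_fun_def algebra_simps)
    then show "\<exists>h b. h \<in> \<O> \<and> (\<forall>k. b k \<in> \<mm>) \<and> ?z i = t * h + (\<Sum>k\<le>dim. b k * ?z k)"
      using b(1) const_in by blast
  qed (use tO centered_in[OF j] in \<open>auto simp: max_ideal_iff\<close>)
  then obtain g where g: "\<And>i. i \<le> dim \<Longrightarrow> g i \<in> \<O> \<and> ?z i = t * g i" by (metis atMost_iff)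
  have "f \<in> \<mm> \<longleftrightarrow> (\<exists>h\<in>\<O>. f = t * h)" for f
  proof
    assume "f \<in> \<mm>"
    then obtain b where b: "\<forall>i. b i \<in> \<O>" "f = (\<Sum>i\<le>dim. b i * ?z i)"
      using centered_generate[OF j] by blast
    have "f = t * (\<Sum>i\<le>dim. b i * g i)"
      unfolding b(2) sum_distrib_left by (intro sum.cong refl) (simp add: g mult_ac)
    moreover have "(\<Sum>i\<le>dim. b i * g i) \<in> \<O>" by (rule sum_in) (use b(1) g in auto)
    ultimately show "\<exists>h\<in>\<O>. f = t * h" by blast
  qed (use tO in \<open>auto simp: max_ideal_iff\<close>)
  then have "parameter t" unfolding local_parameter_def by blast
  moreover have "t \<noteq> 0"
  proof
    assume "t = 0"
    have "0 \<in> max_ideal_sq C P"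
      unfolding max_ideal_sq_def by (auto intro!: exI[of _ "0::nat"])
    with t(2) \<open>t = 0\<close> show False by simp
  qed
  ultimately show ?thesis by blast
qed

lemma parameter_nonzero: "parameter t \<Longrightarrow> t \<noteq> 0"
  and parameter_in: "parameter t \<Longrightarrow> t \<in> \<O>" "parameter t \<Longrightarrow> v t = 0"
proof -
  assume t: "parameter t"
  obtain t' where t': "parameter t'" "t' \<noteq> 0" using parameter_exists by blast
  have "t' \<in> \<mm>" using t'(1) by (auto simp: local_parameter_def intro!: exI[of _ 1])
  then show "t \<noteq> 0" using t t'(2) by (auto simp: local_parameter_def)
  have "t \<in> \<mm>" using t by (auto simp: local_parameter_def intro!: exI[of _ 1])
  then show "t \<in> \<O>" "v t = 0" by (auto simp: max_ideal_iff)
qed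

lemma parameter_divides:
  assumes "parameter t" "f \<in> \<O>" "v f = 0"
  shows "f / t \<in> \<O>"
proof -
  have "f \<in> \<mm>" using assms by (simp add: max_ideal_iff)
  then obtain h where "f = t * h" "h \<in> \<O>" using assms(1) by (auto simp: local_parameter_def)
  then show ?thesis using parameter_nonzero[OF assms(1)] by simp
qed

lemma parameter_transcendental:
  assumes "parameter t" shows "t \<notin> range (const)"
proof
  assume "t \<in> range (const)"
  then obtain c where "t = const c" by auto
  then show False using parameter_in[OF assms] parameter_nonzero[OF assms] by simp
qed

lemma parameter_mult_unit:
  assumes "parameter t" "unit u"
  shows "parameter (t * u)"
proof -
  have "(\<exists>h\<in>\<O>. f = t * u * h) \<longleftrightarrow> (\<exists>h\<in>\<O>. f = t * h)" for f
  proof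
    assume "\<exists>h\<in>\<O>. f = t * h"
    then obtain h where "h \<in> \<O>" "f = t * h" by blast
    then have "f = t * u * (inverse u * h)" "inverse u * h \<in> \<O>"
      using unit_nonzero[OF assms(2)] unit_inverse[OF assms(2)] by (auto simp: unit_def)
    then show "\<exists>h\<in>\<O>. f = t * u * h" by blast
  qed (use assms(2) in \<open>auto simp: mult.assoc unit_def\<close>)
  then show ?thesis using assms(1) unfolding local_parameter_def by blast
qed

lemma parameters_associated:
  assumes "parameter t" "parameter t'"
  obtains u where "unit u" "t' = t * u"
proof -
  have 1: "t' / t \<in> \<O>" "t / t' \<in> \<O>"
    using parameter_divides parameter_in assms by blast+
  have nz: "t \<noteq> 0" "t' \<noteq> 0" using parameter_nonzero assms by auto
  have "unit (t' / t)" unfolding unit_iff using 1 nz by simp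
  then show thesis using that[of "t' / t"] nz by simp
qed

text \<open>The intersection of the powers of \<open>\<mm>\<close> is zero since every function is algebraic over \<open>\<kappa>(t)\<close>:
  the constant coefficient of a minimal relation is a multiple of \<open>f\<close>, but only divisible by a
  bounded power of \<open>t\<close>.\<close>

lemma not_infinitely_divisible:
  assumes t: "parameter t" and f: "f \<noteq> 0"
  shows "\<exists>k. f / t ^ k \<notin> \<O>"
proof (rule ccontr)
  assume "\<not> ?thesis"
  then have div: "f / t ^ k \<in> \<O>" for k by blast
  have fO: "f \<in> \<O>" using div[of 0] by simp
  note tt = parameter_transcendental[OF t]
  obtain q where q: "q \<noteq> 0" "over t q" "poly q f = 0"
    "\<And>p. p \<noteq> 0 \<Longrightarrow> over t p \<Longrightarrow> degree p < degree q \<Longrightarrow> poly p f \<noteq> 0"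
    using minimal_relation[OF tt] by blast
  obtain a p where ap: "q = pCons a p" by (metis pCons_cases)
  obtain A where A: "a = const_poly A t"
    using q(2) unfolding over_def ap by (metis coeff_pCons_0)
  have p_over: "over t p"
    unfolding over_def
  proof
    fix i show "\<exists>A. coeff p i = const_poly A t"
      using q(2)[unfolded over_def, rule_format, of "Suc i"] by (simp add: ap)
  qed
  have "a \<noteq> 0"
  proof
    assume "a = 0"
    then have "p \<noteq> 0" "poly p f = 0" using q(1,3) f by (auto simp: ap)
    then show False using q(4)[OF _ p_over] by (simp add: ap)
  qed
  then have "A \<noteq> 0" using A by auto
  \<comment> \<open>Split off the zero of A at 0; since t has value 0, the remaining factor
    \<open>const_poly B t\<close> is a unit.\<close>
  then obtain k B where B: "A = monom 1 k * B" "poly B 0 \<noteq> 0"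
  proof -
    obtain B where "A = [:- 0, 1:] ^ order 0 A * B" "\<not> [:- 0, 1:] dvd B"
      using order_decomp[OF \<open>A \<noteq> 0\<close>, of 0] by blast
    then show ?thesis
      using that[of "order 0 A" B] by (simp add: monom_altdef poly_eq_0_iff_dvd)
  qed
  have cB: "unit (const_poly B t)"
    using const_poly_in[OF parameter_in(1)[OF t], of B] parameter_in(2)[OF t] B(2) by (simp add: unit_def)
  have coeffs: "coeff p i \<in> \<O>" for i
    using p_over const_poly_in[OF parameter_in(1)[OF t]] unfolding over_def by metis
  have pf: "poly p f \<in> \<O>"
    unfolding poly_altdef using coeffs fO by simp
  have eq: "- (f * poly p f) = t ^ k * const_poly B t"
    using q(3) A by (simp add: ap B(1) neg_eq_iff_add_eq_0 poly_monom add.commute)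
  \<comment> \<open>One power of t beyond k is divided out of f, so 1 appears as t times a regular
    function, whose value is 0.\<close>
  have "t * (- (f / t ^ Suc k) * poly p f * inverse (const_poly B t)) =
      - (f * poly p f) * inverse (t ^ k * const_poly B t)"
    using parameter_nonzero[OF t] by (simp add: field_simps)
  also have "\<dots> = 1"
    unfolding eq using parameter_nonzero[OF t] unit_nonzero[OF cB] by (simp del: inverse_mult_distrib)
  finally have "v 1 = v (t * (- (f / t ^ Suc k) * poly p f * inverse (const_poly B t)))"
    by simp
  then show False
    using pf div[of "Suc k"] unit_inverse[OF cB] parameter_in[OF t] by (simp add: unit_def del: times_divide_eq_left times_divide_eq_right power_Suc)
qed

section \<open>Orders of vanishing\<close>

lemma regular_decomposition:
  assumes t: "parameter t" and f: "f \<noteq> 0" "f \<in> \<O>"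
  obtains n u where "unit u" "f = u * t ^ n"
proof -
  \<comment> \<open>The least bad exponent k is positive because f is regular; n is its predecessor,
    and a zero value of f / t^n would make k good as well.\<close>
  obtain k where k: "f / t ^ k \<notin> \<O>" "\<And>n. n < k \<Longrightarrow> f / t ^ n \<in> \<O>"
    using not_infinitely_divisible[OF t f(1)] exists_least_iff[of "\<lambda>k. f / t ^ k \<notin> \<O>"] by blast
  have "k \<noteq> 0" using k(1) f(2) by (auto intro: ccontr)
  then obtain n where n: "k = Suc n" by (metis not0_implies_Suc)
  have 1: "f / t ^ n \<in> \<O>" using k(2) n by simp
  have "v (f / t ^ n) \<noteq> 0"
    using parameter_divides[OF t 1] k(1) by (auto simp: n field_simps)
  then have "unit (f / t ^ n)" using 1 by (simp add: unit_def)
  moreover have "f = f / t ^ n * t ^ n" using parameter_nonzero[OF t] by simp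
  ultimately show thesis by (rule that)
qed

text \<open>Divide numerator and denominator by a power of a variable that does not vanish at P;
  both become regular there.\<close>

lemma fraction_of_regular:
  obtains a b where "a \<in> \<O>" "b \<in> \<O>" "b \<noteq> 0" "f = a / b"
proof -
  obtain F G where FG: "is_fraction C F G" "f = frac C F G" by (rule frac_surj)
  obtain d where d: "F \<in> forms dim d" "G \<in> forms dim d" "nonvan G"
    using FG(1) by (rule is_fractionE)
  obtain j where j: "j \<le> dim" "rep P j \<noteq> 0" using coordinate_exists by blast
  let ?X = "var j ^ d"
  have X: "?X \<in> forms dim d" using forms_power[OF forms_var[OF j(1)], of d] by simp
  have evX: "eval ?X (rep P) \<noteq> 0" using j by (simp add: eval_power)
  note a = in_local_ringI[OF point d(1) X evX]
  note b = in_local_ringI[OF point d(2) X evX]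
  have "frac C G ?X \<noteq> 0"
    using frac_eq_0_iff[OF b(3)] d(3) by (auto simp: nonvan_def)
  moreover have "frac C G ?X * f = frac C F ?X"
    unfolding FG(2) frac_mult[OF b(3) FG(1)]
    using frac_eq_iff[OF is_fraction_mult[OF b(3) FG(1)] a(3)]
    by (simp add: vanishes_at_def algebra_simps)
  ultimately show thesis
    using that[OF a(1) b(1)] by (simp add: field_simps)
qed

lemma decomposition:
  assumes t: "parameter t" and f: "f \<noteq> 0"
  obtains e u where "unit u" "f = u * t powi e"
proof -
  obtain a b where ab: "a \<in> \<O>" "b \<in> \<O>" "b \<noteq> 0" "f = a / b" by (rule fraction_of_regular)
  have "a \<noteq> 0" using ab(4) f by auto
  then obtain n u where u: "unit u" "a = u * t ^ n" using regular_decomposition[OF t _ ab(1)] by blast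
  obtain m w where w: "unit w" "b = w * t ^ m" using regular_decomposition[OF t ab(3,2)] by blast
  have "f = u * inverse w * t powi (int n - int m)"
    using u w ab(4) parameter_nonzero[OF t] by (simp add: power_int_diff field_simps)
  then show thesis using that[of "u * inverse w"] u w unit_mult unit_inverse by blast
qed

lemma unit_times_powi_unique:
  assumes t: "parameter t" and "unit u" "unit w" "u * t powi d = w * t powi e"
  shows "d = e"
proof -
  have no: "\<not> d < e" if uw: "unit u" "unit w" "u * t powi d = w * t powi e" for u w d e
  proof
    assume "d < e"
    define n where "n = nat (e - d)"
    have n: "t powi e = t powi d * t ^ n" "n > 0"
      using \<open>d < e\<close> parameter_nonzero[OF t] by (simp_all add: n_def flip: power_int_of_nat power_int_add)
    have "u = w * t ^ n"
      using uw(3) parameter_nonzero[OF t] unfolding n(1) by simp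
    then have "v u = v w * v t ^ n"
      using uw parameter_in[OF t] by (simp add: unit_def)
    then show False using uw(1) parameter_in(2)[OF t] n(2) by (simp add: unit_def)
  qed
  show ?thesis
    using no[OF assms(2,3,4)] no[OF assms(3,2) assms(4)[symmetric]] by linarith
qed

text \<open>\<open>ord_at\<close> allows any parameter. Two parameters differ by a unit, and so do
  their powers, so the exponent is the same for all.\<close>

lemma ord_atI:
  assumes t: "parameter t" and u: "unit u" "f = u * t powi e"
  shows "ord_at C P f = e"
  unfolding ord_at_def
proof (rule the_equality)
  show "\<exists>t u. parameter t \<and> u \<noteq> 0 \<and> u \<in> \<O> \<and> inverse u \<in> \<O> \<and> f = u * t powi e"
    using t u unit_iff by blast
next
  fix d assume "\<exists>t u. parameter t \<and> u \<noteq> 0 \<and> u \<in> \<O> \<and> inverse u \<in> \<O> \<and> f = u * t powi d"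
  then obtain t' w where w: "parameter t'" "unit w" "f = w * t' powi d"
    using unit_iff by blast
  obtain a where a: "unit a" "t' = t * a" using parameters_associated[OF t w(1)] by blast
  have "w * a powi d * t powi d = u * t powi e"
    using u(2) w(3) by (simp add: a(2) power_int_mult_distrib mult_ac)
  then show "d = e"
    using unit_times_powi_unique[OF t unit_mult[OF w(2) unit_powi[OF a(1)]] u(1)] by blast
qed

abbreviation "ord \<equiv> ord_at C P"

lemma ord_decomposition:
  assumes "parameter t" "f \<noteq> 0"
  obtains u where "unit u" "f = u * t powi ord f"
  using decomposition[OF assms] ord_atI[OF assms(1)] by metis

lemma ord_mult:
  assumes "f \<noteq> 0" "g \<noteq> 0" shows "ord (f * g) = ord f + ord g"
proof -
  obtain t where t: "parameter t" "t \<noteq> 0" using parameter_exists by blast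
  obtain u where u: "unit u" "f = u * t powi ord f" using ord_decomposition[OF t(1) assms(1)] .
  obtain w where w: "unit w" "g = w * t powi ord g" using ord_decomposition[OF t(1) assms(2)] .
  have "f * g = (u * w) * (t powi ord f * t powi ord g)"
    by (subst u(2), subst w(2)) (simp add: mult_ac)
  also have "\<dots> = (u * w) * t powi (ord f + ord g)"
    using t by (simp add: power_int_add)
  finally show ?thesis using ord_atI[OF t(1) unit_mult[OF u(1) w(1)]] by blast
qed

lemma ord_unit: "unit u \<Longrightarrow> ord u = 0"
  using parameter_exists ord_atI[of _ u u 0] by auto

lemma ord_inverse: assumes "f \<noteq> 0" shows "ord (inverse f) = - ord f"
  using ord_mult[of f "inverse f"] assms ord_unit[OF unit_one] by simp

lemma ord_divide: "f \<noteq> 0 \<Longrightarrow> g \<noteq> 0 \<Longrightarrow> ord (f / g) = ord f - ord g"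
  using ord_mult[of f "inverse g"] ord_inverse[of g] by (simp add: divide_inverse)

lemma parameter_powi_nonzero: "parameter t \<Longrightarrow> t powi n \<noteq> 0"
  using parameter_nonzero by (simp add: power_int_eq_0_iff)

lemma ord_parameter_powi: "parameter t \<Longrightarrow> ord (t powi n) = n"
  using ord_atI[of t 1 "t powi n" n] unit_one by simp

lemma in_iff_ord: "f \<noteq> 0 \<Longrightarrow> f \<in> \<O> \<longleftrightarrow> ord f \<ge> 0"
proof -
  assume f: "f \<noteq> 0"
  obtain t where t: "parameter t" "t \<noteq> 0" using parameter_exists by blast
  obtain u where u: "unit u" "f = u * t powi ord f" using ord_decomposition[OF t(1) f] .
  show ?thesis
  proof
    assume "f \<in> \<O>"
    then obtain n w where "unit w" "f = w * t ^ n"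
      using regular_decomposition[OF t(1) f] by blast
    then have "ord f = int n" using ord_atI[OF t(1), of w f "int n"] by simp
    then show "ord f \<ge> 0" by simp
  next
    assume o: "ord f \<ge> 0"
    then have "u * t powi ord f \<in> \<O>"
      using u(1) parameter_in(1)[OF t(1)] by (auto simp: power_int_def unit_def)
    then show "f \<in> \<O>" using u(2) by simp
  qed
qed

lemma unit_iff_ord: "f \<noteq> 0 \<Longrightarrow> unit f \<longleftrightarrow> ord f = 0"
  using unit_iff[of f] in_iff_ord[of f] in_iff_ord[of "inverse f"] ord_inverse[of f] by auto

lemma v_eq_0_iff_ord: "f \<noteq> 0 \<Longrightarrow> f \<in> \<O> \<Longrightarrow> v f = 0 \<longleftrightarrow> ord f > 0"
  using unit_iff_ord[of f] in_iff_ord[of f] by (auto simp: unit_def)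

text \<open>Two inequalities: g itself lies in the stalk, and it divides t^(-D(P)), which lies there
  too.\<close>

lemma local_generator_ord:
  assumes "local_generator C D P g"
  shows "g \<noteq> 0" "ord g = - D P"
proof -
  obtain t where t: "parameter t" "t \<noteq> 0" using parameter_exists by blast
  have s: "sheaf_stalk C D P = {g * h |h. h \<in> \<O>}" using assms by (simp add: local_generator_def)
  have "t powi (- D P) \<in> sheaf_stalk C D P"
    by (simp add: sheaf_stalk_def ord_parameter_powi t)
  then obtain h where h: "h \<in> \<O>" "t powi (- D P) = g * h" unfolding s by blast
  then have nz: "g \<noteq> 0" "h \<noteq> 0" using t by (auto simp: power_int_eq_0_iff)
  show "g \<noteq> 0" by fact
  have "- D P = ord g + ord h" using h(2) ord_parameter_powi[OF t(1)] ord_mult[OF nz] by metis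
  then have "ord g \<le> - D P" using in_iff_ord[OF nz(2)] h(1) by simp
  moreover have "g \<in> sheaf_stalk C D P" unfolding s by (auto intro!: exI[of _ 1])
  then have "ord g \<ge> - D P" using nz by (simp add: sheaf_stalk_def)
  ultimately show "ord g = - D P" by simp
qed

lemma local_generatorI:
  assumes "g \<noteq> 0" "ord g = - D P"
  shows "local_generator C D P g"
  unfolding local_generator_def
proof (intro equalityI subsetI)
  fix f assume f: "f \<in> sheaf_stalk C D P"
  have "f / g \<in> \<O>"
    using f assms by (cases "f = 0") (auto simp: sheaf_stalk_def in_iff_ord ord_divide)
  moreover have "f = g * (f / g)" using assms by simp
  ultimately show "f \<in> {g * h |h. h \<in> \<O>}" by blast
next
  fix f assume "f \<in> {g * h |h. h \<in> \<O>}"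
  then obtain h where "f = g * h" "h \<in> \<O>" by blast
  then show "f \<in> sheaf_stalk C D P"
    using assms by (cases "h = 0") (auto simp: sheaf_stalk_def in_iff_ord ord_mult)
qed

lemma frame_exists: "\<exists>\<tau> g. local_frame C D P \<tau> g"
proof -
  obtain t where t: "parameter t" "t \<noteq> 0" using parameter_exists by blast
  have "local_generator C D P (t powi (- D P))"
    by (rule local_generatorI) (use t in \<open>auto simp: ord_parameter_powi power_int_eq_0_iff\<close>)
  then show ?thesis using t point by (auto simp: local_frame_def)
qed

lemma section_over_generator:
  assumes "f \<in> sections C D" "local_generator C D P g"
  shows "f / g \<in> \<O>"
proof (cases "f = 0")
  case False
  then have "D P + ord f \<ge> 0"
    using assms(1) point by (auto simp: sections_def add_div_def)
  then show ?thesis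
    using local_generator_ord[OF assms(2)] False by (simp add: in_iff_ord ord_divide)
qed simp

end

section \<open>Laurent expansions\<close>

context curve_point
begin

context
  fixes t assumes t: "parameter t"
begin

text \<open>One step of Taylor expansion: remove the value and divide by t. Iterating and taking
  values yields the coefficients. The twisted product rule \<open>shift_part_mult\<close> makes the
  expansion multiplicative, by induction on the index of the coefficient.\<close>

definition shift_part :: "'b \<Rightarrow> 'b" where
  "shift_part f = (f - const (v f)) / t"

definition expansion :: "'b \<Rightarrow> 'a fps" where
  "expansion f = Abs_fps (\<lambda>n. v ((shift_part ^^ n) f))"

lemma t_nonzero: "t \<noteq> 0" and t_in: "t \<in> \<O>" and v_t: "v t = 0"
  using parameter_nonzero parameter_in t by auto

lemma shift_part_in: "f \<in> \<O> \<Longrightarrow> shift_part f \<in> \<O>"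
  unfolding shift_part_def by (rule parameter_divides[OF t]) auto

lemma shift_part_add: "f \<in> \<O> \<Longrightarrow> g \<in> \<O> \<Longrightarrow> shift_part (f + g) = shift_part f + shift_part g"
  using t_nonzero by (simp add: shift_part_def const.hom_add field_simps)

lemma shift_part_mult:
  "f \<in> \<O> \<Longrightarrow> g \<in> \<O> \<Longrightarrow> shift_part (f * g) = shift_part f * g + const (v f) * shift_part g"
  using t_nonzero by (simp add: shift_part_def const.hom_mult field_simps)

lemma shift_part_const: "shift_part (const c) = 0"
  by (simp add: shift_part_def)

lemma expansion_nth_0: "expansion f $ 0 = v f"
  by (simp add: expansion_def)

lemma expansion_nth_Suc: "expansion f $ Suc n = expansion (shift_part f) $ n"
  by (simp add: expansion_def funpow_swap1)

lemma expansion_add: assumes "f \<in> \<O>" "g \<in> \<O>" shows "expansion (f + g) = expansion f + expansion g"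
proof (rule fps_ext)
  fix n show "expansion (f + g) $ n = (expansion f + expansion g) $ n"
    using assms by (induction n arbitrary: f g)
      (simp_all add: expansion_nth_0 expansion_nth_Suc shift_part_add shift_part_in)
qed

lemma expansion_zero: "expansion 0 = 0"
  using expansion_add[of 0 0] by simp

lemma expansion_const: "expansion (const c) = fps_const c"
proof (rule fps_ext)
  fix n show "expansion (const c) $ n = fps_const c $ n"
    by (cases n) (simp_all add: expansion_nth_0 expansion_nth_Suc shift_part_const expansion_zero)
qed

lemma expansion_const_mult: assumes "f \<in> \<O>" shows "expansion (const c * f) = fps_const c * expansion f"
proof (rule fps_ext)
  fix n show "expansion (const c * f) $ n = (fps_const c * expansion f) $ n"
    using assms by (induction n arbitrary: f)
      (simp_all add: expansion_nth_0 expansion_nth_Suc shift_part_mult shift_part_const shift_part_in)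
qed

lemma expansion_decomp: "expansion f = fps_const (v f) + fps_X * expansion (shift_part f)"
proof (rule fps_ext)
  fix n show "expansion f $ n = (fps_const (v f) + fps_X * expansion (shift_part f)) $ n"
    by (cases n) (simp_all add: expansion_nth_0 expansion_nth_Suc)
qed

lemma expansion_mult: assumes "f \<in> \<O>" "g \<in> \<O>" shows "expansion (f * g) = expansion f * expansion g"
proof (rule fps_ext)
  fix n show "expansion (f * g) $ n = (expansion f * expansion g) $ n"
    using assms
  proof (induction n arbitrary: f g)
    case 0
    then show ?case by (simp add: expansion_nth_0)
  next
    case (Suc n)
    have "expansion (f * g) $ Suc n = expansion (shift_part f * g + const (v f) * shift_part g) $ n"
      using Suc by (simp add: expansion_nth_Suc shift_part_mult)
    also have "\<dots> = (expansion (shift_part f) * expansion g) $ n + v f * expansion (shift_part g) $ n"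
      using Suc by (simp add: expansion_add expansion_const_mult shift_part_in)
    also have "\<dots> = (fps_const (v f) * expansion g + fps_X * (expansion (shift_part f) * expansion g)) $ Suc n"
      by (simp add: expansion_nth_Suc)
    also have "fps_const (v f) * expansion g + fps_X * (expansion (shift_part f) * expansion g) =
        expansion f * expansion g"
      by (subst (3) expansion_decomp) (simp add: algebra_simps)
    finally show ?case .
  qed
qed

lemma expansion_t: "expansion t = fps_X"
proof -
  have "shift_part t = const 1" using v_t t_nonzero by (simp add: shift_part_def)
  then show ?thesis
    using expansion_decomp[of t] v_t expansion_const[of 1] by simp
qed

lemma expansion_t_power: "f \<in> \<O> \<Longrightarrow> expansion (t ^ n * f) = fps_X ^ n * expansion f"
  by (induction n) (simp_all add: expansion_mult expansion_t t_in mult.assoc)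

text \<open>Any power of t that clears the pole may be used; \<open>laurent_eq\<close> shows that
  the result does not depend on the one chosen.\<close>

definition laurent :: "'b \<Rightarrow> 'a fls" where
  "laurent f = (let n = (SOME n. t ^ n * f \<in> \<O>) in fps_to_fls (expansion (t ^ n * f)) / fls_X ^ n)"

lemma power_mult_in: "\<exists>n. t ^ n * f \<in> \<O>"
proof (cases "f = 0")
  case False
  obtain u where u: "unit u" "f = u * t powi ord f" using ord_decomposition[OF t False] .
  define n where "n = nat (- ord f)"
  have "t ^ n * f = u * t powi (int n + ord f)"
    by (subst u(2)) (simp add: power_int_add t_nonzero)
  also have "int n + ord f = int (nat (int n + ord f))" by (simp add: n_def)
  also have "u * t powi \<dots> = u * t ^ nat (int n + ord f)" by (simp only: power_int_of_nat)
  finally show ?thesis using u(1) t_in by (metis mult_in power_in unit_in)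
qed simp

lemma fps_to_fls_X_power: "fps_to_fls (fps_X ^ n :: 'a fps) = fls_X ^ n"
  by (simp add: fps_to_fls_power)

lemma fls_X_power_nonzero: "(fls_X :: 'a fls) ^ n \<noteq> 0"
  by simp

lemma laurent_eq:
  assumes "t ^ n * f \<in> \<O>"
  shows "laurent f = fps_to_fls (expansion (t ^ n * f)) / fls_X ^ n"
proof -
  define m where "m = (SOME n. t ^ n * f \<in> \<O>)"
  have m: "t ^ m * f \<in> \<O>" unfolding m_def using power_mult_in by (rule someI_ex)
  have "fps_X ^ n * expansion (t ^ m * f) = expansion (t ^ n * (t ^ m * f))"
    using m by (simp add: expansion_t_power)
  also have "\<dots> = expansion (t ^ m * (t ^ n * f))" by (simp add: mult_ac)
  also have "\<dots> = fps_X ^ m * expansion (t ^ n * f)"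
    using assms by (simp add: expansion_t_power)
  finally have "fls_X ^ n * fps_to_fls (expansion (t ^ m * f)) = fls_X ^ m * fps_to_fls (expansion (t ^ n * f))"
    by (metis fls_times_fps_to_fls fps_to_fls_X_power)
  then show ?thesis
    unfolding laurent_def Let_def m_def[symmetric]
    using frac_eq_eq[OF fls_X_power_nonzero fls_X_power_nonzero] by (metis mult.commute)
qed

lemma laurent_in: "f \<in> \<O> \<Longrightarrow> laurent f = fps_to_fls (expansion f)"
  using laurent_eq[of 0 f] by simp

lemma common_power: "\<exists>n. t ^ n * f \<in> \<O> \<and> t ^ n * g \<in> \<O>"
proof -
  obtain n m where nm: "t ^ n * f \<in> \<O>" "t ^ m * g \<in> \<O>" using power_mult_in by blast
  have "t ^ (n + m) * f = t ^ m * (t ^ n * f)" "t ^ (n + m) * g = t ^ n * (t ^ m * g)"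
    by (simp_all add: power_add mult_ac)
  then show ?thesis using nm t_in by (metis mult_in power_in)
qed

lemma laurent_add: "laurent (f + g) = laurent f + laurent g"
proof -
  obtain n where n: "t ^ n * f \<in> \<O>" "t ^ n * g \<in> \<O>" using common_power by blast
  then have n': "t ^ n * (f + g) \<in> \<O>" by (simp add: distrib_left)
  show ?thesis
    unfolding laurent_eq[OF n'] laurent_eq[OF n(1)] laurent_eq[OF n(2)] distrib_left expansion_add[OF n]
    by (simp add: add_divide_distrib)
qed

lemma laurent_mult: "laurent (f * g) = laurent f * laurent g"
proof -
  obtain n where n: "t ^ n * f \<in> \<O>" "t ^ n * g \<in> \<O>" using common_power by blast
  have e: "t ^ (n + n) * (f * g) = (t ^ n * f) * (t ^ n * g)"
    by (simp add: power_add mult_ac)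
  then have n': "t ^ (n + n) * (f * g) \<in> \<O>" using n by (metis mult_in)
  show ?thesis
    unfolding laurent_eq[OF n'] laurent_eq[OF n(1)] laurent_eq[OF n(2)] e expansion_mult[OF n]
    by (simp only: fls_times_fps_to_fls power_add times_divide_times_eq)
qed

lemma laurent_const: "laurent (const c) = fls_const c"
  by (simp add: laurent_in expansion_const)

lemma laurent_t: "laurent t = fls_X"
  by (simp add: laurent_in t_in expansion_t)

lemma laurent_zero: "laurent 0 = 0"
  by (simp add: laurent_in expansion_zero)

lemma laurent_one: "laurent 1 = 1"
  using laurent_const[of 1] by simp

lemma laurent_eq_0: "laurent f = 0 \<Longrightarrow> f = 0"
  using laurent_mult[of f "inverse f"] laurent_one by (cases "f = 0") auto

text \<open>A pole of order n > 0 would turn t^n f into a unit whose expansion is divisible by X^n,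
  hence of value 0. Regularity can thus be tested on expansions.\<close>

lemma in_of_laurent:
  assumes "laurent f = fps_to_fls F"
  shows "f \<in> \<O>"
proof (cases "f = 0")
  case False
  obtain u where u: "unit u" "f = u * t powi ord f" using ord_decomposition[OF t False] .
  show ?thesis
  proof (rule ccontr)
    assume "f \<notin> \<O>"
    then have o: "ord f < 0" using in_iff_ord[OF False] by simp
    define n where "n = nat (- ord f)"
    have n: "n > 0" "ord f = - int n" using o by (auto simp: n_def)
    have "t ^ n * f = u" by (subst u(2)) (simp add: n(2) t_nonzero power_int_minus)
    then have "laurent f = fps_to_fls (expansion u) / fls_X ^ n"
      using laurent_eq[of n f] u(1) by (simp add: unit_def)
    then have "fps_to_fls (expansion u) = fps_to_fls (fps_X ^ n * F)"
      using assms nonzero_divide_eq_eq[OF fls_X_power_nonzero]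
      by (metis fls_times_fps_to_fls fps_to_fls_X_power mult.commute)
    then have "expansion u = fps_X ^ n * F" by simp
    then have "expansion u $ 0 = (fps_X ^ n * F) $ 0" by simp
    then show False using n(1) u(1) by (simp add: expansion_nth_0 unit_def)
  qed
qed simp

end

end

section \<open>Differentials\<close>

context curve
begin

abbreviation "B \<equiv> single"
abbreviation "\<R> \<equiv> kaehler_relations C"

lemma lookup_kaehler_scale: "lookup (kaehler_scale b x) k = b * lookup x k"
  unfolding kaehler_scale_def by (simp add: Poly_Mapping.map.rep_eq when_def)

lemma kaehler_scale_single: "kaehler_scale b (B g a) = B g (b * a)"
  by (simp add: kaehler_scale_def)

lemma kaehler_module: "Modules.module kaehler_scale"
  by unfold_locales
    (auto intro!: poly_mapping_eqI simp: lookup_kaehler_scale lookup_add algebra_simps)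

lemma kaehler_scale_diff: "kaehler_scale b (x - y) = kaehler_scale b x - kaehler_scale b y"
  by (rule module.scale_right_diff_distrib[OF kaehler_module])

lemma relations_add: "x \<in> \<R> \<Longrightarrow> y \<in> \<R> \<Longrightarrow> x + y \<in> \<R>"
  unfolding kaehler_relations_def by (rule module.span_add[OF kaehler_module])

lemma relations_diff: "x \<in> \<R> \<Longrightarrow> y \<in> \<R> \<Longrightarrow> x - y \<in> \<R>"
  unfolding kaehler_relations_def by (rule module.span_diff[OF kaehler_module])

lemma relations_scale: "x \<in> \<R> \<Longrightarrow> kaehler_scale b x \<in> \<R>"
  unfolding kaehler_relations_def by (rule module.span_scale[OF kaehler_module])

lemma relation_add: "B (a + b) 1 - B a 1 - B b 1 \<in> \<R>"
  and relation_mult: "B (a * b) 1 - B b a - B a b \<in> \<R>"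
  and relation_const: "B (const c) 1 \<in> \<R>"
  unfolding kaehler_relations_def by (rule module.span_base[OF kaehler_module]; blast)+

lemma relations_cong: "x \<in> \<R> \<Longrightarrow> x = y \<Longrightarrow> y \<in> \<R>"
  by simp

text \<open>The equation dg = h dt as a relation. It allows calculus before
  \<open>deriv_wrt\<close>, a definite description, is known to be well defined.\<close>

definition has_deriv :: "'k \<Rightarrow> 'k \<Rightarrow> 'k \<Rightarrow> bool" where
  "has_deriv t g h \<longleftrightarrow> B g 1 - B t h \<in> \<R>"

lemma has_deriv_const: "has_deriv t (const c) 0"
  by (simp add: has_deriv_def relation_const)

lemma has_deriv_self: "has_deriv t t 1"
  unfolding has_deriv_def kaehler_relations_def using module.span_zero[OF kaehler_module] by simp

lemma has_deriv_add:
  assumes "has_deriv t f a" "has_deriv t g b"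
  shows "has_deriv t (f + g) (a + b)"
  unfolding has_deriv_def
  by (rule relations_cong[OF relations_add[OF relation_add[of f g]
    relations_add[OF assms[unfolded has_deriv_def]]]]) (simp add: single_add)

lemma has_deriv_mult:
  assumes "has_deriv t f a" "has_deriv t g b"
  shows "has_deriv t (f * g) (f * b + g * a)"
proof -
  have "kaehler_scale f (B g 1 - B t b) = B g f - B t (f * b)"
    "kaehler_scale g (B f 1 - B t a) = B f g - B t (g * a)"
    by (simp_all add: kaehler_scale_diff kaehler_scale_single)
  then have "B g f - B t (f * b) \<in> \<R>" "B f g - B t (g * a) \<in> \<R>"
    using relations_scale[OF assms(1)[unfolded has_deriv_def], of g]
      relations_scale[OF assms(2)[unfolded has_deriv_def], of f] by simp_all
  from relations_add[OF relation_mult[of f g] relations_add[OF this]]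
  show ?thesis
    unfolding has_deriv_def by (rule relations_cong) (simp add: single_add)
qed

lemma has_deriv_chain:
  assumes "has_deriv s t a" "has_deriv t g b"
  shows "has_deriv s g (b * a)"
proof -
  have "kaehler_scale b (B t 1 - B s a) = B t b - B s (b * a)"
    by (simp_all add: kaehler_scale_diff kaehler_scale_single)
  then have "B t b - B s (b * a) \<in> \<R>"
    using relations_scale[OF assms(1)[unfolded has_deriv_def], of b] by simp
  from relations_add[OF assms(2)[unfolded has_deriv_def] this]
  show ?thesis unfolding has_deriv_def by simp
qed

lemma has_deriv_const_poly: "\<exists>h. has_deriv t (const_poly A t) h"
proof (induction A)
  case 0
  then show ?case using has_deriv_const[of t 0] by auto
next
  case (pCons a A)
  then obtain h where "has_deriv t (const_poly A t) h" by blast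
  then show ?case
    using has_deriv_add[OF has_deriv_const has_deriv_mult[OF has_deriv_self], of t "const_poly A t" h a] pCons
    by (auto simp: map_poly_pCons)
qed

text \<open>The total differential of q(g): one part comes from g and equals q'(g) dg, the other
  from the coefficients, whose differentials are multiples of dt.\<close>

lemma diff_of_poly:
  assumes "\<And>i. \<exists>h. has_deriv t (coeff q i) h"
  shows "\<exists>h. B (poly q g) 1 - B g (poly (pderiv q) g) - B t h \<in> \<R>"
  using assms
proof (induction q)
  case 0
  have "B (0::'k) 1 \<in> \<R>" using relation_const[of 0] by simp
  then show ?case by (intro exI[of _ 0]) simp
next
  case (pCons a q)
  have "\<And>i. \<exists>h. has_deriv t (coeff q i) h"
    using pCons.prems by (metis coeff_pCons_Suc)
  then obtain h where h: "B (poly q g) 1 - B g (poly (pderiv q) g) - B t h \<in> \<R>"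
    using pCons.IH by blast
  obtain h' where h': "has_deriv t a h'"
    using pCons.prems[of 0] by auto
  let ?w = "poly q g" and ?w' = "poly (pderiv q) g"
  have "kaehler_scale g (B ?w 1 - B g ?w' - B t h) = B ?w g - B g (g * ?w') - B t (g * h)"
    by (simp_all add: kaehler_scale_diff kaehler_scale_single)
  then have 1: "B ?w g - B g (g * ?w') - B t (g * h) \<in> \<R>"
    using relations_scale[OF h, of g] by simp
  have 2: "B a 1 - B t h' \<in> \<R>"
    using h' by (simp add: has_deriv_def)
  have "B (a + g * ?w) 1 - B g (?w + g * ?w') - B t (h' + g * h) \<in> \<R>"
    by (rule relations_cong[OF relations_add[OF relations_add[OF relation_add[of a "g * ?w"]
      relation_mult[of g ?w]] relations_add[OF 1 2]]]) (simp add: single_add algebra_simps)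
  then show ?case
    by (intro exI[of _ "h' + g * h"]) (simp add: pderiv_pCons)
qed

text \<open>Differentiate the minimal relation of g. Its formal derivative is nonzero in
  characteristic zero and does not vanish at g by minimality, so the total differential can be
  solved for dg.\<close>

lemma has_deriv_exists:
  assumes t: "t \<notin> range (const)"
  shows "\<exists>h. has_deriv t g h"
proof -
  obtain q where q: "q \<noteq> 0" "over t q" "poly q g = 0"
    "\<And>p. p \<noteq> 0 \<Longrightarrow> over t p \<Longrightarrow> degree p < degree q \<Longrightarrow> poly p g \<noteq> 0"
    using minimal_relation[OF t] by blast
  have deg: "degree q > 0"
  proof (rule ccontr)
    assume "\<not> degree q > 0"
    then obtain a where "q = [:a:]" by (metis degree_eq_zeroE gr_zeroI)
    then show False using q(1,3) by simp
  qed
  then obtain n where n: "degree q = Suc n" using gr0_implies_Suc by blast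
  \<comment> \<open>The type \<open>'k\<close> is only a field; its characteristic is inherited from
    the ground field through the constants.\<close>
  have of_nat: "(of_nat k :: 'k) = const (of_nat k)" for k
    by (simp add: const.hom_of_nat)
  have "coeff (pderiv q) n \<noteq> 0"
  proof -
    have "coeff q (Suc n) \<noteq> 0" using n q(1) leading_coeff_neq_0 by metis
    moreover have "(of_nat (Suc n) :: 'k) \<noteq> 0" unfolding of_nat by (simp del: of_nat_Suc)
    ultimately show ?thesis by (simp only: coeff_pderiv) simp
  qed
  then have p0: "pderiv q \<noteq> 0" by auto
  have "over t (pderiv q)"
    unfolding over_def
  proof
    fix i
    obtain A where "coeff q (Suc i) = const_poly A t" using q(2) by (auto simp: over_def)
    then have "coeff (pderiv q) i = const_poly (monom (of_nat (Suc i)) 0 * A) t"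
      unfolding const_poly_simps coeff_pderiv of_nat by simp
    then show "\<exists>A. coeff (pderiv q) i = const_poly A t" by blast
  qed
  moreover have "degree (pderiv q) < degree q"
  proof -
    have "degree (pderiv q) \<le> n"
      by (rule degree_le) (use n in \<open>auto simp: coeff_pderiv coeff_eq_0\<close>)
    then show ?thesis using n by simp
  qed
  ultimately have nz: "poly (pderiv q) g \<noteq> 0" using q(4) p0 by blast
  have "\<exists>h. has_deriv t (coeff q i) h" for i
    using q(2) has_deriv_const_poly unfolding over_def by metis
  then obtain h where h: "B (poly q g) 1 - B g (poly (pderiv q) g) - B t h \<in> \<R>"
    using diff_of_poly[of t q g] by blast
  have "B (0::'k) 1 \<in> \<R>" using relation_const[of 0] by simp
  from relations_diff[OF this h] have "B g (poly (pderiv q) g) + B t h \<in> \<R>"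
    using q(3) by simp
  from relations_scale[OF this, of "inverse (poly (pderiv q) g)"]
  have "B g 1 - B t (- h / poly (pderiv q) g) \<in> \<R>"
    by (rule relations_cong)
      (use nz in \<open>auto intro!: poly_mapping_eqI simp: lookup_kaehler_scale lookup_minus lookup_add lookup_single when_def field_simps\<close>)
  then show ?thesis by (auto simp: has_deriv_def)
qed

end

context curve_point
begin

text \<open>The functional \<open>\<Sum> b dg \<mapsto> \<Sum> b g'\<close>, read in Laurent series in \<open>t\<close>, shows that \<open>dt \<noteq> 0\<close>.\<close>

definition diff_functional :: "'b \<Rightarrow> ('b \<Rightarrow>\<^sub>0 'b) \<Rightarrow> 'a fls" where
  "diff_functional t x = (\<Sum>g\<in>keys x. laurent t (lookup x g) * fls_deriv (laurent t g))"

context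
  fixes t assumes t: "parameter t"
begin

lemma diff_functional_superset:
  assumes "finite S" "keys x \<subseteq> S"
  shows "diff_functional t x = (\<Sum>g\<in>S. laurent t (lookup x g) * fls_deriv (laurent t g))"
  unfolding diff_functional_def
  by (rule sum.mono_neutral_left) (use assms laurent_zero[OF t] in \<open>auto simp: in_keys_iff\<close>)

lemma diff_functional_add: "diff_functional t (x + y) = diff_functional t x + diff_functional t y"
proof -
  let ?S = "keys x \<union> keys y"
  have "diff_functional t (x + y) = (\<Sum>g\<in>?S. laurent t (lookup (x + y) g) * fls_deriv (laurent t g))"
    by (rule diff_functional_superset) (simp_all add: keys_add)
  also have "\<dots> = diff_functional t x + diff_functional t y"
    by (simp add: diff_functional_superset[of ?S] lookup_add laurent_add[OF t] distrib_right sum.distrib)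
  finally show ?thesis .
qed

lemma diff_functional_scale: "diff_functional t (kaehler_scale b x) = laurent t b * diff_functional t x"
proof -
  have "diff_functional t (kaehler_scale b x) =
      (\<Sum>g\<in>keys x. laurent t (lookup (kaehler_scale b x) g) * fls_deriv (laurent t g))"
    by (rule diff_functional_superset) (auto simp: in_keys_iff lookup_kaehler_scale)
  then show ?thesis
    by (simp add: lookup_kaehler_scale laurent_mult[OF t] diff_functional_def sum_distrib_left mult.assoc)
qed

lemma diff_functional_zero: "diff_functional t 0 = 0"
  by (simp add: diff_functional_def)

lemma diff_functional_single: "diff_functional t (B g b) = laurent t b * fls_deriv (laurent t g)"
  by (cases "b = 0") (simp_all add: diff_functional_def laurent_zero[OF t])

lemma diff_functional_diff: "diff_functional t (x - y) = diff_functional t x - diff_functional t y"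
  using diff_functional_add[of "x - y" y] by simp

text \<open>The generators of the relations are killed because differentiation of Laurent series
  obeys the sum and product rules and annihilates constants.\<close>

lemma diff_functional_relations:
  assumes "x \<in> \<R>" shows "diff_functional t x = 0"
proof -
  note lau = laurent_add[OF t] laurent_mult[OF t] laurent_one[OF t] laurent_const[OF t]
  have "module.subspace kaehler_scale {x. diff_functional t x = 0}"
    unfolding module.subspace_def[OF kaehler_module]
    by (simp add: diff_functional_add diff_functional_scale diff_functional_zero)
  then have "\<R> \<subseteq> {x. diff_functional t x = 0}"
    unfolding kaehler_relations_def
    by (intro module.span_minimal[OF kaehler_module])
      (auto simp: diff_functional_diff diff_functional_single lau)
  then show ?thesis using assms by auto
qed

lemma has_deriv_laurent:
  assumes "has_deriv t g h" shows "laurent t h = fls_deriv (laurent t g)"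
  using diff_functional_relations[OF assms[unfolded has_deriv_def]]
  by (simp add: diff_functional_diff diff_functional_single laurent_one[OF t] laurent_t[OF t])

lemma single_parameter_relation:
  assumes "B t x \<in> \<R>" shows "x = 0"
  using diff_functional_relations[OF assms]
  by (intro laurent_eq_0[OF t]) (simp add: diff_functional_single laurent_t[OF t])

text \<open>The expansion of h is the derivative of a power series, hence again a power series, and
  \<open>in_of_laurent\<close> applies.\<close>

lemma has_deriv_regular:
  assumes "has_deriv t g h" "g \<in> \<O>" shows "h \<in> \<O>"
  using has_deriv_laurent[OF assms(1)] laurent_in[OF t assms(2)]
  by (intro in_of_laurent[OF t]) (simp add: fls_deriv_fps_to_fls)

end

end

section \<open>Derivatives with respect to an arbitrary non-constant function\<close>

context curve
begin

text \<open>Reduction to a parameter s at some point: ds = a dt and dt = b ds force ab = 1, and x dt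
  = xb ds.\<close>

lemma single_relation:
  assumes t: "t \<notin> range (const)" and x: "B t x \<in> \<R>"
  shows "x = 0"
proof -
  obtain P where P: "P \<in> points C" using points_nonempty by blast
  interpret curve_point C P by unfold_locales (fact P)
  obtain s where s: "parameter s" using parameter_exists by blast
  note sc = parameter_transcendental[OF s]
  obtain a where a: "has_deriv t s a" using has_deriv_exists[OF t] by blast
  obtain b where b: "has_deriv s t b" using has_deriv_exists[OF sc] by blast
  have "B s 1 - B s (a * b) \<in> \<R>"
    using has_deriv_chain[OF b a] by (simp add: has_deriv_def)
  then have "B s (1 - a * b) \<in> \<R>" by (simp add: single_diff)
  then have ab: "a * b = 1" using single_parameter_relation[OF s] by fastforce
  have "kaehler_scale x (B t 1 - B s b) = B t x - B s (x * b)"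
    by (simp_all add: kaehler_scale_diff kaehler_scale_single)
  then have "B t x - B s (x * b) \<in> \<R>"
    using relations_scale[OF b[unfolded has_deriv_def], of x] by simp
  from relations_diff[OF x this] have "B s (x * b) \<in> \<R>" by simp
  then have "x * b = 0" using single_parameter_relation[OF s] by blast
  with ab show "x = 0" by auto
qed

context
  fixes t assumes t: "t \<notin> range (const)"
begin

lemma has_deriv_unique:
  assumes "has_deriv t g a" "has_deriv t g b" shows "a = b"
proof -
  have "B t (b - a) \<in> \<R>"
    using relations_diff[OF assms(1)[unfolded has_deriv_def] assms(2)[unfolded has_deriv_def]]
    by (simp add: single_diff)
  then show ?thesis using single_relation[OF t] by fastforce
qed

lemma deriv_iff: "deriv_wrt C t g = h \<longleftrightarrow> has_deriv t g h"
proof -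
  obtain h' where h': "has_deriv t g h'" using has_deriv_exists[OF t] by blast
  have "deriv_wrt C t g = h'"
    unfolding deriv_wrt_def has_deriv_def[symmetric]
    by (rule the_equality) (use h' has_deriv_unique in blast)+
  then show ?thesis using h' has_deriv_unique by blast
qed

lemma has_deriv_deriv: "has_deriv t g (deriv_wrt C t g)"
  using deriv_iff by blast

lemma deriv_const [simp]: "deriv_wrt C t (const c) = 0"
  unfolding deriv_iff by (rule has_deriv_const)

lemma deriv_self [simp]: "deriv_wrt C t t = 1"
  unfolding deriv_iff by (rule has_deriv_self)

lemma deriv_add: "deriv_wrt C t (f + g) = deriv_wrt C t f + deriv_wrt C t g"
  unfolding deriv_iff by (rule has_deriv_add; rule has_deriv_deriv)

lemma deriv_mult: "deriv_wrt C t (f * g) = f * deriv_wrt C t g + g * deriv_wrt C t f"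
  unfolding deriv_iff by (rule has_deriv_mult; rule has_deriv_deriv)

lemma deriv_zero [simp]: "deriv_wrt C t 0 = 0"
  using deriv_const[of 0] by simp

lemma deriv_scale: "deriv_wrt C t (const c * f) = const c * deriv_wrt C t f"
  by (simp add: deriv_mult)

lemma deriv_sum: "deriv_wrt C t (\<Sum>i\<in>S. f i) = (\<Sum>i\<in>S. deriv_wrt C t (f i))"
  by (induction S rule: infinite_finite_induct) (auto simp: deriv_add)

end

lemma deriv_chain:
  assumes "t \<notin> range (const)" "s \<notin> range (const)"
  shows "deriv_wrt C s g = deriv_wrt C t g * deriv_wrt C s t"
  unfolding deriv_iff[OF assms(2)]
  by (rule has_deriv_chain; rule has_deriv_deriv) (fact assms)+

lemma deriv_inverse_pair:
  assumes "t \<notin> range (const)" "s \<notin> range (const)"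
  shows "deriv_wrt C t s * deriv_wrt C s t = 1"
  using deriv_chain[OF assms(1,2), of s] deriv_self[OF assms(2)] by simp

end

context curve_point
begin

lemma deriv_regular:
  assumes "parameter t" "f \<in> \<O>"
  shows "deriv_wrt C t f \<in> \<O>"
  using has_deriv_regular[OF assms(1) has_deriv_deriv[OF parameter_transcendental[OF assms(1)]] assms(2)] .

end

section \<open>Wronskians\<close>

context curve
begin

text \<open>Changing the parameter and multiplying all functions by \<open>u\<close> acts on the jets of a function
  by a triangular matrix.\<close>

lemma iterated_deriv_change:
  assumes t: "t \<notin> range (const)" and s: "s \<notin> range (const)"
  shows "\<exists>c. (\<forall>f. (deriv_wrt C t ^^ k) (u * f) = (\<Sum>i\<le>k. c i * (deriv_wrt C s ^^ i) f)) \<and>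
    c k = u * deriv_wrt C t s ^ k"
proof (induction k)
  case 0
  show ?case by (intro exI[of _ "\<lambda>_. u"]) simp
next
  case (Suc k)
  let ?w = "deriv_wrt C t s"
  obtain c where c: "\<And>f. (deriv_wrt C t ^^ k) (u * f) = (\<Sum>i\<le>k. c i * (deriv_wrt C s ^^ i) f)"
    "c k = u * ?w ^ k" using Suc by blast
  \<comment> \<open>Product and chain rule: the term with \<open>c i\<close> either has its
    coefficient differentiated or moves, with the factor ds/dt, to index i + 1.\<close>
  define c' where "c' i = (if i \<le> k then deriv_wrt C t (c i) else 0) + (if i > 0 then c (i - 1) * ?w else 0)" for i
  have "(deriv_wrt C t ^^ Suc k) (u * f) = (\<Sum>i\<le>Suc k. c' i * (deriv_wrt C s ^^ i) f)" for f
  proof -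
    let ?d = "\<lambda>i. (deriv_wrt C s ^^ i) f"
    have d: "deriv_wrt C t (?d i) = ?d (Suc i) * ?w" for i
      using deriv_chain[OF s t, of "?d i"] by simp
    have "(deriv_wrt C t ^^ Suc k) (u * f) = (\<Sum>i\<le>k. c i * deriv_wrt C t (?d i) + ?d i * deriv_wrt C t (c i))"
      by (simp add: c(1) deriv_sum[OF t] deriv_mult[OF t])
    also have "\<dots> = (\<Sum>i\<le>k. c i * ?w * ?d (Suc i)) + (\<Sum>i\<le>k. deriv_wrt C t (c i) * ?d i)"
      unfolding sum.distrib
      by (intro arg_cong2[of _ _ _ _ "(+)"] sum.cong refl) (simp_all only: d mult_ac)
    also have "(\<Sum>i\<le>k. deriv_wrt C t (c i) * ?d i) =
        (\<Sum>i\<le>Suc k. (if i \<le> k then deriv_wrt C t (c i) else 0) * ?d i)"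
      by simp
    also have "(\<Sum>i\<le>k. c i * ?w * ?d (Suc i)) = (\<Sum>i\<le>Suc k. (if i > 0 then c (i - 1) * ?w else 0) * ?d i)"
      by (simp only: sum.atMost_Suc_shift) simp
    finally show ?thesis
      by (simp only: c'_def distrib_right sum.distrib add.commute)
  qed
  moreover have "c' (Suc k) = u * ?w ^ Suc k"
    by (simp add: c'_def c(2))
  ultimately show ?case by blast
qed

lemma sum_below: "(\<Sum>k<r. k) = r * (r - 1) div (2::nat)"
  using Sum_Ico_nat[of 0 r] by (simp add: lessThan_atLeast0)

text \<open>The new matrix of jets is the old one times an upper triangular matrix with diagonal
  entries u (ds/dt)^k, whose exponents add up to r (r - 1) / 2.\<close>

lemma wronskian_det_change:
  assumes t: "t \<notin> range (const)" and s: "s \<notin> range (const)"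
  shows "det (mat r r (\<lambda>(j, k). (deriv_wrt C t ^^ k) (u * G j))) =
    det (mat r r (\<lambda>(j, k). (deriv_wrt C s ^^ k) (G j))) * (u ^ r * deriv_wrt C t s ^ (r * (r - 1) div 2))"
proof -
  let ?w = "deriv_wrt C t s"
  obtain c where c: "\<And>k f. (deriv_wrt C t ^^ k) (u * f) = (\<Sum>i\<le>k. c k i * (deriv_wrt C s ^^ i) f)"
    "\<And>k. c k k = u * ?w ^ k"
    using iterated_deriv_change[OF t s, of _ u] by metis
  let ?A = "mat r r (\<lambda>(j, k). (deriv_wrt C s ^^ k) (G j))"
  let ?T = "mat r r (\<lambda>(i, k). if i \<le> k then c k i else 0)"
  have "mat r r (\<lambda>(j, k). (deriv_wrt C t ^^ k) (u * G j)) = ?A * ?T"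
  proof (rule eq_matI)
    fix j k assume jk: "j < dim_row (?A * ?T)" "k < dim_col (?A * ?T)"
    have "(\<Sum>i\<le>k. c k i * (deriv_wrt C s ^^ i) (G j)) =
        (\<Sum>i<r. (deriv_wrt C s ^^ i) (G j) * (if i \<le> k then c k i else 0))"
      by (rule sum.mono_neutral_cong_left) (use jk in auto)
    then show "mat r r (\<lambda>(j, k). (deriv_wrt C t ^^ k) (u * G j)) $$ (j, k) = (?A * ?T) $$ (j, k)"
      using jk by (simp add: c(1) scalar_prod_def lessThan_atLeast0)
  qed auto
  then have "det (mat r r (\<lambda>(j, k). (deriv_wrt C t ^^ k) (u * G j))) = det ?A * det ?T"
    by (simp add: det_mult[of _ r])
  also have "det ?T = (\<Prod>k<r. c k k)"
    by (subst det_upper_triangular[of _ r])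
      (auto simp: prod_list_diag_prod lessThan_atLeast0)
  also have "\<dots> = u ^ r * ?w ^ (r * (r - 1) div 2)"
    by (simp add: c(2) prod.distrib sum_below flip: power_sum)
  finally show ?thesis .
qed

lemma local_frame_nonconst: "local_frame C D P \<tau> g \<Longrightarrow> \<tau> \<notin> range (const)"
  and local_frame_nonzero: "local_frame C D P \<tau> g \<Longrightarrow> g \<noteq> 0"
proof -
  assume fr: "local_frame C D P \<tau> g"
  interpret curve_point C P by unfold_locales (use fr in \<open>simp add: local_frame_def\<close>)
  show "\<tau> \<notin> range (const)" "g \<noteq> 0"
    using fr parameter_transcendental local_generator_ord(1) unfolding local_frame_def by blast+
qed

lemma wronskian_change_frame:
  assumes "local_frame C D P \<tau> g" "local_frame C D P' \<tau>' g'"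
  shows "wronskian C r G P \<tau> g * g ^ r =
    wronskian C r G P' \<tau>' g' * g' ^ r * deriv_wrt C \<tau> \<tau>' ^ (r * (r - 1) div 2)"
proof -
  note nc = local_frame_nonconst[OF assms(1)] local_frame_nonconst[OF assms(2)]
  note nz = local_frame_nonzero[OF assms(1)] local_frame_nonzero[OF assms(2)]
  \<comment> \<open>Replacing the generator g' by g multiplies all functions by u = g' / g.\<close>
  have G: "G j / g = (g' / g) * (G j / g')" for j
    using nz by simp
  show ?thesis
    unfolding wronskian_def G wronskian_det_change[OF nc] using nz by (simp add: power_divide)
qed

lemma signed_wronskians_change_frame:
  assumes "local_frame C D P \<tau> g" "local_frame C D P' \<tau>' g'"
  shows "signed_wronskians C r f i P \<tau> g * g ^ r =
    signed_wronskians C r f i P' \<tau>' g' * g' ^ r * deriv_wrt C \<tau> \<tau>' ^ (r * (r - 1) div 2)"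
  using wronskian_change_frame[OF assms, of r "omit i f"]
  by (simp add: signed_wronskians_def mult.assoc)

lemma signed_wronskians_relation:
  assumes "k < r"
  shows "(\<Sum>i\<le>r. signed_wronskians C r f i P \<tau> g * (deriv_wrt C \<tau> ^^ k) (f i / g)) = 0"
proof -
  \<comment> \<open>The columns below r are the jets, and column r repeats column k. Deleting column
    r and row i leaves the Wronskian matrix without \<open>f i\<close>; the cofactor sign splits
    into (-1)^i, the sign in \<open>signed_wronskians\<close>, and a common (-1)^r.\<close>
  define A where "A = mat (Suc r) (Suc r) (\<lambda>(i, l). (deriv_wrt C \<tau> ^^ (if l < r then l else k)) (f i / g))"
  have A: "A \<in> carrier_mat (Suc r) (Suc r)" by (simp add: A_def)
  have "det A = 0"
    by (rule det_identical_columns[OF A, of k r]) (use assms in \<open>auto simp: A_def\<close>)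
  moreover have "det A = (\<Sum>i<Suc r. A $$ (i, r) * cofactor A i r)"
    by (rule laplace_expansion_column[OF A]) simp
  moreover have "A $$ (i, r) * cofactor A i r =
      (-1) ^ r * (signed_wronskians C r f i P \<tau> g * (deriv_wrt C \<tau> ^^ k) (f i / g))" if "i < Suc r" for i
  proof -
    have "mat_delete A i r = mat r r (\<lambda>(j, k). (deriv_wrt C \<tau> ^^ k) (omit i f j / g))"
      by (rule eq_matI) (use that in \<open>auto simp: A_def mat_delete_def omit_def\<close>)
    then show ?thesis
      using that by (simp add: cofactor_def signed_wronskians_def wronskian_def A_def power_add mult_ac)
  qed
  ultimately have "(-1) ^ r * (\<Sum>i\<le>r. signed_wronskians C r f i P \<tau> g * (deriv_wrt C \<tau> ^^ k) (f i / g)) = 0"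
    by (simp add: sum_distrib_left lessThan_Suc_atMost)
  then show ?thesis by simp
qed

end

context curve_point
begin

lemma iterated_deriv_regular:
  "parameter t \<Longrightarrow> f \<in> \<O> \<Longrightarrow> (deriv_wrt C t ^^ k) f \<in> \<O>"
  by (induction k) (auto intro: deriv_regular)

lemma det_in:
  assumes "A \<in> carrier_mat n n" "\<And>i j. i < n \<Longrightarrow> j < n \<Longrightarrow> A $$ (i, j) \<in> \<O>"
  shows "det A \<in> \<O>"
proof -
  have "(of_int (sign p) :: 'b) \<in> \<O>" for p :: "nat \<Rightarrow> nat"
    by (simp add: sign_def)
  moreover have "(\<Prod>i = 0..<n. A $$ (i, p i)) \<in> \<O>" if "p permutes {0..<n}" for p
    by (rule prod_in) (use assms(2) permutes_in_image[OF that] in auto)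
  ultimately show ?thesis
    unfolding det_def'[OF assms(1)] by (intro sum_in mult_in) auto
qed

lemma wronskian_regular:
  assumes "parameter \<tau>" "\<And>j. j < r \<Longrightarrow> G j / g \<in> \<O>"
  shows "wronskian C r G P \<tau> g \<in> \<O>"
  unfolding wronskian_def
  by (rule det_in[of _ r]) (use assms in \<open>auto intro: iterated_deriv_regular\<close>)

lemma signed_wronskians_regular:
  assumes "parameter \<tau>" "\<And>j. j \<le> r \<Longrightarrow> f j / g \<in> \<O>"
  shows "signed_wronskians C r f i P \<tau> g \<in> \<O>"
  unfolding signed_wronskians_def
  by (intro mult_in power_in uminus_in one_in wronskian_regular) (use assms in \<open>auto simp: omit_def\<close>)

end

context curve
begin

lemma signed_wronskians_global:
  assumes "\<And>j. j \<le> r \<Longrightarrow> f j \<in> sections C D"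
  shows "global_section C D r (r * (r - 1) div 2) (signed_wronskians C r f i)"
  unfolding global_section_def
proof (intro conjI allI impI)
  fix P \<tau> g assume fr: "local_frame C D P \<tau> g"
  interpret curve_point C P by unfold_locales (use fr in \<open>simp add: local_frame_def\<close>)
  show "signed_wronskians C r f i P \<tau> g \<in> \<O>"
    by (rule signed_wronskians_regular)
      (use fr section_over_generator assms in \<open>auto simp: local_frame_def\<close>)
next
  fix P \<tau> g P' \<tau>' g' assume "local_frame C D P \<tau> g \<and> local_frame C D P' \<tau>' g'"
  then show "signed_wronskians C r f i P \<tau> g * g ^ r =
      signed_wronskians C r f i P' \<tau>' g' * g' ^ r * deriv_wrt C \<tau> \<tau>' ^ (r * (r - 1) div 2)"
    using signed_wronskians_change_frame by blast
qed

end

section \<open>Linear differential relations at a point\<close>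

context curve
begin

abbreviation lincomb :: "nat set \<Rightarrow> (nat \<Rightarrow> 'a) \<Rightarrow> (nat \<Rightarrow> 'k) \<Rightarrow> 'k" where
  "lincomb J b f \<equiv> (\<Sum>j\<in>J. const (b j) * f j)"

definition const_independent :: "nat set \<Rightarrow> (nat \<Rightarrow> 'k) \<Rightarrow> bool" where
  "const_independent J F \<longleftrightarrow>
     (\<forall>b. lincomb J b F = 0 \<longrightarrow> (\<forall>j\<in>J. b j = 0))"

end

context curve_point
begin

text \<open>The exponent \<mu> is the least order among the nonzero entries and may be
  negative.\<close>

lemma normalize:
  assumes t: "parameter t" and J: "finite J" "\<exists>j\<in>J. y j \<noteq> 0"
  obtains \<mu> where "\<And>j. j \<in> J \<Longrightarrow> t powi (- \<mu>) * y j \<in> \<O>" "\<exists>j\<in>J. v (t powi (- \<mu>) * y j) \<noteq> 0"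
proof -
  let ?A = "(\<lambda>j. ord (y j)) ` {j\<in>J. y j \<noteq> 0}"
  define \<mu> where "\<mu> = Min ?A"
  have A: "finite ?A" "?A \<noteq> {}" using J by auto
  have le: "\<mu> \<le> ord (y j)" if "j \<in> J" "y j \<noteq> 0" for j
    unfolding \<mu>_def using A that by auto
  note tnz = parameter_powi_nonzero[OF t]
  have ord: "ord (t powi (- \<mu>) * y j) = ord (y j) - \<mu>" if "y j \<noteq> 0" for j
    using that tnz by (simp add: ord_mult ord_parameter_powi[OF t])
  have nz: "t powi (- \<mu>) * y j \<noteq> 0" if "y j \<noteq> 0" for j
    using that tnz by simp
  have "t powi (- \<mu>) * y j \<in> \<O>" if "j \<in> J" for j
    using le[OF that] ord nz by (cases "y j = 0") (simp_all add: in_iff_ord)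
  moreover obtain i where i: "i \<in> J" "y i \<noteq> 0" "ord (y i) = \<mu>"
    using Min_in[OF A] unfolding \<mu>_def by auto
  then have "v (t powi (- \<mu>) * y i) \<noteq> 0"
    using unit_iff_ord[OF nz[OF i(2)]] ord[OF i(2)] by (simp add: unit_def)
  ultimately show thesis using that i(1) by blast
qed

context
  fixes t assumes t: "parameter t"
begin

abbreviation \<delta> where "\<delta> \<equiv> deriv_wrt C t"

lemmas tr = parameter_transcendental[OF t]

lemma deriv_t_power: "t * \<delta> (t ^ n) = of_nat n * t ^ n"
proof (induction n)
  case 0
  then show ?case using deriv_const[OF tr, of 1] by simp
next
  case (Suc n)
  have "t * \<delta> (t ^ Suc n) = t * (t * \<delta> (t ^ n) + t ^ n)"
    by (simp add: deriv_mult[OF tr] deriv_self[OF tr])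
  then show ?case unfolding Suc by (simp add: algebra_simps)
qed

lemma deriv_of_nat: "\<delta> (of_nat n) = 0"
  using deriv_const[OF tr, of "of_nat n"] by (simp add: const.hom_of_nat)

text \<open>Commuting t d/dt past k derivatives involves only derivatives of order k and k + 1, so a
  relation for the new functions follows from two consecutive old ones.\<close>

lemma iterated_deriv_euler:
  "(\<delta> ^^ k) (t * \<delta> f) = t * (\<delta> ^^ Suc k) f + of_nat k * (\<delta> ^^ k) f"
  by (induction k) (simp_all add: deriv_add[OF tr] deriv_mult[OF tr] deriv_self[OF tr] deriv_of_nat algebra_simps)

lemma iterated_deriv_linear:
  "(\<delta> ^^ k) (f + g) = (\<delta> ^^ k) f + (\<delta> ^^ k) g"
  "(\<delta> ^^ k) (const c * f) = const c * (\<delta> ^^ k) f"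
  by (induction k) (simp_all add: deriv_add[OF tr] deriv_scale[OF tr])

text \<open>Applying \<open>\<Prod>(t d/dt - b)\<close> multiplies leading coefficients by \<open>\<Prod>(a - b)\<close>, where \<open>a\<close> is the
  order of vanishing, and costs one relation for each factor.\<close>

lemma euler_operators:
  assumes "finite J" "\<And>j. j \<in> J \<Longrightarrow> u j \<in> \<O>"
    and rel: "\<And>k. k < M \<Longrightarrow> (\<Sum>j\<in>J. y j * (\<delta> ^^ k) (t ^ a j * u j)) = 0"
    and "length bs < M"
  shows "\<exists>U. (\<forall>j\<in>J. U j \<in> \<O> \<and> v (U j) = v (u j) * (\<Prod>b\<leftarrow>bs. of_nat (a j) - of_nat b)) \<and>
    (\<forall>k<M - length bs. (\<Sum>j\<in>J. y j * (\<delta> ^^ k) (t ^ a j * U j)) = 0)"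
  using \<open>length bs < M\<close>
proof (induction bs)
  case Nil
  then show ?case using assms(2) rel by (intro exI[of _ u]) auto
next
  case (Cons b bs)
  then obtain U where U: "\<And>j. j \<in> J \<Longrightarrow> U j \<in> \<O>"
    "\<And>j. j \<in> J \<Longrightarrow> v (U j) = v (u j) * (\<Prod>b\<leftarrow>bs. of_nat (a j) - of_nat b)"
    "\<And>k. k < M - length bs \<Longrightarrow> (\<Sum>j\<in>J. y j * (\<delta> ^^ k) (t ^ a j * U j)) = 0"
    by auto
  \<comment> \<open>Chosen so that t^a U' is the image of t^a U under t d/dt - b. The second summand
    has value 0, so leading coefficients are multiplied by a - b.\<close>
  define U' where "U' j = (of_nat (a j) - of_nat b) * U j + t * \<delta> (U j)" for j
  have U'eq: "U' j = const (of_nat (a j) - of_nat b) * U j + t * \<delta> (U j)" for j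
    by (simp add: U'_def const.hom_minus const.hom_of_nat)
  have "U' j \<in> \<O> \<and> v (U' j) = v (u j) * (\<Prod>b\<leftarrow>b # bs. of_nat (a j) - of_nat b)" if "j \<in> J" for j
  proof -
    have "\<delta> (U j) \<in> \<O>" using U(1)[OF that] deriv_regular[OF t] by blast
    then show ?thesis
      unfolding U'eq using U(1,2)[OF that] parameter_in[OF t] by (simp del: const.hom_minus)
  qed
  moreover have "(\<Sum>j\<in>J. y j * (\<delta> ^^ k) (t ^ a j * U' j)) = 0" if k: "k < M - length (b # bs)" for k
  proof -
    have "t ^ a j * U' j = t * \<delta> (t ^ a j * U j) + const (- of_nat b) * (t ^ a j * U j)" for j
    proof -
      have "t * \<delta> (t ^ a j * U j) = t ^ a j * (t * \<delta> (U j)) + (t * \<delta> (t ^ a j)) * U j"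
        by (simp add: deriv_mult[OF tr] algebra_simps)
      then show ?thesis
        unfolding U'_def deriv_t_power by (simp add: algebra_simps const.hom_uminus const.hom_of_nat)
    qed
    then have "(\<delta> ^^ k) (t ^ a j * U' j) = t * (\<delta> ^^ Suc k) (t ^ a j * U j) + of_nat k * (\<delta> ^^ k) (t ^ a j * U j)
        + const (- of_nat b) * (\<delta> ^^ k) (t ^ a j * U j)" for j
      by (simp only: iterated_deriv_linear iterated_deriv_euler)
    then have "(\<Sum>j\<in>J. y j * (\<delta> ^^ k) (t ^ a j * U' j)) =
        (\<Sum>j\<in>J. t * (y j * (\<delta> ^^ Suc k) (t ^ a j * U j)) + of_nat k * (y j * (\<delta> ^^ k) (t ^ a j * U j))
        + const (- of_nat b) * (y j * (\<delta> ^^ k) (t ^ a j * U j)))"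
      by (simp only: distrib_left mult_ac)
    also have "\<dots> = t * (\<Sum>j\<in>J. y j * (\<delta> ^^ Suc k) (t ^ a j * U j)) + of_nat k * (\<Sum>j\<in>J. y j * (\<delta> ^^ k) (t ^ a j * U j))
        + const (- of_nat b) * (\<Sum>j\<in>J. y j * (\<delta> ^^ k) (t ^ a j * U j))"
      by (simp only: sum.distrib sum_distrib_left)
    also have "\<dots> = 0"
      using U(3)[of k] U(3)[of "Suc k"] k by (simp del: funpow.simps)
    finally show ?thesis .
  qed
  ultimately show ?case by blast
qed

text \<open>The weight of j is the coefficient at t^\<mu> of \<open>y j\<close> times the j-th
  function. After the operators have acted, the relation without derivatives is divided by t^\<mu>
  and evaluated at P; there the quotient of \<open>U j\<close> by \<open>u j\<close> takes the
  product over \<open>bs\<close> as its value.\<close>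

lemma weight_relation:
  assumes J: "finite J" "\<And>j. j \<in> J \<Longrightarrow> unit (u j)"
    and rel: "\<And>k. k < M \<Longrightarrow> (\<Sum>j\<in>J. y j * (\<delta> ^^ k) (t ^ a j * u j)) = 0"
    and bs: "length bs < M"
    and w: "\<And>j. j \<in> J \<Longrightarrow> t powi (- \<mu>) * (y j * (t ^ a j * u j)) \<in> \<O>"
  shows "(\<Sum>j\<in>J. v (t powi (- \<mu>) * (y j * (t ^ a j * u j))) * (\<Prod>b\<leftarrow>bs. of_nat (a j) - of_nat b)) = 0"
proof -
  let ?w = "\<lambda>j. t powi (- \<mu>) * (y j * (t ^ a j * u j))"
  obtain U where U: "\<And>j. j \<in> J \<Longrightarrow> U j \<in> \<O>"
    "\<And>j. j \<in> J \<Longrightarrow> v (U j) = v (u j) * (\<Prod>b\<leftarrow>bs. of_nat (a j) - of_nat b)"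
    "\<And>k. k < M - length bs \<Longrightarrow> (\<Sum>j\<in>J. y j * (\<delta> ^^ k) (t ^ a j * U j)) = 0"
    using euler_operators[OF J(1) unit_in[OF J(2)] rel bs] by blast
  have "0 = t powi (- \<mu>) * (\<Sum>j\<in>J. y j * (t ^ a j * U j))"
    using U(3)[of 0] bs by simp
  also have "\<dots> = (\<Sum>j\<in>J. ?w j * (inverse (u j) * U j))"
    unfolding sum_distrib_left
    by (intro sum.cong refl) (use unit_nonzero[OF J(2)] in \<open>simp add: field_simps\<close>)
  finally have "0 = (\<Sum>j\<in>J. ?w j * (inverse (u j) * U j))" .
  then have "0 = v (\<Sum>j\<in>J. ?w j * (inverse (u j) * U j))" by simp
  also have "\<dots> = (\<Sum>j\<in>J. v (?w j * (inverse (u j) * U j)))"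
    by (rule v_sum) (use w U unit_inverse[OF J(2)] unit_in in auto)
  also have "\<dots> = (\<Sum>j\<in>J. v (?w j) * (\<Prod>b\<leftarrow>bs. of_nat (a j) - of_nat b))"
  proof (intro sum.cong refl)
    fix j assume j: "j \<in> J"
    have "v (u j) \<noteq> 0" using J(2)[OF j] by (simp add: unit_def)
    then show "v (?w j * (inverse (u j) * U j)) = v (?w j) * (\<Prod>b\<leftarrow>bs. of_nat (a j) - of_nat b)"
      using v_mult[OF w[OF j], of "inverse (u j) * U j"]
        v_mult[of "inverse (u j)" "U j"] unit_inverse[OF J(2)[OF j]] v_inverse[OF J(2)[OF j]] U(1,2)[OF j]
      by (simp add: unit_in)
  qed
  finally show ?thesis by simp
qed

end

section \<open>Families with distinct orders of vanishing\<close>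

definition const_linear :: "('b \<Rightarrow> 'b) \<Rightarrow> bool" where
  "const_linear T \<longleftrightarrow> (\<forall>f g. T (f + g) = T f + T g) \<and> (\<forall>c f. T (const c * f) = const c * T f)"

lemma const_independent_nonzero:
  assumes "const_independent J F" "finite J" "j \<in> J" shows "F j \<noteq> 0"
proof
  assume "F j = 0"
  have "(\<Sum>i\<in>J. const (if i = j then 1 else 0) * F i) = (\<Sum>i\<in>J. if i = j then F j else 0)"
    by (intro sum.cong) auto
  also have "\<dots> = 0" by (rule sum.neutral) (simp add: \<open>F j = 0\<close>)
  finally have "\<forall>i\<in>J. (if i = j then 1 else 0) = (0::'a)"
    using assms(1) unfolding const_independent_def by (elim allE[of _ "\<lambda>i. if i = j then 1 else 0"]) simp
  then show False using assms(3) by auto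
qed

text \<open>The clause on all \<open>const_linear\<close> maps T expresses that the tensor of
  coefficients and functions is preserved; T will be an iterated derivative. The next clause says
  the same after the coefficients are evaluated at P. The bound n serves the induction: after a
  pivot of order a the remaining functions have order at least a + 1.\<close>

definition echelon_form ::
    "nat set \<Rightarrow> int \<Rightarrow> (nat \<Rightarrow> 'b) \<Rightarrow> (nat \<Rightarrow> 'b) \<Rightarrow> (nat \<Rightarrow> 'b) \<Rightarrow> (nat \<Rightarrow> 'b) \<Rightarrow> bool" where
  "echelon_form J n F \<rho> F' \<rho>' \<longleftrightarrow>
    (\<forall>j\<in>J. F' j \<in> \<O> \<and> F' j \<noteq> 0 \<and> \<rho>' j \<in> \<O> \<and> n \<le> ord (F' j)) \<and> inj_on (\<lambda>j. ord (F' j)) J \<and>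
    (\<forall>T. const_linear T \<longrightarrow> (\<Sum>j\<in>J. \<rho>' j * T (F' j)) = (\<Sum>j\<in>J. \<rho> j * T (F j))) \<and>
    (\<Sum>j\<in>J. const (v (\<rho>' j)) * F' j) = (\<Sum>j\<in>J. const (v (\<rho> j)) * F j) \<and>
    ((\<exists>j\<in>J. v (\<rho> j) \<noteq> 0) \<longrightarrow> (\<exists>j\<in>J. v (\<rho>' j) \<noteq> 0)) \<and>
    (\<forall>b. \<exists>b'. lincomb J b F = lincomb J b' F')"

text \<open>Gaussian elimination of the orders at \<open>P\<close>, applied contragrediently to the coefficients
  \<open>\<rho>\<close> so that the tensor \<open>\<Sum> \<rho>\<^sub>j \<otimes> F\<^sub>j\<close> does not change.\<close>

lemma echelon:
  assumes t: "parameter t" and "finite J" "\<forall>j\<in>J. F j \<in> \<O>" "const_independent J F"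
    "\<forall>j\<in>J. \<rho> j \<in> \<O>" "\<forall>j\<in>J. n \<le> ord (F j)"
  shows "\<exists>F' \<rho>'. echelon_form J n F \<rho> F' \<rho>'"
  using assms(2-)
proof (induction "card J" arbitrary: J F \<rho> n)
  case 0
  then have "J = {}" by simp
  then show ?case by (simp add: echelon_form_def)
next
  case (Suc m)
  note hyp = Suc.prems
  have nz: "F j \<noteq> 0" if "j \<in> J" for j using const_independent_nonzero hyp(1,3) that by blast
  have Jne: "J \<noteq> {}" using Suc(2) by auto
  then have "Min ((\<lambda>j. ord (F j)) ` J) \<in> (\<lambda>j. ord (F j)) ` J"
    using hyp(1) by (intro Min_in) auto
  then obtain i where i: "i \<in> J" "Min ((\<lambda>j. ord (F j)) ` J) = ord (F i)" by auto
  have i_min: "ord (F i) \<le> ord (F j)" if "j \<in> J" for j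
    unfolding i(2)[symmetric] using hyp(1) that by (intro Min_le) auto
  define a where "a = ord (F i)"
  define J' where "J' = J - {i}"
  have J': "finite J'" "i \<notin> J'" "J = insert i J'" "m = card J'"
    using hyp(1) i(1) Suc(2) by (auto simp: J'_def card_Diff_singleton)
  have sumJ: "(\<Sum>j\<in>J. f j) = f i + (\<Sum>j\<in>J'. f j)" for f :: "nat \<Rightarrow> 'b"
    using J' by simp
  note tnz = parameter_powi_nonzero[OF t]
  let ?l = "\<lambda>j. t powi (- a) * F j"
  have lO: "?l j \<in> \<O>" if "j \<in> J" for j
    using that nz[OF that] tnz i_min[OF that] by (simp add: in_iff_ord ord_mult ord_parameter_powi[OF t] a_def)
  have li: "v (?l i) \<noteq> 0"
    using unit_iff_ord[of "?l i"] nz[OF i(1)] tnz by (simp add: ord_mult ord_parameter_powi[OF t] a_def unit_def)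
  \<comment> \<open>Ratio of leading coefficients at the least order a, so that \<open>G j\<close>
    loses the term of order a.\<close>
  define c where "c j = v (?l j) / v (?l i)" for j
  define G where "G j = F j - const (c j) * F i" for j
  have FG: "F j = G j + const (c j) * F i" for j by (simp add: G_def)
  have combine: "lincomb J b F =
      const (b i + (\<Sum>j\<in>J'. b j * c j)) * F i + lincomb J' b G" for b
  proof -
    have "lincomb J' b F =
        lincomb J' b G + (\<Sum>j\<in>J'. const (b j * c j)) * F i"
      unfolding sum_distrib_right sum.distrib[symmetric]
      by (intro sum.cong refl, subst FG) (simp add: const.hom_mult algebra_simps)
    then show ?thesis
      unfolding sumJ by (simp add: const.hom_add const.hom_sum algebra_simps)
  qed
  have ind: "const_independent J' G"
    unfolding const_independent_def
  proof (intro allI impI)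
    fix b assume b: "lincomb J' b G = 0"
    \<comment> \<open>The coefficient of \<open>F i\<close> is chosen to cancel its total
      contribution in \<open>combine\<close>.\<close>
    define b' where "b' = (\<lambda>j. if j = i then - (\<Sum>j\<in>J'. b j * c j) else b j)"
    have b'J: "b' j = b j" if "j \<in> J'" for j using that J'(2) by (auto simp: b'_def)
    have "lincomb J b' F = 0"
      unfolding combine using b by (simp add: b'J b'_def[THEN fun_cong, of i] cong: sum.cong)
    then have "\<forall>j\<in>J. b' j = 0" using hyp(3) unfolding const_independent_def by blast
    then show "\<forall>j\<in>J'. b j = 0" using b'J J'(3) by auto
  qed
  have GO: "G j \<in> \<O>" if "j \<in> J'" for j
    using that hyp(2)[rule_format] J'(3) i(1) by (simp add: G_def)
  have ordG: "a + 1 \<le> ord (G j)" if j: "j \<in> J'" for j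
  proof -
    have jJ: "j \<in> J" using j J'(3) by simp
    have e: "t powi (- a) * G j = ?l j - const (c j) * ?l i"
      by (simp add: G_def algebra_simps)
    have "v (t powi (- a) * G j) = 0"
      unfolding e using lO[OF jJ] lO[OF i(1)] li by (simp add: c_def)
    moreover have "t powi (- a) * G j \<in> \<O>"
      unfolding e using lO[OF jJ] lO[OF i(1)] by simp
    moreover have "G j \<noteq> 0" using const_independent_nonzero[OF ind J'(1) j] .
    ultimately have "ord (t powi (- a) * G j) > 0" using v_eq_0_iff_ord tnz by simp
    then show ?thesis using \<open>G j \<noteq> 0\<close> tnz by (simp add: ord_mult ord_parameter_powi[OF t])
  qed
  have \<rho>J': "\<rho> j \<in> \<O>" if "j \<in> J'" for j using that hyp(4) J'(3) by auto
  have "\<exists>G' \<rho>'. echelon_form J' (a + 1) G \<rho> G' \<rho>'"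
    by (rule Suc.hyps(1)[OF J'(4,1)]) (use GO ind \<rho>J' ordG in auto)
  then obtain G' \<rho>' where "echelon_form J' (a + 1) G \<rho> G' \<rho>'" by blast
  then have IH: "\<And>j. j \<in> J' \<Longrightarrow> G' j \<in> \<O> \<and> G' j \<noteq> 0 \<and> \<rho>' j \<in> \<O> \<and> a + 1 \<le> ord (G' j)"
    "inj_on (\<lambda>j. ord (G' j)) J'"
    "\<And>T. const_linear T \<Longrightarrow> (\<Sum>j\<in>J'. \<rho>' j * T (G' j)) = (\<Sum>j\<in>J'. \<rho> j * T (G j))"
    "(\<Sum>j\<in>J'. const (v (\<rho>' j)) * G' j) = (\<Sum>j\<in>J'. const (v (\<rho> j)) * G j)"
    "(\<exists>j\<in>J'. v (\<rho> j) \<noteq> 0) \<Longrightarrow> (\<exists>j\<in>J'. v (\<rho>' j) \<noteq> 0)"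
    "\<And>b. \<exists>b'. lincomb J' b G = lincomb J' b' G'"
    unfolding echelon_form_def by blast+
  define F' where "F' = G'(i := F i)"
  \<comment> \<open>Dual change of coefficients: since \<open>F j\<close> is \<open>G j\<close> plus
    \<open>c j\<close> times \<open>F i\<close>, the coefficient of \<open>F i\<close> collects
    \<open>c j\<close> times each \<open>\<rho> j\<close>.\<close>
  define \<rho>'' where "\<rho>'' = \<rho>'(i := \<rho> i + (\<Sum>j\<in>J'. const (c j) * \<rho> j))"
  have F'J: "F' i = F i" "\<And>j. j \<in> J' \<Longrightarrow> F' j = G' j"
    "\<rho>'' i = \<rho> i + (\<Sum>j\<in>J'. const (c j) * \<rho> j)" "\<And>j. j \<in> J' \<Longrightarrow> \<rho>'' j = \<rho>' j"
    using J'(2) by (auto simp: F'_def \<rho>''_def)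
  have \<rho>i: "\<rho>'' i \<in> \<O>" "v (\<rho>'' i) = v (\<rho> i) + (\<Sum>j\<in>J'. c j * v (\<rho> j))"
    unfolding F'J(3) using \<rho>J' hyp(4)[rule_format, OF i(1)] by simp_all
  show ?case
    unfolding echelon_form_def
  proof (rule exI[of _ F'], rule exI[of _ \<rho>''], intro conjI ballI allI impI)
    fix j assume j: "j \<in> J"
    show "F' j \<in> \<O>" "F' j \<noteq> 0" "\<rho>'' j \<in> \<O>" "n \<le> ord (F' j)"
      using j IH(1) hyp(2)[rule_format, OF i(1)] nz[OF i(1)] hyp(5)[rule_format, OF i(1)] \<rho>i(1) unfolding J'(3) a_def
      by (force simp: F'J)+
  next
    have "ord (F' j) \<noteq> a" if "j \<in> J'" for j using IH(1)[OF that] F'J(2)[OF that] by simp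
    then show "inj_on (\<lambda>j. ord (F' j)) J"
      using IH(2) J'(2) unfolding J'(3) inj_on_def a_def
      by (auto simp: F'J) metis+
  next
    fix T assume T: "const_linear T"
    have "(\<Sum>j\<in>J'. \<rho> j * T (F j)) = (\<Sum>j\<in>J'. \<rho> j * T (G j)) + (\<Sum>j\<in>J'. const (c j) * \<rho> j) * T (F i)"
      unfolding sum_distrib_right sum.distrib[symmetric]
      by (intro sum.cong refl, subst FG) (use T in \<open>simp add: const_linear_def algebra_simps\<close>)
    then show "(\<Sum>j\<in>J. \<rho>'' j * T (F' j)) = (\<Sum>j\<in>J. \<rho> j * T (F j))"
      unfolding sumJ using IH(3)[OF T] by (simp add: F'J algebra_simps cong: sum.cong)
  next
    show "(\<Sum>j\<in>J. const (v (\<rho>'' j)) * F' j) = (\<Sum>j\<in>J. const (v (\<rho> j)) * F j)"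
      unfolding combine unfolding sumJ \<rho>i(2) using IH(4) by (simp add: F'J mult.commute cong: sum.cong)
  next
    assume "\<exists>j\<in>J. v (\<rho> j) \<noteq> 0"
    show "\<exists>j\<in>J. v (\<rho>'' j) \<noteq> 0"
    proof (cases "\<exists>j\<in>J'. v (\<rho> j) \<noteq> 0")
      case True
      then show ?thesis using IH(5) F'J(4) J'(3) by auto
    next
      case False
      then have "v (\<rho>'' i) \<noteq> 0" using \<open>\<exists>j\<in>J. v (\<rho> j) \<noteq> 0\<close> J'(3) by (auto simp: \<rho>i(2))
      then show ?thesis using i(1) by blast
    qed
  next
    fix b
    obtain b' where "lincomb J' b G = lincomb J' b' G'"
      using IH(6) by blast
    then have "lincomb J b F = (\<Sum>j\<in>J. const ((b'(i := b i + (\<Sum>j\<in>J'. b j * c j))) j) * F' j)"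
      unfolding combine unfolding sumJ using J'(2) by (auto simp: F'J cong: sum.cong intro!: sum.cong)
    then show "\<exists>b'. lincomb J b F = lincomb J b' F'" by blast
  qed
qed

end

section \<open>Weights of solutions of the differential relations\<close>

context curve_point
begin

context
  fixes t assumes t: "parameter t"
begin

lemma iterated_deriv_const_linear: "const_linear (\<delta> t ^^ k)"
  by (simp add: const_linear_def iterated_deriv_linear[OF t])

text \<open>The power of t is taken out of the products of \<open>\<rho> j\<close> and
  \<open>F j\<close>, not out of the coefficients alone, so that their lowest common terms, the
  weights, are not all 0. Each \<open>F j\<close> is a power of t times a unit, as
  \<open>weight_relation\<close> requires.\<close>

lemma solution_weights:
  assumes J: "finite J" "\<And>j. j \<in> J \<Longrightarrow> F j \<in> \<O> \<and> F j \<noteq> 0" "\<exists>j\<in>J. \<rho> j \<noteq> 0"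
    and rel: "\<And>k. k < M \<Longrightarrow> (\<Sum>j\<in>J. \<rho> j * (\<delta> t ^^ k) (F j)) = 0"
  obtains \<mu> where "\<And>j. j \<in> J \<Longrightarrow> t powi (- \<mu>) * (\<rho> j * F j) \<in> \<O>"
    "\<exists>j\<in>J. v (t powi (- \<mu>) * (\<rho> j * F j)) \<noteq> 0"
    "\<And>bs. length bs < M \<Longrightarrow>
      (\<Sum>j\<in>J. v (t powi (- \<mu>) * (\<rho> j * F j)) * (\<Prod>b\<leftarrow>bs. of_nat (nat (ord (F j))) - of_nat b)) = 0"
proof -
  define a where "a j = nat (ord (F j))" for j
  define u where "u j = F j / t ^ a j" for j
  have Fu: "F j = t ^ a j * u j" for j
    using parameter_nonzero[OF t] by (simp add: u_def)
  have u: "unit (u j)" if j: "j \<in> J" for j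
  proof -
    have "ord (F j) \<ge> 0" using J(2)[OF j] in_iff_ord by blast
    moreover have "ord (t ^ a j) = int (a j)"
      using ord_parameter_powi[OF t, of "int (a j)"] by simp
    ultimately have "ord (u j) = 0"
      using J(2)[OF j] parameter_nonzero[OF t] by (simp add: u_def ord_divide a_def)
    then show ?thesis using J(2)[OF j] parameter_nonzero[OF t] unit_iff_ord[of "u j"] by (simp add: u_def)
  qed
  obtain \<mu> where \<mu>: "\<And>j. j \<in> J \<Longrightarrow> t powi (- \<mu>) * (\<rho> j * F j) \<in> \<O>"
    "\<exists>j\<in>J. v (t powi (- \<mu>) * (\<rho> j * F j)) \<noteq> 0"
  proof (rule normalize[OF t J(1), of "\<lambda>j. \<rho> j * F j"])
    show "\<exists>j\<in>J. \<rho> j * F j \<noteq> 0" using J(2,3) by auto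
  qed (use that in blast)
  show thesis
  proof (rule that[OF \<mu>])
    fix bs :: "nat list" assume "length bs < M"
    then show "(\<Sum>j\<in>J. v (t powi (- \<mu>) * (\<rho> j * F j)) * (\<Prod>b\<leftarrow>bs. of_nat (nat (ord (F j))) - of_nat b)) = 0"
      using weight_relation[OF t J(1), of u M \<rho> a bs \<mu>] u rel \<mu>(1)
      unfolding Fu[symmetric] a_def[symmetric] by blast
  qed
qed

lemma nat_ord_inj:
  assumes "\<And>j. j \<in> J \<Longrightarrow> F j \<in> \<O> \<and> F j \<noteq> 0" "inj_on (\<lambda>j. ord (F j)) J"
    "i \<in> J" "j \<in> J" "nat (ord (F i)) = nat (ord (F j))"
  shows "i = j"
proof -
  have "ord (F i) \<ge> 0" "ord (F j) \<ge> 0" using assms(1,3,4) in_iff_ord by blast+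
  then have "ord (F i) = ord (F j)" using assms(5) by simp
  then show ?thesis using assms(2-4) by (auto dest: inj_onD)
qed

lemma prod_roots:
  assumes "finite S"
  shows "(\<Prod>b\<leftarrow>map a (sorted_list_of_set S). of_nat x - (of_nat b :: 'a)) = (\<Prod>l\<in>S. of_nat x - of_nat (a l))"
  using assms by (simp add: o_def prod.distinct_set_conv_list[symmetric])

text \<open>With as many relations as functions, card J - 1 factors may be used. They annihilate
  every weight except a chosen nonzero one, which is multiplied by a product of differences of
  distinct orders. In determinant form: Wronskians of independent functions do not vanish in
  characteristic zero.\<close>

lemma no_full_relation:
  assumes J: "finite J" "\<And>j. j \<in> J \<Longrightarrow> F j \<in> \<O>" "const_independent J F" "\<exists>j\<in>J. y j \<noteq> 0"
    and rel: "\<And>k. k < card J \<Longrightarrow> (\<Sum>j\<in>J. y j * (\<delta> t ^^ k) (F j)) = 0"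
  shows False
proof -
  obtain \<nu> where \<nu>: "\<And>j. j \<in> J \<Longrightarrow> t powi (- \<nu>) * y j \<in> \<O>" "\<exists>j\<in>J. v (t powi (- \<nu>) * y j) \<noteq> 0"
    using normalize[OF t J(1,4)] by blast
  have nz: "F j \<noteq> 0" if "j \<in> J" for j
    using const_independent_nonzero J(1,3) that by blast
  have "\<exists>F' \<rho>'. echelon_form J 0 F (\<lambda>j. t powi (- \<nu>) * y j) F' \<rho>'"
    by (rule echelon[OF t J(1) _ J(3)]) (use \<nu>(1) J(2) nz in_iff_ord in auto)
  then obtain F' \<rho>' where e: "echelon_form J 0 F (\<lambda>j. t powi (- \<nu>) * y j) F' \<rho>'" by blast
  have F': "F' j \<in> \<O> \<and> F' j \<noteq> 0" if "j \<in> J" for j using e that by (auto simp: echelon_form_def)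
  have inj: "inj_on (\<lambda>j. ord (F' j)) J" using e by (auto simp: echelon_form_def)
  have "\<exists>j\<in>J. v (\<rho>' j) \<noteq> 0" using e \<nu>(2) by (auto simp: echelon_form_def)
  then have \<rho>nz: "\<exists>j\<in>J. \<rho>' j \<noteq> 0" using v_zero by metis
  have rel': "(\<Sum>j\<in>J. \<rho>' j * (\<delta> t ^^ k) (F' j)) = 0" if "k < card J" for k
  proof -
    have "(\<Sum>j\<in>J. \<rho>' j * (\<delta> t ^^ k) (F' j)) = (\<Sum>j\<in>J. t powi (- \<nu>) * y j * (\<delta> t ^^ k) (F j))"
      using e iterated_deriv_const_linear unfolding echelon_form_def by blast
    also have "\<dots> = t powi (- \<nu>) * (\<Sum>j\<in>J. y j * (\<delta> t ^^ k) (F j))"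
      by (simp add: sum_distrib_left mult.assoc)
    finally show ?thesis using rel[OF that] by simp
  qed
  let ?a = "\<lambda>j. nat (ord (F' j))"
  obtain \<mu> where "\<And>j. j \<in> J \<Longrightarrow> t powi (- \<mu>) * (\<rho>' j * F' j) \<in> \<O>"
    and \<mu>: "\<exists>j\<in>J. v (t powi (- \<mu>) * (\<rho>' j * F' j)) \<noteq> 0"
    "\<And>bs. length bs < card J \<Longrightarrow>
      (\<Sum>j\<in>J. v (t powi (- \<mu>) * (\<rho>' j * F' j)) * (\<Prod>b\<leftarrow>bs. of_nat (?a j) - of_nat b)) = 0"
    by (rule solution_weights[of J F' \<rho>' "card J"])
      (assumption | rule J(1) F' \<rho>nz rel' | rule that)+
  let ?w = "\<lambda>j. v (t powi (- \<mu>) * (\<rho>' j * F' j))"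
  obtain i where i: "i \<in> J" "?w i \<noteq> 0" using \<mu>(1) by blast
  let ?p = "\<lambda>j. \<Prod>l\<in>J - {i}. of_nat (?a j) - (of_nat (?a l) :: 'a)"
  have "length (map ?a (sorted_list_of_set (J - {i}))) < card J"
    using card_Diff1_less[OF J(1) i(1)] by (simp only: length_map length_sorted_list_of_set)
  then have "(\<Sum>j\<in>J. ?w j * ?p j) = 0"
    using \<mu>(2)[of "map ?a (sorted_list_of_set (J - {i}))"] J(1) by (simp only: prod_roots finite_Diff)
  moreover have "(\<Sum>j\<in>J. ?w j * ?p j) = ?w i * ?p i + (\<Sum>j\<in>J - {i}. ?w j * ?p j)"
    using J(1) i(1) by (rule sum.remove)
  moreover have "?p j = 0" if "j \<in> J - {i}" for j
    using that J(1) by (intro prod_zero) auto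
  moreover have "?p i \<noteq> 0"
    using nat_ord_inj[of J F', OF F' inj i(1)] J(1) by (auto simp: prod_zero_iff)
  ultimately show False using i(2) by simp
qed

text \<open>Since the orders are distinct, lowest terms cannot cancel: the combination has the least
  order among the functions with nonzero coefficient.\<close>

lemma ord_combination_le:
  assumes J: "finite J" "\<And>j. j \<in> J \<Longrightarrow> F j \<noteq> 0" "inj_on (\<lambda>j. ord (F j)) J"
    and le: "\<And>j. j \<in> J \<Longrightarrow> ord (F j) \<le> n"
    and nz: "lincomb J b F \<noteq> 0"
  shows "ord (lincomb J b F) \<le> n"
proof -
  let ?J = "{j\<in>J. b j \<noteq> 0}"
  let ?s = "lincomb J b F"
  have s: "?s = lincomb ?J b F"
    by (rule sum.mono_neutral_right) (use J(1) in auto)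
  have "?J \<noteq> {}" using nz unfolding s by (metis sum.empty)
  then have "Min ((\<lambda>j. ord (F j)) ` ?J) \<in> (\<lambda>j. ord (F j)) ` ?J"
    using J(1) by (intro Min_in) auto
  then obtain i where i: "i \<in> ?J" "Min ((\<lambda>j. ord (F j)) ` ?J) = ord (F i)" by auto
  have i_min: "ord (F i) \<le> ord (F j)" if "j \<in> ?J" for j
    unfolding i(2)[symmetric] using J(1) that by (intro Min_le) auto
  note tnz = parameter_powi_nonzero[OF t]
  define l where "l j = t powi (- ord (F i)) * F j" for j
  have lnz: "l j \<noteq> 0" "ord (l j) = ord (F j) - ord (F i)" if "j \<in> ?J" for j
    using that J(2)[of j] tnz by (simp_all add: l_def ord_mult ord_parameter_powi[OF t])
  have lO: "l j \<in> \<O>" if "j \<in> ?J" for j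
    using lnz[OF that] i_min[OF that] by (simp add: in_iff_ord)
  have l0: "v (l j) = 0" if "j \<in> ?J - {i}" for j
  proof -
    have "ord (F j) \<noteq> ord (F i)" using that i(1) J(3) by (auto dest: inj_onD)
    then show ?thesis using that lnz[of j] lO[of j] i_min[of j] v_eq_0_iff_ord[of "l j"] by auto
  qed
  have li: "v (l i) \<noteq> 0" using lnz[OF i(1)] unit_iff_ord[of "l i"] by (simp add: unit_def)
  have e: "t powi (- ord (F i)) * ?s = lincomb ?J b l"
    unfolding s by (simp add: l_def sum_distrib_left mult_ac)
  have "v (lincomb ?J b l) = (\<Sum>j\<in>?J. b j * v (l j))"
    using lO by (subst v_sum) (auto intro: sum.cong)
  also have "\<dots> = b i * v (l i) + (\<Sum>j\<in>?J - {i}. b j * v (l j))"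
    using J(1) i(1) by (intro sum.remove) auto
  also have "(\<Sum>j\<in>?J - {i}. b j * v (l j)) = 0"
    by (rule sum.neutral) (use l0 in auto)
  finally have "v (t powi (- ord (F i)) * ?s) \<noteq> 0" unfolding e using li i(1) by simp
  moreover have "t powi (- ord (F i)) * ?s \<in> \<O>"
    unfolding e by (rule sum_in) (use lO in auto)
  ultimately have "ord (t powi (- ord (F i)) * ?s) = 0"
    using unit_iff_ord[of "t powi (- ord (F i)) * ?s"] nz tnz by (simp add: unit_def)
  then have "ord ?s = ord (F i)" using nz tnz by (simp add: ord_mult ord_parameter_powi[OF t])
  then show ?thesis using le i(1) by auto
qed

text \<open>The weights \<open>w\<^sub>j\<close> of a solution satisfy \<open>w\<^sub>i \<Prod>(a\<^sub>i - a\<^sub>l) + w\<^sub>m \<Prod>(a\<^sub>m - a\<^sub>l) = 0\<close>, \<open>l\<close> running over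
  the other indices; so none of them vanishes, and the coefficient of the function of highest
  order is the only one not vanishing at \<open>P\<close>.\<close>

lemma solution_has_maximal_order:
  assumes F: "\<And>j. j \<le> r \<Longrightarrow> F j \<in> \<O>" "const_independent {..r} F"
    and \<rho>: "\<And>j. j \<le> r \<Longrightarrow> \<rho> j \<in> \<O>" "\<exists>j\<le>r. v (\<rho> j) \<noteq> 0"
    and rel: "\<And>k. k < r \<Longrightarrow> (\<Sum>j\<le>r. \<rho> j * (\<delta> t ^^ k) (F j)) = 0"
    and nz: "lincomb {..r} b F \<noteq> 0"
  shows "ord (lincomb {..r} b F) \<le> ord (\<Sum>j\<le>r. const (v (\<rho> j)) * F j)"
proof -
  let ?J = "{..r}"
  have Fnz: "F j \<noteq> 0" if "j \<in> ?J" for j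
    using const_independent_nonzero F(2) that by blast
  have "\<exists>F' \<rho>'. echelon_form ?J 0 F \<rho> F' \<rho>'"
    by (rule echelon[OF t _ _ F(2)]) (use F(1) \<rho>(1) Fnz in_iff_ord in auto)
  then obtain F' \<rho>' where e: "echelon_form ?J 0 F \<rho> F' \<rho>'" by blast
  have F': "F' j \<in> \<O> \<and> F' j \<noteq> 0" if "j \<in> ?J" for j using e that by (auto simp: echelon_form_def)
  have \<rho>': "\<rho>' j \<in> \<O>" if "j \<in> ?J" for j using e that by (auto simp: echelon_form_def)
  have inj: "inj_on (\<lambda>j. ord (F' j)) ?J" using e by (auto simp: echelon_form_def)
  have \<rho>nz: "\<exists>j\<in>?J. v (\<rho>' j) \<noteq> 0" using e \<rho>(2) unfolding echelon_form_def by blast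
  then have \<rho>nz': "\<exists>j\<in>?J. \<rho>' j \<noteq> 0" using v_zero by metis
  have rel': "(\<Sum>j\<in>?J. \<rho>' j * (\<delta> t ^^ k) (F' j)) = 0" if "k < r" for k
  proof -
    have "(\<Sum>j\<in>?J. \<rho>' j * (\<delta> t ^^ k) (F' j)) = (\<Sum>j\<in>?J. \<rho> j * (\<delta> t ^^ k) (F j))"
      using e iterated_deriv_const_linear unfolding echelon_form_def by blast
    then show ?thesis using rel[OF that] by simp
  qed
  let ?a = "\<lambda>j. nat (ord (F' j))"
  obtain \<mu> where \<mu>: "\<And>j. j \<in> ?J \<Longrightarrow> t powi (- \<mu>) * (\<rho>' j * F' j) \<in> \<O>" "\<exists>j\<in>?J. v (t powi (- \<mu>) * (\<rho>' j * F' j)) \<noteq> 0"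
    "\<And>bs. length bs < r \<Longrightarrow>
      (\<Sum>j\<in>?J. v (t powi (- \<mu>) * (\<rho>' j * F' j)) * (\<Prod>b\<leftarrow>bs. of_nat (?a j) - of_nat b)) = 0"
    by (rule solution_weights[of ?J F' \<rho>' r])
      (assumption | rule finite_atMost F' \<rho>nz' rel' | rule that)+
  let ?w = "\<lambda>j. v (t powi (- \<mu>) * (\<rho>' j * F' j))"
  have w_iff: "?w m \<noteq> 0" if im: "i \<in> ?J" "m \<in> ?J" and wi: "?w i \<noteq> 0" for i m
  proof (cases "i = m")
    case True
    then show ?thesis using wi by (simp only: not_False_eq_True)
  next
    case False
    let ?S = "?J - {i, m}"
    let ?p = "\<lambda>j. \<Prod>l\<in>?S. of_nat (?a j) - (of_nat (?a l) :: 'a)"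
    \<comment> \<open>Omitting two of the r + 1 indices leaves r - 1 factors, the largest number
      that r relations support.\<close>
    have "card ?S < r"
    proof -
      have "card ?S = card ?J - card {i, m}" using im by (intro card_Diff_subset) auto
      then have "card ?S = Suc r - 2" using False by simp
      moreover have "r > 0" using im False by auto
      ultimately show ?thesis by simp
    qed
    then have "(\<Sum>j\<in>?J. ?w j * ?p j) = 0"
      using \<mu>(3)[of "map ?a (sorted_list_of_set ?S)"] by (simp only: prod_roots finite_Diff finite_atMost length_map length_sorted_list_of_set)
    moreover have "(\<Sum>j\<in>?J. ?w j * ?p j) = (\<Sum>j\<in>{i, m}. ?w j * ?p j)"
    proof (rule sum.mono_neutral_right)
      have "?p j = 0" if "j \<in> ?J - {i, m}" for j
        using that by (intro prod_zero) auto
      then show "\<forall>j\<in>?J - {i, m}. ?w j * ?p j = 0" by simp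
    qed (use im in auto)
    ultimately have sum: "?w i * ?p i + ?w m * ?p m = 0" using False by simp
    have "?p j \<noteq> 0" if "j \<in> {i, m}" for j
      using nat_ord_inj[of ?J F', OF F' inj] im that by (auto simp: prod_zero_iff)
    then have "?p i \<noteq> 0" "?p m \<noteq> 0" by blast+
    then show ?thesis using sum wi by auto
  qed
  note tnz = parameter_powi_nonzero[OF t]
  \<comment> \<open>All weights being nonzero, every product has order exactly \<mu>; a larger order
    of the function means a smaller one of its coefficient.\<close>
  have ord\<rho>: "\<rho>' j \<noteq> 0 \<and> ord (\<rho>' j) + ord (F' j) = \<mu>" if j: "j \<in> ?J" for j
  proof -
    have w: "?w j \<noteq> 0" using \<mu>(2) w_iff[OF _ j] by blast
    then have nz: "t powi (- \<mu>) * (\<rho>' j * F' j) \<noteq> 0" using v_zero by metis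
    then have "\<rho>' j \<noteq> 0" by auto
    moreover have "ord (t powi (- \<mu>) * (\<rho>' j * F' j)) = 0"
      using unit_iff_ord[OF nz] \<mu>(1)[OF j] w by (simp add: unit_def)
    ultimately show ?thesis
      using F'[OF j] tnz by (simp add: ord_mult ord_parameter_powi[OF t])
  qed
  have "Max ((\<lambda>j. ord (F' j)) ` ?J) \<in> (\<lambda>j. ord (F' j)) ` ?J" by (intro Max_in) auto
  then obtain m where m: "m \<in> ?J" "Max ((\<lambda>j. ord (F' j)) ` ?J) = ord (F' m)" by blast
  have m_max: "ord (F' j) \<le> ord (F' m)" if "j \<in> ?J" for j
    unfolding m(2)[symmetric] using that by (intro Max_ge) auto
  \<comment> \<open>The coefficient belonging to the largest order is regular, so every other
    coefficient has positive order.\<close>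
  have "v (\<rho>' j) = 0" if j: "j \<in> ?J" "j \<noteq> m" for j
  proof -
    have "ord (F' j) \<noteq> ord (F' m)" using j m(1) inj by (auto dest: inj_onD)
    then have "ord (F' j) < ord (F' m)" using m_max[OF j(1)] by simp
    moreover have "ord (\<rho>' m) \<ge> 0" using ord\<rho>[OF m(1)] \<rho>'[OF m(1)] in_iff_ord by blast
    ultimately have "ord (\<rho>' j) > 0" using ord\<rho>[OF j(1)] ord\<rho>[OF m(1)] by simp
    then show ?thesis using v_eq_0_iff_ord[of "\<rho>' j"] ord\<rho>[OF j(1)] \<rho>'[OF j(1)] by blast
  qed
  then have \<rho>m: "v (\<rho>' m) \<noteq> 0" and s: "(\<Sum>j\<in>?J. const (v (\<rho>' j)) * F' j) = const (v (\<rho>' m)) * F' m"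
    using \<rho>nz m(1) by (auto simp: sum.remove[of _ m])
  have "(\<Sum>j\<le>r. const (v (\<rho> j)) * F j) = const (v (\<rho>' m)) * F' m"
    using e s unfolding echelon_form_def by simp
  moreover have "ord (const (v (\<rho>' m)) * F' m) = ord (F' m)"
    using \<rho>m F'[OF m(1)] ord_unit[of "const (v (\<rho>' m))"] by (simp add: ord_mult unit_def)
  moreover obtain b' where b': "lincomb {..r} b F = lincomb {..r} b' F'"
    using e unfolding echelon_form_def by blast
  have "ord (lincomb ?J b' F') \<le> ord (F' m)"
    by (rule ord_combination_le) (use F' inj m_max nz b' in auto)
  ultimately show ?thesis unfolding b' by simp
qed

end

lemma const_independent_divide:
  assumes "const_independent J f" "g \<noteq> 0"
  shows "const_independent J (\<lambda>j. f j / g)"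
  unfolding const_independent_def
proof (intro allI impI)
  fix b assume "(\<Sum>j\<in>J. const (b j) * (f j / g)) = 0"
  moreover have "(\<Sum>j\<in>J. const (b j) * (f j / g)) = lincomb J b f / g"
    by (simp add: sum_divide_distrib)
  ultimately show "\<forall>j\<in>J. b j = 0"
    using assms unfolding const_independent_def by simp
qed

lemma const_independent_shift:
  assumes "const_independent {..r} f" shows "const_independent {..<r} (\<lambda>j. f (Suc j))"
  unfolding const_independent_def
proof (intro allI impI)
  fix b :: "nat \<Rightarrow> 'a" assume b: "(\<Sum>j<r. const (b j) * f (Suc j)) = 0"
  define b' where "b' = (\<lambda>j. case j of 0 \<Rightarrow> 0 | Suc j \<Rightarrow> b j)"
  have "lincomb {..r} b' f = const (b' 0) * f 0 + (\<Sum>j<r. const (b' (Suc j)) * f (Suc j))"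
    by (simp only: sum.atMost_shift)
  also have "\<dots> = 0" using b by (simp add: b'_def)
  finally have *: "\<forall>j\<in>{..r}. b' j = 0" using assms unfolding const_independent_def by blast
  show "\<forall>j\<in>{..<r}. b j = 0"
  proof
    fix j assume "j \<in> {..<r}"
    then show "b j = 0" using *[rule_format, of "Suc j"] by (simp add: b'_def)
  qed
qed

text \<open>If the determinant vanished, a nontrivial combination of its rows over the function
  field would be 0. This is a relation among r functions and their derivatives of order 0 to r - 1,
  excluded by \<open>no_full_relation\<close>.\<close>

lemma signed_wronskian_nonzero:
  assumes fr: "local_frame C D P \<tau> g"
    and f: "\<And>j. j \<le> r \<Longrightarrow> f j \<in> sections C D" "const_independent {..r} f"
  shows "signed_wronskians C r f 0 P \<tau> g \<noteq> 0"
proof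
  assume zero: "signed_wronskians C r f 0 P \<tau> g = 0"
  have \<tau>: "parameter \<tau>" and g: "local_generator C D P g" using fr by (auto simp: local_frame_def)
  let ?F = "\<lambda>j. f (Suc j) / g"
  let ?A = "mat r r (\<lambda>(j, k). (deriv_wrt C \<tau> ^^ k) (?F j))"
  have A: "?A \<in> carrier_mat r r" by simp
  have "det ?A = 0"
    using zero by (simp add: signed_wronskians_def wronskian_def omit_def)
  \<comment> \<open>Transposed so that the kernel vector combines the functions rather than the
    derivatives.\<close>
  then have "det (transpose_mat ?A) = 0" using det_transpose[OF A] by simp
  then obtain y where y: "y \<in> carrier_vec r" "y \<noteq> 0\<^sub>v r" "transpose_mat ?A *\<^sub>v y = 0\<^sub>v r"
    using det_0_iff_vec_prod_zero[of "transpose_mat ?A" r] A by auto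
  show False
  proof (rule no_full_relation[OF \<tau>, of "{..<r}" ?F "\<lambda>j. y $ j"])
    show "?F j \<in> \<O>" if "j \<in> {..<r}" for j
      using section_over_generator[OF f(1) g] that by auto
    show "const_independent {..<r} ?F"
      by (rule const_independent_divide[OF const_independent_shift[OF f(2)]]) (rule local_generator_ord(1)[OF g])
    show "\<exists>j\<in>{..<r}. y $ j \<noteq> 0"
      using y(1,2) by (metis carrier_vecD eq_vecI index_zero_vec lessThan_iff)
  next
    fix k assume k: "k < card {..<r}"
    then have "(transpose_mat ?A *\<^sub>v y) $ k = 0" using y(3) by simp
    then show "(\<Sum>j<r. y $ j * (deriv_wrt C \<tau> ^^ k) (?F j)) = 0"
      using k y(1) by (simp add: scalar_prod_def lessThan_atLeast0 mult.commute)
  qed simp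
qed

end

section \<open>Morphisms to projective space\<close>

context curve
begin

definition coord_values :: "nat \<Rightarrow> (nat \<Rightarrow> 'k) \<Rightarrow> 'a point \<Rightarrow> nat \<Rightarrow> 'a" where
  "coord_values r X P = (\<lambda>i. if i \<le> r then value_at C P (X i) else 0)"

definition primitive :: "nat \<Rightarrow> (nat \<Rightarrow> 'k) \<Rightarrow> 'a point \<Rightarrow> bool" where
  "primitive r X P \<longleftrightarrow> (\<forall>i\<le>r. X i \<in> local_ring C P) \<and> (\<exists>i\<le>r. value_at C P (X i) \<noteq> 0)"

text \<open>The point with rational coordinates W at P: a chosen factor removes poles and common
  zeros before evaluation. By \<open>extension_eq\<close> any such factor gives the same
  point.\<close>

definition extension :: "nat \<Rightarrow> (nat \<Rightarrow> 'k) \<Rightarrow> 'a point \<Rightarrow> 'a point" where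
  "extension r W P = proj_point (coord_values r (\<lambda>i. (SOME l. primitive r (\<lambda>i. l * W i) P) * W i) P)"

lemma curve_pointI: "P \<in> points C \<Longrightarrow> curve_point C P"
  by unfold_locales

text \<open>Some \<open>Y i\<close> is a unit, so l is regular; its value is nonzero, as otherwise
  all values of X would vanish. Evaluation then changes the vector by a nonzero scalar only.\<close>

lemma primitive_proportional:
  assumes P: "P \<in> points C" and X: "primitive r X P" and Y: "primitive r Y P"
    and eq: "\<And>i. i \<le> r \<Longrightarrow> X i = l * Y i"
  shows "proj_point (coord_values r X P) = proj_point (coord_values r Y P)"
proof -
  interpret curve_point C P by (rule curve_pointI[OF P])
  obtain i where i: "i \<le> r" "unit (Y i)" using Y by (auto simp: primitive_def unit_def)
  have "l = X i * inverse (Y i)" using eq[OF i(1)] unit_nonzero[OF i(2)] by simp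
  then have l: "l \<in> \<O>" using X i unit_in[OF unit_inverse[OF i(2)]] by (auto simp: primitive_def)
  obtain k where k: "k \<le> r" "v (X k) \<noteq> 0" using X by (auto simp: primitive_def)
  have vX: "v (X i) = v l * v (Y i)" if "i \<le> r" for i
    using eq[OF that] l Y that by (simp add: primitive_def)
  then have "v l \<noteq> 0" using k by auto
  moreover have "coord_values r X P = (\<lambda>i. v l * coord_values r Y P i)"
    by (rule ext) (simp add: coord_values_def vX)
  ultimately show ?thesis by (simp only: proj_point_scale not_False_eq_True)
qed

lemma primitive_exists:
  assumes "P \<in> points C" "\<exists>i\<le>r. W i \<noteq> 0"
  shows "\<exists>l. primitive r (\<lambda>i. l * W i) P"
proof -
  interpret curve_point C P by (rule curve_pointI[OF assms(1)])
  obtain t where t: "parameter t" using parameter_exists by blast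
  have W: "\<exists>i\<in>{..r}. W i \<noteq> 0" using assms(2) by auto
  obtain \<mu> where "\<And>i. i \<in> {..r} \<Longrightarrow> t powi (- \<mu>) * W i \<in> \<O>" "\<exists>i\<in>{..r}. v (t powi (- \<mu>) * W i) \<noteq> 0"
    by (rule normalize[OF t finite_atMost W]) (rule that)
  then show ?thesis unfolding primitive_def by (intro exI[of _ "t powi (- \<mu>)"]) auto
qed

lemma extension_eq:
  assumes P: "P \<in> points C" and l: "primitive r (\<lambda>i. l * W i) P"
  shows "extension r W P = proj_point (coord_values r (\<lambda>i. l * W i) P)"
proof -
  let ?m = "SOME l. primitive r (\<lambda>i. l * W i) P"
  have m: "primitive r (\<lambda>i. ?m * W i) P" using l by (rule someI)
  have "l \<noteq> 0"
  proof
    assume "l = 0"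
    interpret curve_point C P by (rule curve_pointI[OF P])
    show False using l \<open>l = 0\<close> by (simp add: primitive_def)
  qed
  then show ?thesis
    unfolding extension_def by (intro primitive_proportional[OF P m l, of "?m / l"]) simp
qed

lemma common_denominator:
  assumes P: "P \<in> points C" and X: "\<And>i. i \<le> (r::nat) \<Longrightarrow> X i \<in> local_ring C P"
  shows "\<exists>d B G. B \<in> forms dim d \<and> eval B (rep P) \<noteq> 0 \<and> (\<forall>i\<le>r. G i \<in> forms dim d \<and> X i = frac C (G i) B)"
proof -
  have "\<forall>i\<in>{..r}. \<exists>F B d. F \<in> forms dim d \<and> B \<in> forms dim d \<and> eval B (rep P) \<noteq> 0 \<and> X i = frac C F B"
    using in_local_ringE[OF P X] by (metis atMost_iff)
  then obtain F B d where FB: "\<And>i. i \<le> r \<Longrightarrow> F i \<in> forms dim (d i)" "\<And>i. i \<le> r \<Longrightarrow> B i \<in> forms dim (d i)"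
    "\<And>i. i \<le> r \<Longrightarrow> eval (B i) (rep P) \<noteq> 0" "\<And>i. i \<le> r \<Longrightarrow> X i = frac C (F i) (B i)"
    by (metis atMost_iff)
  let ?B = "\<Prod>i\<le>r. B i" and ?E = "\<lambda>i. \<Prod>l\<in>{..r} - {i}. B l"
  have B: "?B \<in> forms dim (\<Sum>i\<le>r. d i)" using FB(2) by (intro forms_prod) auto
  have B0: "eval ?B (rep P) \<noteq> 0" using FB(3) by (simp add: eval_prod)
  have "F i * ?E i \<in> forms dim (\<Sum>i\<le>r. d i) \<and> X i = frac C (F i * ?E i) ?B" if i: "i \<le> r" for i
  proof -
    have E: "?E i \<in> forms dim (\<Sum>l\<in>{..r} - {i}. d l)" using FB(2) by (intro forms_prod) auto
    have E0: "eval (?E i) (rep P) \<noteq> 0" using FB(3) by (simp add: eval_prod)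
    have Ef: "is_fraction C (?E i) (?E i)" by (rule in_local_ringI(3)[OF P E E E0])
    have Ff: "is_fraction C (F i) (B i)" by (rule in_local_ringI(3)[OF P FB(1,2,3)[OF i]])
    have Bi: "?B = B i * ?E i" using i by (simp add: prod.remove[of _ i])
    have "frac C (F i) (B i) * frac C (?E i) (?E i) = frac C (F i * ?E i) ?B"
      unfolding Bi by (rule frac_mult[OF Ff Ef])
    then have "X i = frac C (F i * ?E i) ?B"
      using frac_self[OF nonvanI[OF P E E0]] FB(4)[OF i] by simp
    moreover have "(\<Sum>l\<le>r. d l) = d i + (\<Sum>l\<in>{..r} - {i}. d l)" using i by (simp add: sum.remove[of _ i])
    ultimately show ?thesis using forms_mult[OF FB(1)[OF i] E] by simp
  qed
  then have all: "\<forall>i\<le>r. F i * ?E i \<in> forms dim (\<Sum>i\<le>r. d i) \<and> X i = frac C (F i * ?E i) ?B"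
    by blast
  show ?thesis
    by (rule exI[of _ "\<Sum>i\<le>r. d i"], rule exI[of _ ?B], rule exI[of _ "\<lambda>i. F i * ?E i"])
      (intro conjI B B0 all)
qed

text \<open>A factor l that works at P also works nearby: over a common denominator B the numerators
  are forms describing the map wherever B and one numerator \<open>G k\<close> do not
  vanish.\<close>

lemma extension_morphism:
  assumes W: "\<exists>i\<le>r. W i \<noteq> 0"
  shows "morphism_to_proj C r (extension r W)"
  unfolding morphism_to_proj_def
proof
  fix P assume P: "P \<in> points C"
  obtain l where l: "primitive r (\<lambda>i. l * W i) P" using primitive_exists[OF P W] by blast
  then obtain k where k: "k \<le> r" "value_at C P (l * W k) \<noteq> 0" by (auto simp: primitive_def)
  obtain d B G where B: "B \<in> forms dim d" "eval B (rep P) \<noteq> 0"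
    and G: "\<And>i. i \<le> r \<Longrightarrow> G i \<in> forms dim d \<and> l * W i = frac C (G i) B"
    using common_denominator[OF P, of r "\<lambda>i. l * W i"] l by (auto simp: primitive_def)
  let ?Z = "{Q \<in> proj_space dim. vanishes_at (B * G k) Q}"
  have BG: "B * G k \<in> forms dim (d + d)" using B(1) G[OF k(1)] by (auto intro: forms_mult)
  have Z: "algebraic_set dim ?Z"
    unfolding algebraic_set_def using BG by (intro exI[of _ "{B * G k}"]) auto
  have "eval (G k) (rep P) \<noteq> 0"
    using k(2) in_local_ringI(2)[OF P _ B(1,2), of "G k"] G[OF k(1)] by auto
  then have PZ: "P \<notin> ?Z"
    using vanishes_iff[OF P BG] B(2) by (simp add: eval_mult)
  have "(\<exists>i\<le>r. \<not> vanishes_at (G i) Q) \<and> (\<forall>v\<in>Q. v \<noteq> (\<lambda>_. 0) \<longrightarrow>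
      extension r W Q = proj_point (\<lambda>i. if i \<le> r then eval (G i) v else 0))" if Q: "Q \<in> points C - ?Z" for Q
  proof -
    have QC: "Q \<in> points C" and nz: "eval B (rep Q) \<noteq> 0" "eval (G k) (rep Q) \<noteq> 0"
      using Q vanishes_iff[OF _ BG, of Q] points_proj by (auto simp: eval_mult)
    have val: "l * W i \<in> local_ring C Q" "value_at C Q (l * W i) = eval (G i) (rep Q) / eval B (rep Q)" if "i \<le> r" for i
      using in_local_ringI[OF QC _ B(1) nz(1), of "G i"] G[OF that] by auto
    have prim: "primitive r (\<lambda>i. l * W i) Q"
      unfolding primitive_def using val k(1) nz by auto
    have "extension r W Q = proj_point (\<lambda>i. if i \<le> r then eval (G i) w else 0)" if w: "w \<in> Q" "w \<noteq> (\<lambda>_. 0)" for w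
    proof -
      obtain c where c: "w = (\<lambda>i. c * rep Q i)" using in_proj_pointE[OF points_proj[OF QC] w(1)] by blast
      have "c \<noteq> 0" using c w(2) by auto
      define e where "e = c ^ d * eval B (rep Q)"
      have "e \<noteq> 0" using \<open>c \<noteq> 0\<close> nz(1) by (simp add: e_def)
      have "eval (G i) w = e * value_at C Q (l * W i)" if "i \<le> r" for i
        unfolding c using homogeneous_eval_scale[of d "G i" c "rep Q"] G[OF that] val(2)[OF that] nz(1)
        by (simp add: forms_def e_def)
      then have "(\<lambda>i. if i \<le> r then eval (G i) w else 0) = (\<lambda>i. e * coord_values r (\<lambda>i. l * W i) Q i)"
        by (auto simp: coord_values_def)
      then have "proj_point (\<lambda>i. if i \<le> r then eval (G i) w else 0) = proj_point (coord_values r (\<lambda>i. l * W i) Q)"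
        using proj_point_scale[OF \<open>e \<noteq> 0\<close>] by simp
      then show ?thesis using extension_eq[OF QC prim] by simp
    qed
    moreover have "\<not> vanishes_at (G k) Q" using vanishes_iff[OF QC, of "G k" d] G[OF k(1)] nz(2) by simp
    ultimately show ?thesis using k(1) by blast
  qed
  then show "\<exists>Z d G. algebraic_set dim Z \<and> P \<notin> Z \<and> (\<forall>i\<le>r. G i \<in> forms dim d) \<and>
      (\<forall>Q\<in>points C - Z. (\<exists>i\<le>r. \<not> vanishes_at (G i) Q) \<and> (\<forall>v\<in>Q. v \<noteq> (\<lambda>_. 0) \<longrightarrow>
        extension r W Q = proj_point (\<lambda>i. if i \<le> r then eval (G i) v else 0)))"
    using Z PZ G by (intro exI[of _ ?Z] exI[of _ d] exI[of _ G]) blast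
qed

lemma morphism_localE:
  assumes "morphism_to_proj C r \<phi>" "P \<in> points C"
  obtains Z d G where "algebraic_set dim Z" "P \<notin> Z" "\<And>i. i \<le> r \<Longrightarrow> G i \<in> forms dim d"
    "\<And>Q. Q \<in> points C - Z \<Longrightarrow> (\<exists>i\<le>r. \<not> vanishes_at (G i) Q) \<and> (\<forall>v\<in>Q. v \<noteq> (\<lambda>_. 0) \<longrightarrow>
        \<phi> Q = proj_point (\<lambda>i. if i \<le> r then eval (G i) v else 0))"
proof -
  from bspec[OF assms(1)[unfolded morphism_to_proj_def] assms(2)]
  show thesis
  proof (elim exE conjE)
    fix Z d G
    assume *: "algebraic_set dim Z" "P \<notin> Z" "\<forall>i\<le>r. G i \<in> forms dim d"
      "\<forall>Q\<in>points C - Z. (\<exists>i\<le>r. \<not> vanishes_at (G i) Q) \<and> (\<forall>v\<in>Q. v \<noteq> (\<lambda>_. 0) \<longrightarrow>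
        \<phi> Q = proj_point (\<lambda>i. if i \<le> r then eval (G i) v else 0))"
    show thesis
      by (rule that[OF *(1,2) *(3)[rule_format] bspec[OF *(4)]])
  qed
qed

lemma morphisms_agree:
  assumes \<phi>: "morphism_to_proj C r \<phi>" and \<psi>: "morphism_to_proj C r \<psi>"
    and gen: "generic (\<lambda>Q. \<phi> Q = \<psi> Q)" and P: "P \<in> points C"
  shows "\<phi> P = \<psi> P"
proof -
  obtain Z d G where Z: "algebraic_set dim Z" "P \<notin> Z" "\<And>i. i \<le> r \<Longrightarrow> G i \<in> forms dim d"
    "\<And>Q. Q \<in> points C - Z \<Longrightarrow> (\<exists>i\<le>r. \<not> vanishes_at (G i) Q) \<and> (\<forall>v\<in>Q. v \<noteq> (\<lambda>_. 0) \<longrightarrow>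
        \<phi> Q = proj_point (\<lambda>i. if i \<le> r then eval (G i) v else 0))"
    by (rule morphism_localE[OF \<phi> P]) (rule that)
  obtain Z' d' G' where Z': "algebraic_set dim Z'" "P \<notin> Z'" "\<And>i. i \<le> r \<Longrightarrow> G' i \<in> forms dim d'"
    "\<And>Q. Q \<in> points C - Z' \<Longrightarrow> (\<exists>i\<le>r. \<not> vanishes_at (G' i) Q) \<and> (\<forall>v\<in>Q. v \<noteq> (\<lambda>_. 0) \<longrightarrow>
        \<psi> Q = proj_point (\<lambda>i. if i \<le> r then eval (G' i) v else 0))"
    by (rule morphism_localE[OF \<psi> P]) (rule that)
  define x where "x Q = (\<lambda>i. if i \<le> r then eval (G i) (rep Q) else 0)" for Q
  define x' where "x' Q = (\<lambda>i. if i \<le> r then eval (G' i) (rep Q) else 0)" for Q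
  have x: "\<phi> Q = proj_point (x Q)" "\<exists>i. x Q i \<noteq> 0" if "Q \<in> points C" "Q \<notin> Z" for Q
  proof -
    have Q: "Q \<in> points C - Z" using that by simp
    show "\<phi> Q = proj_point (x Q)"
      unfolding x_def
      by (rule conjunct2[OF Z(4)[OF Q], rule_format]) (rule proj_pointE[OF points_proj[OF that(1)]])+
    from conjunct1[OF Z(4)[OF Q]] obtain i where "i \<le> r" "\<not> vanishes_at (G i) Q" by blast
    then show "\<exists>i. x Q i \<noteq> 0"
      using vanishes_iff[OF that(1) Z(3)] by (auto simp: x_def)
  qed
  have x': "\<psi> Q = proj_point (x' Q)" "\<exists>i. x' Q i \<noteq> 0" if "Q \<in> points C" "Q \<notin> Z'" for Q
  proof -
    have Q: "Q \<in> points C - Z'" using that by simp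
    show "\<psi> Q = proj_point (x' Q)"
      unfolding x'_def
      by (rule conjunct2[OF Z'(4)[OF Q], rule_format]) (rule proj_pointE[OF points_proj[OF that(1)]])+
    from conjunct1[OF Z'(4)[OF Q]] obtain i where "i \<le> r" "\<not> vanishes_at (G' i) Q" by blast
    then show "\<exists>i. x' Q i \<noteq> 0"
      using vanishes_iff[OF that(1) Z'(3)] by (auto simp: x'_def)
  qed
  have off: "generic (\<lambda>Q. \<phi> Q = \<psi> Q \<and> Q \<notin> Z \<and> Q \<notin> Z')"
    by (rule generic_conj[OF gen generic_conj[OF generic_off_algebraic[OF Z(1) P Z(2)]
      generic_off_algebraic[OF Z'(1) P Z'(2)]]])
  have minors: "generic (\<lambda>Q. \<forall>i j. x Q i * x' Q j = x Q j * x' Q i)"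
  proof (rule generic_mono[OF off])
    fix Q assume Q: "Q \<in> points C" "\<phi> Q = \<psi> Q \<and> Q \<notin> Z \<and> Q \<notin> Z'"
    then have "x Q \<in> proj_point (x' Q)" using x(1) x'(1) proj_point_self by metis
    then obtain c where "x Q = (\<lambda>i. c * x' Q i)" by (auto simp: proj_point_def)
    then show "\<forall>i j. x Q i * x' Q j = x Q j * x' Q i" by (simp add: mult_ac)
  qed
  have "x P i * x' P j = x P j * x' P i" for i j
  proof (cases "i \<le> r \<and> j \<le> r")
    case True
    let ?M = "G i * G' j - G j * G' i"
    have M: "?M \<in> forms dim (d + d')"
      using Z(3) Z'(3) True by (intro forms_diff forms_mult) auto
    have ev: "eval ?M (rep Q) = x Q i * x' Q j - x Q j * x' Q i" for Q
      using True by (simp add: eval_diff eval_mult x_def x'_def)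
    have "generic (vanishes_at ?M)"
      by (rule generic_mono[OF minors]) (use vanishes_iff[OF _ M] ev in simp)
    then have "vanishes_at ?M P"
      by (rule vanishes_of_generic[OF M _ P])
    then show ?thesis using vanishes_iff[OF P M] ev[of P] by simp
  qed (auto simp: x_def x'_def)
  then show ?thesis
    using x[OF P Z(2)] x'[OF P Z'(2)] proj_point_eq_iff_minors by metis
qed

subsection \<open>Generic behaviour of functions\<close>

lemma generic_unit:
  assumes "f \<noteq> 0" shows "generic (\<lambda>Q. f \<in> local_ring C Q \<and> value_at C Q f \<noteq> 0)"
proof -
  obtain F G where FG: "is_fraction C F G" "f = frac C F G" by (rule frac_surj)
  obtain d where d: "F \<in> forms dim d" "G \<in> forms dim d" "nonvan G" using FG(1) by (rule is_fractionE)
  have "nonvan F" using assms frac_eq_0_iff[OF FG(1)] FG(2) d(1) by (auto simp: nonvan_def)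
  then have "generic (\<lambda>Q. \<not> vanishes_at F Q \<and> \<not> vanishes_at G Q)"
    using d(3) by (intro generic_conj generic_nonvan)
  then show ?thesis
  proof (rule generic_mono)
    fix Q assume Q: "Q \<in> points C" "\<not> vanishes_at F Q \<and> \<not> vanishes_at G Q"
    then have nz: "eval F (rep Q) \<noteq> 0" "eval G (rep Q) \<noteq> 0"
      using vanishes_iff[OF Q(1) d(1)] vanishes_iff[OF Q(1) d(2)] by auto
    show "f \<in> local_ring C Q \<and> value_at C Q f \<noteq> 0"
      using in_local_ringI(1,2)[OF Q(1) d(1,2) nz(2)] nz FG(2) by simp
  qed
qed

text \<open>On a single point the numerator of a parameter would vanish everywhere, and the
  parameter would be 0.\<close>

lemma another_point: assumes P: "P \<in> points C" shows "\<exists>Q\<in>points C. Q \<noteq> P"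
proof (rule ccontr)
  assume only: "\<not> ?thesis"
  interpret curve_point C P by (rule curve_pointI[OF P])
  obtain t where t: "parameter t" "t \<noteq> 0" using parameter_exists by blast
  obtain F G d where F: "F \<in> forms dim d" "G \<in> forms dim d" "eval G (rep P) \<noteq> 0" "t = frac C F G" "is_fraction C F G"
    using in_local_ringE[OF P parameter_in(1)[OF t(1)]] by blast
  have "eval F (rep P) = 0"
    using in_local_ringI(2)[OF P F(1-3)] parameter_in(2)[OF t(1)] F(3,4) by simp
  then have "vanishes_at F P" using vanishes_iff[OF P F(1)] by simp
  then have "t = 0" using frac_eq_0_iff[OF F(5)] F(4) only by auto
  then show False using t(2) by simp
qed

text \<open>A nonzero minor of P and another point R gives a linear form that vanishes at P but not
  at R.\<close>

lemma generic_distinct: assumes P: "P \<in> points C" shows "generic (\<lambda>Q. Q \<noteq> P)"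
proof -
  obtain R where R: "R \<in> points C" "R \<noteq> P" using another_point[OF P] by blast
  let ?a = "rep P" and ?b = "rep R"
  have "\<exists>i j. ?a i * ?b j \<noteq> ?a j * ?b i"
    using proj_point_eq_iff_minors[of ?a ?b] proj_pointE(3,5)[OF points_proj[OF P]]
      proj_pointE(3,5)[OF points_proj[OF R(1)]] R(2) by metis
  then obtain i j where ij: "?a i * ?b j \<noteq> ?a j * ?b i" by blast
  have le: "i \<le> dim" "j \<le> dim"
    using ij proj_pointE(4)[OF points_proj[OF P]] proj_pointE(4)[OF points_proj[OF R(1)]]
    by (metis mult_zero_left mult_zero_right not_le)+
  let ?L = "single 0 (?a i) * var j - single 0 (?a j) * var i"
  have L: "?L \<in> forms dim 1"
    using forms_mult[OF forms_const forms_var[OF le(1)]] forms_mult[OF forms_const forms_var[OF le(2)]]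
    by (intro forms_diff) auto
  have ev: "eval ?L y = ?a i * y j - ?a j * y i" for y
    by (simp add: eval_diff eval_mult)
  have "nonvan ?L"
    by (rule nonvanI[OF R(1) L], unfold ev) (use ij in simp)
  moreover have "vanishes_at ?L P" unfolding vanishes_iff[OF P L] ev by (simp add: mult.commute)
  ultimately show ?thesis
    using generic_mono[OF generic_nonvan, of ?L "\<lambda>Q. Q \<noteq> P"] by blast
qed

lemma generic_off_divisor:
  assumes "divisor C D" shows "generic (\<lambda>Q. D Q = 0)"
proof -
  have "generic (\<lambda>Q. \<forall>P\<in>{P. D P \<noteq> 0}. Q \<noteq> P)"
    using assms by (intro generic_Ball generic_distinct) (auto simp: divisor_def)
  then show ?thesis by (rule generic_mono) auto
qed

end

context curve_point
begin

text \<open>Write a parameter t as a combination of the centered coordinates, divide by t and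
  evaluate at P: one quotient has nonzero value, so that coordinate is a parameter too.\<close>

lemma affine_parameter:
  assumes j: "j \<le> dim" "rep P j \<noteq> 0"
  shows "\<exists>i\<le>dim. parameter (centered j i)"
proof -
  obtain t where t: "parameter t" "t \<noteq> 0" using parameter_exists by blast
  have "t \<in> \<mm>" using parameter_in[OF t(1)] by (simp add: max_ideal_iff)
  then obtain b where b: "\<And>i. b i \<in> \<O>" "t = (\<Sum>i\<le>dim. b i * centered j i)"
    using centered_generate[OF j] by blast
  have g: "centered j i / t \<in> \<O>" if "i \<le> dim" for i
    using parameter_divides[OF t(1)] centered_in[OF j that] by (simp add: max_ideal_iff)
  have "1 = (\<Sum>i\<le>dim. b i * (centered j i / t))"
    using t(2) b(2) by (simp add: sum_divide_distrib[symmetric])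
  then have "v 1 = v (\<Sum>i\<le>dim. b i * (centered j i / t))" by simp
  also have "\<dots> = (\<Sum>i\<le>dim. v (b i * (centered j i / t)))"
    by (rule v_sum) (rule mult_in[OF b(1) g], simp)
  also have "\<dots> = (\<Sum>i\<le>dim. v (b i) * v (centered j i / t))"
    by (intro sum.cong refl v_mult b(1) g) simp
  finally have "(\<Sum>i\<le>dim. v (b i) * v (centered j i / t)) \<noteq> 0" by simp
  then obtain i where i: "i \<le> dim" "v (centered j i / t) \<noteq> 0"
    by (metis (no_types, lifting) atMost_iff mult_zero_right sum.neutral)
  then have "unit (centered j i / t)" using g by (simp add: unit_def)
  from parameter_mult_unit[OF t(1) this] have "parameter (centered j i)" using t(2) by simp
  then show ?thesis using i(1) by blast
qed

end

section \<open>The morphism defined by the Wronskians\<close>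

context curve
begin

text \<open>The functions y and y - a have the same differential.\<close>

lemma deriv_wrt_shift:
  assumes y: "y \<notin> range (const)" and s: "y - const a \<notin> range (const)"
  shows "deriv_wrt C (y - const a) g = deriv_wrt C y g"
proof -
  have "deriv_wrt C (y - const a) y = deriv_wrt C (y - const a) ((y - const a) + const a)"
    by simp
  also have "\<dots> = 1"
    unfolding deriv_add[OF s] deriv_self[OF s] deriv_const[OF s] by simp
  finally show ?thesis using deriv_chain[OF y s, of g] by simp
qed

text \<open>The affine coordinates of the curve provide local parameters everywhere on an affine chart,
  so that only finitely many functions have to be inverted.\<close>

lemma signed_wronskians_generic:
  assumes D: "divisor C D" and f: "\<And>j. j \<le> r \<Longrightarrow> f j \<in> sections C D" "const_independent {..r} f"
  shows "generic (\<lambda>Q. \<exists>\<tau> g. local_frame C D Q \<tau> g \<and>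
    section_values C r (signed_wronskians C r f) Q \<tau> g \<noteq> (\<lambda>_. 0))"
proof -
  obtain P where P: "P \<in> points C" using points_nonempty by blast
  interpret P: curve_point C P by (rule curve_pointI[OF P])
  obtain \<tau>0 g0 where fr0: "local_frame C D P \<tau>0 g0" using P.frame_exists by blast
  obtain j where j: "j \<le> dim" "rep P j \<noteq> 0" using P.coordinate_exists by blast
  define W where "W = signed_wronskians C r f 0 P \<tau>0 g0"
  have W: "W \<noteq> 0" unfolding W_def by (rule P.signed_wronskian_nonzero[OF fr0 f])
  have g0: "g0 \<noteq> 0" using local_frame_nonzero[OF fr0] .
  have \<tau>0: "\<tau>0 \<notin> range (const)" using local_frame_nonconst[OF fr0] .
  define y where "y i = frac C (var i) (var j)" for i
  let ?I = "{i. i \<le> dim \<and> y i \<notin> range (const)}"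
  let ?u = "\<lambda>h Q. h \<in> local_ring C Q \<and> value_at C Q h \<noteq> 0"
  have e: "deriv_wrt C \<tau>0 (y i) \<noteq> 0" if "i \<in> ?I" for i
    using deriv_inverse_pair[OF \<tau>0, of "y i"] that by auto
  have "generic (\<lambda>Q. \<forall>i\<in>?I. ?u (deriv_wrt C \<tau>0 (y i)) Q)"
    by (rule generic_Ball) (use e generic_unit in auto)
  from generic_conj[OF this generic_conj[OF generic_unit[OF W] generic_conj[OF generic_unit[OF g0]
    generic_conj[OF generic_nonvan[OF P.var_nonvan[OF j]] generic_off_divisor[OF D]]]]]
  show ?thesis
  proof (rule generic_mono)
    fix Q assume Q: "Q \<in> points C" and *: "(\<forall>i\<in>?I. ?u (deriv_wrt C \<tau>0 (y i)) Q) \<and> ?u W Q \<and> ?u g0 Q \<and>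
        \<not> vanishes_at (var j) Q \<and> D Q = 0"
    interpret Q: curve_point C Q by (rule curve_pointI[OF Q])
    have jQ: "rep Q j \<noteq> 0"
      using * vanishes_iff[OF Q forms_var[OF j(1)]] by simp
    obtain i where i: "i \<le> dim" "local_parameter C Q (Q.centered j i)"
      using Q.affine_parameter[OF j(1) jQ] by blast
    define \<tau> where "\<tau> = Q.centered j i"
    have \<tau>: "local_parameter C Q \<tau>" using i(2) by (simp add: \<tau>_def)
    obtain a where a: "\<tau> = y i - const a"
      by (simp add: \<tau>_def Q.centered_def Q.affine_def y_def)
    have \<tau>nc: "\<tau> \<notin> range (const)" by (rule Q.parameter_transcendental[OF \<tau>])
    have ync: "y i \<notin> range (const)"
    proof
      assume "y i \<in> range (const)"
      then obtain b where "y i = const b" by auto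
      then have "\<tau> = const (b - a)" by (simp add: a const.hom_minus)
      then show False using \<tau>nc by auto
    qed
    \<comment> \<open>The parameter \<tau> depends on Q only through an additive constant and the
      index i, so this derivative is inverse to one of the functions made units above.\<close>
    have "deriv_wrt C \<tau> \<tau>0 = deriv_wrt C (y i) \<tau>0"
      using deriv_wrt_shift[OF ync] \<tau>nc unfolding a by blast
    also have "\<dots> = inverse (deriv_wrt C \<tau>0 (y i))"
      using deriv_inverse_pair[OF \<tau>0 ync] by (metis inverse_unique)
    finally have d: "deriv_wrt C \<tau> \<tau>0 = inverse (deriv_wrt C \<tau>0 (y i))" .
    have "Q.unit (deriv_wrt C \<tau>0 (y i))" using * i(1) ync by (simp add: Q.unit_def)
    then have du: "Q.unit (deriv_wrt C \<tau> \<tau>0)" unfolding d by (rule Q.unit_inverse)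
    \<comment> \<open>Away from the support of D the constant 1 generates the stalk.\<close>
    have gen: "local_generator C D Q 1"
      by (rule Q.local_generatorI) (use * Q.ord_unit[OF Q.unit_one] in auto)
    have fr: "local_frame C D Q \<tau> 1" using Q \<tau> gen by (simp add: local_frame_def)
    have "signed_wronskians C r f 0 Q \<tau> 1 = W * g0 ^ r * deriv_wrt C \<tau> \<tau>0 ^ (r * (r - 1) div 2)"
      using signed_wronskians_change_frame[OF fr fr0, of r f 0] by (simp add: W_def)
    moreover have "Q.unit (W * g0 ^ r * deriv_wrt C \<tau> \<tau>0 ^ (r * (r - 1) div 2))"
      using * du by (intro Q.unit_mult Q.unit_power) (auto simp: Q.unit_def)
    ultimately have "value_at C Q (signed_wronskians C r f 0 Q \<tau> 1) \<noteq> 0"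
      by (simp add: Q.unit_def)
    then have "section_values C r (signed_wronskians C r f) Q \<tau> 1 0 \<noteq> 0"
      by (simp add: section_values_def)
    then have "section_values C r (signed_wronskians C r f) Q \<tau> 1 \<noteq> (\<lambda>_. 0)" by metis
    then show "\<exists>\<tau> g. local_frame C D Q \<tau> g \<and>
        section_values C r (signed_wronskians C r f) Q \<tau> g \<noteq> (\<lambda>_. 0)"
      using fr by blast
  qed
qed

lemma signed_wronskians_proportional:
  assumes "local_frame C D P \<tau> g" "local_frame C D P' \<tau>' g'"
  obtains l where "l \<noteq> 0" "\<And>i. signed_wronskians C r f i P \<tau> g = l * signed_wronskians C r f i P' \<tau>' g'"
proof -
  note nz = local_frame_nonzero[OF assms(1)] local_frame_nonzero[OF assms(2)]
  note nc = local_frame_nonconst[OF assms(1)] local_frame_nonconst[OF assms(2)]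
  let ?l = "g' ^ r * deriv_wrt C \<tau> \<tau>' ^ (r * (r - 1) div 2) / g ^ r"
  have "deriv_wrt C \<tau> \<tau>' \<noteq> 0" using deriv_inverse_pair[OF nc] by auto
  then have "?l \<noteq> 0" using nz by simp
  moreover have "signed_wronskians C r f i P \<tau> g = ?l * signed_wronskians C r f i P' \<tau>' g'" for i
    using signed_wronskians_change_frame[OF assms, of r f i] nz by (simp add: field_simps)
  ultimately show thesis by (rule that)
qed

section \<open>The Wronskian morphism and the reduced map\<close>

context
  fixes D r f
  assumes D: "divisor C D" and f: "\<And>j. j \<le> r \<Longrightarrow> f j \<in> sections C D" "const_independent {..r} f"
begin

abbreviation "\<sigma> \<equiv> signed_wronskians C r f"
abbreviation "\<Phi> P \<tau> g \<equiv> extension r (\<lambda>i. \<sigma> i P \<tau> g)"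

text \<open>A change of frame multiplies all Wronskians by one factor; when their values in the
  frame at P are not all 0, this factor is an admissible choice in \<open>extension\<close>.\<close>

lemma section_values_extension:
  assumes fr0: "local_frame C D P0 \<tau>0 g0" and fr: "local_frame C D P \<tau> g"
    and nz: "section_values C r \<sigma> P \<tau> g \<noteq> (\<lambda>_. 0)"
  shows "\<Phi> P0 \<tau>0 g0 P = proj_point (section_values C r \<sigma> P \<tau> g)"
proof -
  have P: "P \<in> points C" using fr by (simp add: local_frame_def)
  interpret curve_point C P by (rule curve_pointI[OF P])
  obtain l where l: "\<And>i. \<sigma> i P \<tau> g = l * \<sigma> i P0 \<tau>0 g0"
    using signed_wronskians_proportional[OF fr fr0, of r f] by blast
  have reg: "\<sigma> i P \<tau> g \<in> \<O>" for i
    by (rule signed_wronskians_regular)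
      (use fr section_over_generator f(1) in \<open>auto simp: local_frame_def\<close>)
  have "\<exists>i\<le>r. v (\<sigma> i P \<tau> g) \<noteq> 0"
    using nz by (auto simp: section_values_def fun_eq_iff split: if_splits)
  then have "primitive r (\<lambda>i. \<sigma> i P \<tau> g) P"
    using reg by (simp add: primitive_def)
  from extension_eq[OF P this[unfolded l]]
  show ?thesis unfolding section_values_def coord_values_def l .
qed

lemma extension_is_morphism_of_sections:
  assumes fr0: "local_frame C D P0 \<tau>0 g0"
  shows "morphism_of_sections C D r (r * (r - 1) div 2) r \<sigma>
    (\<Phi> P0 \<tau>0 g0)"
proof -
  have P: "P0 \<in> points C" using fr0 by (simp add: local_frame_def)
  interpret curve_point C P0 by (rule curve_pointI[OF P])
  have nz: "\<exists>i\<le>r. \<sigma> i P0 \<tau>0 g0 \<noteq> 0"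
    using signed_wronskian_nonzero[OF fr0 f] by (intro exI[of _ 0]) simp
  show ?thesis
    unfolding morphism_of_sections_def
  proof (intro conjI allI impI)
    show "global_section C D r (r * (r - 1) div 2) (\<sigma> i)" for i
      by (rule signed_wronskians_global[OF f(1)])
    show "morphism_to_proj C r (\<Phi> P0 \<tau>0 g0)"
      by (rule extension_morphism[OF nz])
    show "\<exists>P \<tau> g. local_frame C D P \<tau> g \<and> section_values C r \<sigma> P \<tau> g \<noteq> (\<lambda>_. 0)"
      using generic_ex[OF signed_wronskians_generic[OF D f]] by blast
    show "\<Phi> P0 \<tau>0 g0 P =
        proj_point (section_values C r \<sigma> P \<tau> g)"
      if "local_frame C D P \<tau> g \<and> section_values C r \<sigma> P \<tau> g \<noteq> (\<lambda>_. 0)" for P \<tau> g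
      using section_values_extension[OF fr0] that by simp
  qed
qed

lemma morphism_of_sections_unique:
  assumes fr0: "local_frame C D P0 \<tau>0 g0"
    and \<phi>: "morphism_of_sections C D r (r * (r - 1) div 2) r \<sigma> \<phi>"
    and P: "P \<in> points C"
  shows "\<phi> P = \<Phi> P0 \<tau>0 g0 P"
proof (rule morphisms_agree[OF _ _ _ P])
  show "morphism_to_proj C r \<phi>" using \<phi> by (simp add: morphism_of_sections_def)
  show "morphism_to_proj C r (\<Phi> P0 \<tau>0 g0)"
    using extension_is_morphism_of_sections[OF fr0] by (simp add: morphism_of_sections_def)
  show "generic (\<lambda>Q. \<phi> Q = \<Phi> P0 \<tau>0 g0 Q)"
  proof (rule generic_mono[OF signed_wronskians_generic[OF D f]])
    fix Q assume "\<exists>\<tau> g. local_frame C D Q \<tau> g \<and> section_values C r \<sigma> Q \<tau> g \<noteq> (\<lambda>_. 0)"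
    then obtain \<tau> g where Q: "local_frame C D Q \<tau> g" "section_values C r \<sigma> Q \<tau> g \<noteq> (\<lambda>_. 0)"
      by blast
    have "\<phi> Q = proj_point (section_values C r \<sigma> Q \<tau> g)"
      using \<phi> Q unfolding morphism_of_sections_def by blast
    then show "\<phi> Q = \<Phi> P0 \<tau>0 g0 Q"
      using section_values_extension[OF fr0 Q] by simp
  qed
qed

text \<open>The frame at P itself is used. Multiplying all Wronskians by l keeps the relations,
  since these do not differentiate them, and dividing sections by g shifts every order
  equally.\<close>

lemma extension_maximal_order:
  assumes P: "P \<in> points C" and fr: "local_frame C D P \<tau> g"
  shows "\<exists>x. (\<exists>i\<le>r. x i \<noteq> 0) \<and> (\<forall>i>r. x i = 0) \<and>
    \<Phi> P \<tau> g P = proj_point x \<and>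
    (\<forall>b. lincomb {..r} b f \<noteq> 0 \<longrightarrow>
      ord_at C P (lincomb {..r} b f) \<le> ord_at C P (lincomb {..r} x f))"
proof -
  interpret curve_point C P by (rule curve_pointI[OF P])
  let ?W = "\<lambda>i. \<sigma> i P \<tau> g"
  have \<tau>: "parameter \<tau>" and g: "local_generator C D P g" using fr by (auto simp: local_frame_def)
  have gnz: "g \<noteq> 0" by (rule local_generator_ord(1)[OF g])
  have "\<exists>i\<le>r. ?W i \<noteq> 0"
    using signed_wronskian_nonzero[OF fr f] by (intro exI[of _ 0]) simp
  then have "\<exists>l. primitive r (\<lambda>i. l * ?W i) P" by (rule primitive_exists[OF P])
  then obtain l where l: "primitive r (\<lambda>i. l * ?W i) P" ..
  define x where "x = coord_values r (\<lambda>i. l * ?W i) P"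
  have xi: "x i = v (l * ?W i)" if "i \<le> r" for i using that by (simp add: x_def coord_values_def)
  have x: "\<exists>i\<le>r. x i \<noteq> 0" using l xi by (auto simp: primitive_def)
  have x_sum: "lincomb {..r} x h = (\<Sum>j\<le>r. const (v (l * ?W j)) * h j)" for h
    by (intro sum.cong refl) (simp add: xi)
  have div: "(\<Sum>j\<le>r. const (b j) * (f j / g)) = lincomb {..r} b f / g" for b
    by (simp add: sum_divide_distrib)
  have max: "ord (lincomb {..r} b f) \<le> ord (lincomb {..r} x f)"
    if b: "lincomb {..r} b f \<noteq> 0" for b
  proof -
    have "ord (\<Sum>j\<le>r. const (b j) * (f j / g)) \<le> ord (\<Sum>j\<le>r. const (v (l * ?W j)) * (f j / g))"
    proof (rule solution_has_maximal_order[OF \<tau>])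
      show "f j / g \<in> \<O>" if "j \<le> r" for j using section_over_generator[OF f(1)[OF that] g] .
      show "const_independent {..r} (\<lambda>j. f j / g)" by (rule const_independent_divide[OF f(2) gnz])
      show "l * ?W j \<in> \<O>" if "j \<le> r" for j using l that by (simp add: primitive_def)
      show "\<exists>j\<le>r. v (l * ?W j) \<noteq> 0" using l by (simp add: primitive_def)
      show "(\<Sum>j\<le>r. l * ?W j * (deriv_wrt C \<tau> ^^ k) (f j / g)) = 0" if "k < r" for k
        using signed_wronskians_relation[OF that, of f P \<tau> g]
        by (simp add: mult.assoc flip: sum_distrib_left)
      show "(\<Sum>j\<le>r. const (b j) * (f j / g)) \<noteq> 0" unfolding div using b gnz by simp
    qed
    then have *: "ord (lincomb {..r} b f / g) \<le> ord (lincomb {..r} x f / g)"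
      unfolding x_sum[symmetric] div .
    have "lincomb {..r} x f \<noteq> 0"
      using f(2) x unfolding const_independent_def by auto
    with * show ?thesis using b gnz by (simp add: ord_divide)
  qed
  show ?thesis
  proof (intro exI[of _ x] conjI allI impI x max)
    show "x i = 0" if "r < i" for i using that by (simp add: x_def coord_values_def)
    show "extension r ?W P = proj_point x" unfolding x_def by (rule extension_eq[OF P l])
  qed
qed

text \<open>A section of maximal order at \<open>P\<close> is unique up to scalars, since of two such sections a
  non-trivial combination has larger order.\<close>

lemma reduced_map_eq:
  assumes P: "P \<in> points C"
    and span: "\<And>h. h \<in> sections C D \<longleftrightarrow> (\<exists>b. h = lincomb {..r} b f)"
    and x: "\<exists>i\<le>r. x i \<noteq> 0"
    and max: "\<And>b. lincomb {..r} b f \<noteq> 0 \<Longrightarrow>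
      ord_at C P (lincomb {..r} b f) \<le> ord_at C P (lincomb {..r} x f)"
  shows "reduced_map C D P = line_of_coords C r f (proj_point x)"
proof -
  interpret curve_point C P by (rule curve_pointI[OF P])
  define s where "s = lincomb {..r} x f"
  have s: "s \<in> sections C D" using span s_def by blast
  have snz: "s \<noteq> 0" using f(2) x unfolding const_independent_def s_def by auto
  have max': "ord h \<le> ord s" if "h \<in> sections C D" "h \<noteq> 0" for h
    using span max that s_def by auto
  have at_P: "add_div C D h P = D P + ord h" for h using P by (simp add: add_div_def)
  have line: "line_of_coords C r f (proj_point x) = fun_line C s"
  proof -
    have "(\<Sum>j\<le>r. scale_fun C (c * x j) (f j)) = scale_fun C c s" for c
      by (simp add: scale_fun_def s_def const.hom_mult sum_distrib_left mult.assoc)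
    then have comb: "scale_fun C c s = (\<Sum>j\<le>r. scale_fun C ((\<lambda>i. c * x i) j) (f j))" for c
      by simp
    show ?thesis
    proof (intro equalityI subsetI)
      fix w assume "w \<in> line_of_coords C r f (proj_point x)"
      then obtain c where "w = (\<Sum>j\<le>r. scale_fun C ((\<lambda>i. c * x i) j) (f j))"
        by (auto simp: line_of_coords_def proj_point_def)
      then show "w \<in> fun_line C s" unfolding fun_line_def comb[symmetric] by blast
    next
      fix w assume "w \<in> fun_line C s"
      then obtain c where "w = scale_fun C c s" unfolding fun_line_def by blast
      then show "w \<in> line_of_coords C r f (proj_point x)"
        unfolding line_of_coords_def proj_point_def comb
        by (intro CollectI exI[of _ "\<lambda>i. c * x i"]) auto
    qed
  qed
  have eff: "0 \<le> add_div C D h Q" if "h \<in> sections C D" "h \<noteq> 0" "Q \<in> points C" for h Q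
    using that by (auto simp: sections_def)
  have red: "reduced_divisor C D P (add_div C D s)"
    unfolding reduced_divisor_def
  proof (intro conjI allI impI)
    show "lin_equiv C (add_div C D s) D" using snz by (auto simp: lin_equiv_def)
    show "effective_away C P (add_div C D s)" using eff[OF s snz] by (simp add: effective_away_def)
    fix D' assume D': "lin_equiv C D' D \<and> effective_away C P D'"
    then obtain h where h: "h \<noteq> 0" "D' = add_div C D h" by (auto simp: lin_equiv_def)
    show "D' P \<le> add_div C D s P"
    \<comment> \<open>A competitor that is nonnegative at P is effective everywhere and so comes
      from a section; any other loses to s, whose divisor is nonnegative at P.\<close>
    proof (cases "D' P \<ge> 0")
      case True
      then have "h \<in> sections C D"
        using D' h by (auto simp: sections_def effective_away_def)
      then show ?thesis using max'[OF _ h(1)] unfolding h(2) at_P by simp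
    next
      case False
      then show ?thesis using eff[OF s snz P] by simp
    qed
  qed
  have unique: "fun_line C h = fun_line C s"
    if h: "h \<in> sections C D" "h \<noteq> 0" "reduced_divisor C D P (add_div C D h)" for h
  proof -
    have "add_div C D s P \<le> add_div C D h P"
      using h(3) red unfolding reduced_divisor_def by blast
    then have o: "ord h = ord s" using max'[OF h(1,2)] unfolding at_P by simp
    define c where "c = v (h / s)"
    have u: "unit (h / s)" using unit_iff_ord[of "h / s"] h(2) snz o by (simp add: ord_divide)
    then have c: "c \<noteq> 0" by (simp add: c_def unit_def)
    have "h = const c * s"
    proof (rule ccontr)
      assume ne: "h \<noteq> const c * s"
      obtain b where b: "h = lincomb {..r} b f" using span h(1) by blast
      have "h - const c * s = (\<Sum>j\<le>r. const (b j - c * x j) * f j)"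
        unfolding b s_def sum_distrib_left sum_subtractf[symmetric]
        by (intro sum.cong refl) (simp add: const.hom_minus const.hom_mult algebra_simps)
      then have "h - const c * s \<in> sections C D"
        unfolding span by (intro exI[of _ "\<lambda>j. b j - c * x j"])
      then have 1: "ord (h - const c * s) \<le> ord s" using max' ne by simp
      have e: "(h - const c * s) / s = h / s - const c" using snz by (simp add: field_simps)
      have "v ((h - const c * s) / s) = 0" "(h - const c * s) / s \<in> \<O>"
        unfolding e using unit_in[OF u] by (simp_all add: c_def)
      then have "ord ((h - const c * s) / s) > 0"
        using v_eq_0_iff_ord[of "(h - const c * s) / s"] ne snz by simp
      then show False using 1 ne snz by (simp add: ord_divide)
    qed
    then have "h = scale_fun C c s" by (simp add: scale_fun_def)
    have "fun_line C h = {scale_fun C (d * c) s | d. True}"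
      unfolding \<open>h = scale_fun C c s\<close> fun_line_def scale_fun_def by (simp add: const.hom_mult mult.assoc)
    also have "\<dots> = fun_line C s"
    proof -
      have "scale_fun C d s = scale_fun C (d / c * c) s" for d using c by simp
      then show ?thesis unfolding fun_line_def by blast
    qed
    finally show ?thesis .
  qed
  have "reduced_map C D P = fun_line C s"
    unfolding reduced_map_def
    by (rule the_equality) (use s snz red unique in blast)+
  then show ?thesis using line by simp
qed

end

text \<open>The basis is given as a set, while the arguments above use families; injectivity of f
  transports coefficients between the two.\<close>

lemma sections_basisD:
  assumes "sections_basis C D r f"
  shows "h \<in> sections C D \<longleftrightarrow> (\<exists>b. h = lincomb {..r} b f)"
    and "const_independent {..r} f"
proof -
  interpret vs: vector_space "scale_fun C" by (rule scale_module)
  have inj: "inj_on f {..r}" and ind: "vs.independent (f ` {..r})" and sp: "vs.span (f ` {..r}) = sections C D"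
    using assms by (auto simp: sections_basis_def)
  have sum: "(\<Sum>w\<in>f ` {..r}. scale_fun C (u w) w) = (\<Sum>j\<le>r. const (u (f j)) * f j)" for u
    using inj by (simp add: sum.reindex scale_fun_def)
  have inv: "(\<Sum>j\<le>r. const (b (the_inv_into {..r} f (f j))) * f j) = lincomb {..r} b f" for b
    by (intro sum.cong refl) (simp add: the_inv_into_f_f[OF inj])
  have iff: "h \<in> sections C D \<longleftrightarrow> (\<exists>u. h = (\<Sum>j\<le>r. const (u (f j)) * f j))"
    unfolding sp[symmetric] vs.span_finite[OF finite_imageI[OF finite_atMost]] sum by auto
  show "h \<in> sections C D \<longleftrightarrow> (\<exists>b. h = lincomb {..r} b f)"
  proof
    assume "h \<in> sections C D"
    then obtain u where "h = (\<Sum>j\<le>r. const (u (f j)) * f j)" unfolding iff by blast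
    then show "\<exists>b. h = lincomb {..r} b f" by (intro exI[of _ "\<lambda>j. u (f j)"])
  next
    assume "\<exists>b. h = lincomb {..r} b f"
    then obtain b where "h = lincomb {..r} b f" by blast
    then have "h = (\<Sum>j\<le>r. const (b (the_inv_into {..r} f (f j))) * f j)"
      by (simp only: inv)
    then show "h \<in> sections C D"
      unfolding iff by (intro exI[of _ "\<lambda>w. b (the_inv_into {..r} f w)"])
  qed
  show "const_independent {..r} f"
    unfolding const_independent_def
  proof (intro allI impI ballI)
    fix b i assume b: "lincomb {..r} b f = 0" and i: "i \<in> {..r}"
    have "(\<Sum>w\<in>f ` {..r}. scale_fun C (b (the_inv_into {..r} f w)) w) = 0"
      unfolding sum inv by (rule b)
    then have "b (the_inv_into {..r} f (f i)) = 0"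
      by (rule vs.independentD[OF ind finite_imageI[OF finite_atMost] subset_refl]) (use i in auto)
    then show "b i = 0" using the_inv_into_f_f[OF inj i] by simp
  qed
qed

end

theorem theorem29:
  fixes C :: "('a::{alg_closed_field, field_char_0}, 'k::field) variety"
    and D :: "'a point \<Rightarrow> int"
    and r :: nat
    and f :: "nat \<Rightarrow> 'k"
  assumes "nonsingular_projective_curve C"
    and "divisor C D"
    and "divisor_rank C D = int r"
    and "sections_basis C D r f"
  shows "(\<exists>\<phi>. morphism_of_sections C D r (r * (r - 1) div 2) r (signed_wronskians C r f) \<phi>) \<and>
         (\<forall>\<phi>. morphism_of_sections C D r (r * (r - 1) div 2) r (signed_wronskians C r f) \<phi> \<longrightarrow>
            (\<forall>P\<in>points C. reduced_map C D P = line_of_coords C r f (\<phi> P)))"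
proof -
  interpret curve C by unfold_locales (fact assms(1))
  note span = sections_basisD(1)[OF assms(4)] and ind = sections_basisD(2)[OF assms(4)]
  have f: "f j \<in> sections C D" if "j \<le> r" for j
  proof -
    have "(\<Sum>i\<le>r. const_fun C (if i = j then 1 else 0) * f i) = (\<Sum>i\<le>r. if i = j then f i else 0)"
      by (intro sum.cong) auto
    then have "f j = (\<Sum>i\<le>r. const_fun C (if i = j then 1 else 0) * f i)" using that by simp
    then show ?thesis unfolding span by (intro exI[of _ "\<lambda>i. if i = j then 1 else 0"])
  qed
  have frame: "\<exists>\<tau> g. local_frame C D P \<tau> g" if "P \<in> points C" for P
    using curve_point.frame_exists[OF curve_pointI[OF that]] .
  show ?thesis
  proof (intro conjI allI impI ballI)
    show "\<exists>\<phi>. morphism_of_sections C D r (r * (r - 1) div 2) r (signed_wronskians C r f) \<phi>"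
      using points_nonempty frame extension_is_morphism_of_sections[OF assms(2) f ind] by blast
    fix \<phi> P
    assume \<phi>: "morphism_of_sections C D r (r * (r - 1) div 2) r (signed_wronskians C r f) \<phi>" and P: "P \<in> points C"
    \<comment> \<open>The frame is taken at P itself: by uniqueness \<phi> agrees with the extension
      formed in any frame, and for this one the maximality of the order at P is known.\<close>
    obtain \<tau> g where fr: "local_frame C D P \<tau> g" using frame[OF P] by blast
    obtain x where x: "\<exists>i\<le>r. x i \<noteq> 0" "extension r (\<lambda>i. signed_wronskians C r f i P \<tau> g) P = proj_point x"
      "\<And>b. (\<Sum>j\<le>r. const_fun C (b j) * f j) \<noteq> 0 \<Longrightarrow>
        ord_at C P (\<Sum>j\<le>r. const_fun C (b j) * f j) \<le> ord_at C P (\<Sum>j\<le>r. const_fun C (x j) * f j)"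
      using extension_maximal_order[OF assms(2) f ind P fr] by blast
    have "\<phi> P = proj_point x"
      using morphism_of_sections_unique[OF assms(2) f ind fr \<phi> P] x(2) by simp
    then show "reduced_map C D P = line_of_coords C r f (\<phi> P)"
      using reduced_map_eq[OF assms(2) f ind P span x(1,3)] by simp
  qed
qed

end
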